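(* Let $n\ge 2$, let $\Omega\subset\mathbb R^n$ be a smooth bounded domain, let $V$ be a potential on $\Omega$, and let $K$ be a compact set included in $\Omega$. Assume that $\mathrm{Cap}_{V,\infty}(K)=0$. Then there exists a sequence $(\psi_j)_j$, $\psi_j\in C^2_c(\Omega)$, such that: 1. $\psi_j(x)\to 0$ as $j\to+\infty$ for a.e. $x\in\Omega$ and $\psi_j\to0$ strongly in $L^1(\Omega)$; $\psi_j=1$ on $K$; and $\dfrac{|\nabla\psi_j|}{\sqrt V}\to 0$ and $\dfrac{\Delta\psi_j}{V}\to0$ strongly in $L^\infty(\Omega)$. 2. If furthermore $V\in L^{\frac n2,1}_{loc}(\Omega_K)$ with $\Omega_K=\{x\in\Omega:\ \mathrm{dist}(x;K)>0\}$, then for all $x\in\Omega\setminus K$, $\psi_j(x)\to0$ as $j\to+\infty$; more precisely, if $\Omega_{K,0}$ is an open set with $\Omega_{K,0}\subset\subset\Omega_K$, then $$\max_{\overline\Omega_{K,0}}|\psi_j(x)|\xrightarrow[j\to+\infty]{}0,\qquad \|\nabla\psi_j\|_{L^{n,1}(\Omega_{K,0})}\xrightarrow[j\to+\infty]{}0 .$$ Moreover: 3. If $a\in\Omega$, $m>0$ and $V_0(x)=|x-a|^{-m}$ for $x\in\Omega$, then $V_0\in L^{\frac n2,1}(\Omega)$ if and only if $m<2$.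
   Context: A potential on $\Omega$ is a measurable function $V:\Omega\to[0,+\infty]$ that is not identically zero (a.e.). For $\psi\in C^2_c(\Omega)$, $$\|\psi\|_{V,\infty}=\|\psi\|_{L^1(\Omega)}+\Big\|\frac{\nabla\psi}{\sqrt V}\Big\|_{L^\infty(\Omega)}+\Big\|\frac{\Delta\psi}{V}\Big\|_{L^\infty(\Omega)}\in[0,+\infty],$$ where a quotient is taken to be $0$ where its numerator vanishes or where $V=+\infty$, and to be $+\infty$ in absolute value where $V=0$ and the numerator is nonzero. For a compact $K\subset\Omega$, $$\mathbb B^2_K=\{\psi\in C^2_c(\Omega):\ 0\le\psi\le1,\ \psi=1\text{ in a neighborhood of }K\},\qquad \mathrm{Cap}_{V,\infty}(K)=\inf\{\|\psi\|_{V,\infty}:\ \psi\in\mathbb B^2_K\}.$$ Lorentz spaces: for $u$ measurable on a bounded open set $\Omega$, let $|u|_*$ be the decreasing rearrangement of $|u|$ on $(0,|\Omega|)$, i.e. $|u|_*(s)=\inf\{t:\ |\{|u|>t\}|\le s\}$, and $|u|_{**}(t)=\frac1t\int_0^t|u|_*(\sigma)\,d\sigma$. For $1\le p<+\infty$, $0<q<+\infty$, $L^{p,q}(\Omega)$ is the set of measurable $u$ with $\|u\|_{L^{p,q}}=\Big[\frac1{|\Omega|}\int_0^{|\Omega|}\big(t^{1/p}|u|_{**}(t)\big)^q\frac{dt}t\Big]^{1/q}<+\infty$. $A\subset\subset B$ means that $\overline A$ is a compact subset of $B$. *)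

theory Defs
  imports "HOL-Analysis.Analysis" "HOL-Probability.Essential_Supremum"
begin

section \<open>Functions of class C^k, gradient and Laplacian\<close>

definition partial_deriv :: "'a::euclidean_space \<Rightarrow> ('a \<Rightarrow> real) \<Rightarrow> 'a \<Rightarrow> real" where
  "partial_deriv b f x = frechet_derivative f (at x) b"

(* Meant for open S: the derivatives are taken at x in the whole space. *)
primrec Ck_on :: "nat \<Rightarrow> ('a::euclidean_space \<Rightarrow> real) \<Rightarrow> 'a set \<Rightarrow> bool" where
  "Ck_on 0 f S \<longleftrightarrow> continuous_on S f"
| "Ck_on (Suc k) f S \<longleftrightarrow>
     (\<forall>x\<in>S. f differentiable (at x)) \<and> (\<forall>b\<in>Basis. Ck_on k (partial_deriv b f) S)"

definition gradient :: "('a::euclidean_space \<Rightarrow> real) \<Rightarrow> 'a \<Rightarrow> 'a" where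
  "gradient f x = (\<Sum>b\<in>Basis. partial_deriv b f x *\<^sub>R b)"

definition laplacian :: "('a::euclidean_space \<Rightarrow> real) \<Rightarrow> 'a \<Rightarrow> real" where
  "laplacian f x = (\<Sum>b\<in>Basis. partial_deriv b (partial_deriv b f) x)"

section \<open>Smooth bounded domains\<close>

(* Near each boundary point the set is the sublevel set of a C^infinity function without
   critical points, so that it lies locally on one side of a smooth hypersurface. *)
definition smooth_boundary :: "'a::euclidean_space set \<Rightarrow> bool" where
  "smooth_boundary \<Omega> \<longleftrightarrow>
     (\<forall>z\<in>frontier \<Omega>. \<exists>U \<rho>. open U \<and> z \<in> U \<and> (\<forall>k. Ck_on k \<rho> U) \<and>
        (\<forall>x\<in>U. gradient \<rho> x \<noteq> 0) \<and> \<Omega> \<inter> U = {x\<in>U. \<rho> x < 0})"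

definition smooth_bounded_domain :: "'a::euclidean_space set \<Rightarrow> bool" where
  "smooth_bounded_domain \<Omega> \<longleftrightarrow>
     \<Omega> \<noteq> {} \<and> open \<Omega> \<and> connected \<Omega> \<and> bounded \<Omega> \<and> smooth_boundary \<Omega>"

definition compactly_inside :: "'a::topological_space set \<Rightarrow> 'a set \<Rightarrow> bool" where
  "compactly_inside A B \<longleftrightarrow> compact (closure A) \<and> closure A \<subseteq> B"

(* Compactly supported functions on \<Omega> are extended by zero to the whole space. *)
definition C2c :: "'a::euclidean_space set \<Rightarrow> ('a \<Rightarrow> real) set" where
  "C2c \<Omega> = {\<psi>. Ck_on 2 \<psi> UNIV \<and> compactly_inside {x. \<psi> x \<noteq> 0} \<Omega>}"

section \<open>Potentials and capacity\<close>

(* Only the values on \<Omega> matter; measurable means Lebesgue measurable. *)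
definition potential :: "'a::euclidean_space set \<Rightarrow> ('a \<Rightarrow> ennreal) \<Rightarrow> bool" where
  "potential \<Omega> V \<longleftrightarrow>
     V \<in> borel_measurable (lebesgue_on \<Omega>) \<and> \<not> (AE x in lebesgue_on \<Omega>. V x = 0)"

(* Meant for r > 0; in particular 0 is sent to 0. *)
definition enn_powr :: "ennreal \<Rightarrow> real \<Rightarrow> ennreal" where
  "enn_powr x r = (if x = \<infinity> then \<infinity> else ennreal (enn2real x powr r))"

(* Division in ennreal already follows the convention for quotients by a potential. *)
lemma quotient_convention:
  fixes v :: ennreal and a :: real
  shows "ennreal 0 / v = 0"
    and "ennreal a / \<infinity> = 0"
    and "a > 0 \<Longrightarrow> ennreal a / 0 = \<infinity>"
  by (simp_all add: divide_ennreal_def ennreal_mult_eq_top_iff)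

definition grad_quot :: "('a::euclidean_space \<Rightarrow> ennreal) \<Rightarrow> ('a \<Rightarrow> real) \<Rightarrow> 'a \<Rightarrow> ennreal" where
  "grad_quot V \<psi> x = ennreal (norm (gradient \<psi> x)) / enn_powr (V x) (1/2)"

definition lap_quot :: "('a::euclidean_space \<Rightarrow> ennreal) \<Rightarrow> ('a \<Rightarrow> real) \<Rightarrow> 'a \<Rightarrow> ennreal" where
  "lap_quot V \<psi> x = ennreal \<bar>laplacian \<psi> x\<bar> / V x"

definition L1_norm :: "'a::euclidean_space set \<Rightarrow> ('a \<Rightarrow> real) \<Rightarrow> ennreal" where
  "L1_norm \<Omega> \<psi> = (\<integral>\<^sup>+ x. ennreal \<bar>\<psi> x\<bar> \<partial>lebesgue_on \<Omega>)"

(* The argument is the absolute value |u| of the function u. *)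
definition Linf_norm :: "'a::euclidean_space set \<Rightarrow> ('a \<Rightarrow> ennreal) \<Rightarrow> ennreal" where
  "Linf_norm \<Omega> u = esssup (lebesgue_on \<Omega>) u"

definition Linf_tendsto_0 :: "'a::euclidean_space set \<Rightarrow> (nat \<Rightarrow> 'a \<Rightarrow> ennreal) \<Rightarrow> bool" where
  "Linf_tendsto_0 \<Omega> u \<longleftrightarrow>
     (\<forall>j. Linf_norm \<Omega> (u j) < \<infinity>) \<and> (\<lambda>j. Linf_norm \<Omega> (u j)) \<longlonglongrightarrow> 0"

definition V_inf_norm ::
    "'a::euclidean_space set \<Rightarrow> ('a \<Rightarrow> ennreal) \<Rightarrow> ('a \<Rightarrow> real) \<Rightarrow> ennreal" where
  "V_inf_norm \<Omega> V \<psi> =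
     L1_norm \<Omega> \<psi> + Linf_norm \<Omega> (grad_quot V \<psi>) + Linf_norm \<Omega> (lap_quot V \<psi>)"

definition B2 :: "'a::euclidean_space set \<Rightarrow> 'a set \<Rightarrow> ('a \<Rightarrow> real) set" where
  "B2 \<Omega> K = {\<psi> \<in> C2c \<Omega>. (\<forall>x. 0 \<le> \<psi> x \<and> \<psi> x \<le> 1) \<and>
                       (\<exists>U. open U \<and> K \<subseteq> U \<and> (\<forall>x\<in>U. \<psi> x = 1))}"

definition Cap_inf :: "'a::euclidean_space set \<Rightarrow> ('a \<Rightarrow> ennreal) \<Rightarrow> 'a set \<Rightarrow> ennreal" where
  "Cap_inf \<Omega> V K = (INF \<psi>\<in>B2 \<Omega> K. V_inf_norm \<Omega> V \<psi>)"

(* The distance to the empty set is infinite, whereas infdist x {} = 0. *)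
definition away_from :: "'a::euclidean_space set \<Rightarrow> 'a set \<Rightarrow> 'a set" where
  "away_from \<Omega> K = {x\<in>\<Omega>. K = {} \<or> infdist x K > 0}"

section \<open>Lorentz spaces\<close>

(* Throughout, u stands for the absolute value of the function, and \<Omega> is open and bounded.
   For 0 < s < |\<Omega>| the infimum over all real t in the decreasing rearrangement is a
   nonnegative one, so t may be taken in [0,\<infinity>]. *)
definition rearr :: "'a::euclidean_space set \<Rightarrow> ('a \<Rightarrow> ennreal) \<Rightarrow> real \<Rightarrow> ennreal" where
  "rearr \<Omega> u s = Inf {t. emeasure lebesgue {x\<in>\<Omega>. u x > t} \<le> ennreal s}"

definition rearr_avg :: "'a::euclidean_space set \<Rightarrow> ('a \<Rightarrow> ennreal) \<Rightarrow> real \<Rightarrow> ennreal" where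
  "rearr_avg \<Omega> u t = 1 / ennreal t * (\<integral>\<^sup>+ \<sigma>\<in>{0<..<t}. rearr \<Omega> u \<sigma> \<partial>lborel)"

definition lorentz_norm ::
    "real \<Rightarrow> real \<Rightarrow> 'a::euclidean_space set \<Rightarrow> ('a \<Rightarrow> ennreal) \<Rightarrow> ennreal" where
  "lorentz_norm p q \<Omega> u =
     enn_powr (1 / emeasure lebesgue \<Omega> *
       (\<integral>\<^sup>+ t\<in>{0<..<measure lebesgue \<Omega>}.
          enn_powr (ennreal (t powr (1/p)) * rearr_avg \<Omega> u t) q / ennreal t \<partial>lborel)) (1/q)"

definition lorentz :: "real \<Rightarrow> real \<Rightarrow> 'a::euclidean_space set \<Rightarrow> ('a \<Rightarrow> ennreal) set" where
  "lorentz p q \<Omega> =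
     {u. u \<in> borel_measurable (lebesgue_on \<Omega>) \<and> lorentz_norm p q \<Omega> u < \<infinity>}"

definition lorentz_loc :: "real \<Rightarrow> real \<Rightarrow> 'a::euclidean_space set \<Rightarrow> ('a \<Rightarrow> ennreal) set" where
  "lorentz_loc p q U = {u. \<forall>W. open W \<and> compactly_inside W U \<longrightarrow> u \<in> lorentz p q W}"

end

theory Submission
  imports Defs
begin

text \<open>
  Part 1 is the definition of the capacity. Admissible functions \<open>\<psi>\<^sub>j\<close> with norm below \<open>2^-j\<close> exist,
  all three terms of the norm then tend to 0, and because the \<open>L\<^sup>1\<close> norms are summable,
  \<open>\<Sum>\<^sub>j \<psi>\<^sub>j\<close> is finite almost everywhere, which gives pointwise convergence.

  Part 2 is a regularity argument. With \<open>\<epsilon>\<^sub>j = 2^-j\<close> one has \<open>|\<Delta>\<psi>\<^sub>j| \<le> \<epsilon>\<^sub>j V\<close> and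
  \<open>|\<nabla>\<psi>\<^sub>j| \<le> \<epsilon>\<^sub>j sqrt V \<le> \<epsilon>\<^sub>j (1 + V)\<close> almost everywhere. Multiply \<open>\<psi>\<^sub>j\<close> by a \<open>C\<^sup>2\<close> cutoff \<open>B\<close> that is
  positive on the given compact set and supported away from \<open>K\<close>. For \<open>u\<^sub>j = B \<psi>\<^sub>j\<close> the product rule gives
  \<open>|\<Delta>u\<^sub>j| \<le> M (2 \<epsilon>\<^sub>j V + \<epsilon>\<^sub>j + \<psi>\<^sub>j)\<close>, so \<open>\<Delta>u\<^sub>j\<close> tends to 0 in \<open>L^(n/2,1)\<close>
  (\<open>lorentz_int_laplacian_cutoff\<close>). Now let \<open>I f\<close> be the Riesz potential of order one, the convolution of
  \<open>f\<close> with \<open>|z|^(1-n)\<close>. Up to constants,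
  \<open>|\<partial>\<^sub>i u| \<le> I |\<Delta>u|\<close> (\<open>partial_deriv_le_riesz_pot_laplacian\<close>) and \<open>|u| \<le> I |\<nabla>u|\<close>
  (\<open>le_riesz_pot_gradient\<close>), while \<open>I\<close> maps \<open>L^(n/2,1)\<close> to \<open>L^(n,1)\<close> (\<open>lorentz_int_riesz_pot\<close>) and
  \<open>L^(n,1)\<close> to bounded functions (\<open>riesz_pot_le_lorentz_int\<close>). Hence \<open>\<nabla>u\<^sub>j\<close> tends to 0 in \<open>L^(n,1)\<close> and
  \<open>u\<^sub>j\<close> uniformly, and dividing by \<open>B\<close> transfers this to \<open>\<psi>\<^sub>j\<close> (\<open>local_convergence\<close>). Only the gradient
  of the fundamental solution occurs, so the logarithmic case \<open>n = 2\<close> is not special.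

  Rearrangements are removed at the start. Writing \<open>\<mu>(l)\<close> for the measure of \<open>{u > l}\<close>, one has
  \<open>t u\<^sub>*\<^sub>*(t) = \<integral> min(\<mu>(l), t) dl\<close>, so for \<open>q = 1\<close> the Lorentz norm is \<open>\<integral> \<Psi>(\<mu>(l)) dl / |W|\<close> with an
  increasing subadditive weight \<open>\<Psi>\<close> (\<open>lorentz_norm_1_eq\<close>). Monotonicity, the quasi-triangle inequality and
  the mapping property of \<open>I\<close> are then checked level by level. Part 3 is the same formula for
  \<open>\<mu>(l) = c l^(-n/m)\<close>.
\<close>

section \<open>The Lorentz norm as an integral over levels\<close>

definition distr_fun :: "'a::euclidean_space set \<Rightarrow> ('a \<Rightarrow> ennreal) \<Rightarrow> real \<Rightarrow> ennreal" where
  "distr_fun W u l = emeasure lebesgue {x\<in>W. u x > ennreal l}"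

text \<open>Up to the factor \<open>1/T\<close>, this is the \<open>L^(p,1)\<close> norm, on a set of measure \<open>T\<close>, of the indicator function of
  a subset of measure \<open>s\<close>: its averaged rearrangement at \<open>t\<close> is \<open>min(s,t)/t\<close>.\<close>

definition lorentz_weight :: "real \<Rightarrow> real \<Rightarrow> ennreal \<Rightarrow> ennreal" where
  "lorentz_weight p T s = (\<integral>\<^sup>+ t\<in>{0<..<T}. ennreal (t powr (1/p - 2)) * min s (ennreal t) \<partial>lborel)"

lemma superlevel_measurable:
  fixes u :: "'a::euclidean_space \<Rightarrow> ennreal"
  assumes "u \<in> borel_measurable (lebesgue_on W)" "W \<in> sets lebesgue"
  shows "{x\<in>W. u x > c} \<in> sets lebesgue"
proof -
  have "{x\<in>space (lebesgue_on W). u x > c} \<in> sets (lebesgue_on W)"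
    using assms by measurable
  thus ?thesis using assms(2)
    by (auto simp: space_restrict_space sets_restrict_space_iff)
qed

lemma distr_fun_antimono:
  assumes "u \<in> borel_measurable (lebesgue_on W)" "W \<in> sets lebesgue" "l \<le> l'"
  shows "distr_fun W u l' \<le> distr_fun W u l"
  unfolding distr_fun_def
  by (rule emeasure_mono[OF _ superlevel_measurable[OF assms(1,2)]])
     (use assms(3) in \<open>auto intro: le_less_trans ennreal_leI\<close>)

lemma measurable_antimono_ennreal:
  fixes f :: "real \<Rightarrow> ennreal"
  assumes "\<And>x y. x \<le> y \<Longrightarrow> f y \<le> f x"
  shows "f \<in> borel_measurable borel"
proof (rule borel_measurableI_greater)
  fix y
  have "is_interval {x. y < f x}"
    unfolding is_interval_1 using assms by (auto intro: less_le_trans)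
  hence "{x. y < f x} \<in> sets borel"
    by (rule real_interval_borel_measurable)
  thus "{x \<in> space borel. y < f x} \<in> sets borel" by simp
qed

lemma distr_fun_borel[measurable]:
  assumes "u \<in> borel_measurable (lebesgue_on W)" "W \<in> sets lebesgue"
  shows "distr_fun W u \<in> borel_measurable borel"
  by (rule measurable_antimono_ennreal) (rule distr_fun_antimono[OF assms])

lemma emeasure_positive_below:
  "emeasure lborel {l::real. 0 < l \<and> ennreal l < r} = r"
proof (cases r)
  case (real c)
  have "{l::real. 0 < l \<and> ennreal l < r} = {0<..<c}"
    using real by (auto simp: ennreal_less_iff)
  thus ?thesis using real by simp
next
  case top
  have "{l::real. 0 < l \<and> ennreal l < r} = {0<..}"
    using top by auto
  moreover have "emeasure lborel {0::real<..} = \<infinity>"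
  proof (rule ccontr)
    assume "\<not> ?thesis"
    then obtain c where c: "emeasure lborel {0::real<..} = ennreal c" "c \<ge> 0" by (cases "emeasure lborel {0::real<..}") auto
    have "emeasure lborel {0<..<c+1} \<le> emeasure lborel {0::real<..}"
      by (rule emeasure_mono) auto
    thus False using c by (simp add: ennreal_le_iff del: ennreal_plus)
  qed
  ultimately show ?thesis using top by simp
qed

lemma nn_integral_below: "(\<integral>\<^sup>+ l\<in>{0<..}. indicator {l. ennreal l < r} l \<partial>lborel) = r"
proof -
  have "(\<integral>\<^sup>+ l\<in>{0<..}. indicator {l. ennreal l < r} l \<partial>lborel)
      = (\<integral>\<^sup>+ l. indicator {l::real. 0 < l \<and> ennreal l < r} l \<partial>lborel)"
    by (intro nn_integral_cong) (auto simp: indicator_def)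
  also have "\<dots> = r"
    by (subst nn_integral_indicator) (auto simp: emeasure_positive_below)
  finally show ?thesis .
qed

text \<open>The rearrangement and the distribution function are generalised inverses of each other, so
  \<open>l < u\<^sub>*(s)\<close> and \<open>s < \<mu>(l)\<close> agree for all \<open>l\<close> except possibly \<open>l = u\<^sub>*(s)\<close>.\<close>

lemma layer_cake_rearr:
  assumes "u \<in> borel_measurable (lebesgue_on W)" "W \<in> sets lebesgue"
  shows "rearr W u s = (\<integral>\<^sup>+ l\<in>{0<..}. indicator {l. ennreal s < distr_fun W u l} l \<partial>lborel)"
proof -
  have *: "(ennreal l < rearr W u s) = (ennreal s < distr_fun W u l)"
    if l: "l \<noteq> enn2real (rearr W u s)" "l > 0" for l
  proof
    assume "ennreal l < rearr W u s"
    thus "ennreal s < distr_fun W u l"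
      using Inf_lower[of "ennreal l" "{t. emeasure lebesgue {x \<in> W. t < u x} \<le> ennreal s}"]
      unfolding rearr_def distr_fun_def by (meson leD leI mem_Collect_eq)
  next
    assume a: "ennreal s < distr_fun W u l"
    show "ennreal l < rearr W u s"
    proof (rule ccontr)
      assume "\<not> ?thesis"
      hence "rearr W u s \<le> ennreal l" by simp
      moreover have "rearr W u s \<noteq> ennreal l" using l by auto
      ultimately have "rearr W u s < ennreal l" by simp
      then obtain t where t: "emeasure lebesgue {x\<in>W. u x > t} \<le> ennreal s" "t < ennreal l"
        unfolding rearr_def Inf_less_iff by blast
      have "distr_fun W u l \<le> emeasure lebesgue {x\<in>W. u x > t}"
        unfolding distr_fun_def
        by (rule emeasure_mono[OF _ superlevel_measurable[OF assms(1,2)]])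
           (use t(2) in \<open>auto intro: less_trans\<close>)
      thus False using t a by simp
    qed
  qed
  have "rearr W u s = (\<integral>\<^sup>+ l\<in>{0<..}. indicator {l. ennreal l < rearr W u s} l \<partial>lborel)"
    by (simp add: nn_integral_below)
  also have "\<dots> = (\<integral>\<^sup>+ l\<in>{0<..}. indicator {l. ennreal s < distr_fun W u l} l \<partial>lborel)"
  proof (rule nn_integral_cong_AE)
    \<comment> \<open>The exceptional level is a single point, hence negligible.\<close>
    have "AE l in lborel. l \<noteq> enn2real (rearr W u s)"
      by (rule AE_lborel_singleton)
    thus "AE x in lborel. indicator {l. ennreal l < rearr W u s} x * indicator {0<..} x
       = (indicator {l. ennreal s < distr_fun W u l} x * indicator {0<..} x :: ennreal)"
      by eventually_elim (auto simp: indicator_def *)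
  qed
  finally show ?thesis .
qed

text \<open>Exchange the integrals over \<open>\<sigma>\<close> and \<open>l\<close>: the set of \<open>\<sigma>\<close> in \<open>(0,t)\<close> with \<open>\<sigma> < \<mu>(l)\<close> has
  length \<open>min(\<mu>(l), t)\<close>.\<close>

lemma nn_integral_rearr:
  assumes [measurable]: "u \<in> borel_measurable (lebesgue_on W)" "W \<in> sets lebesgue"
  assumes "t > 0"
  shows "(\<integral>\<^sup>+ \<sigma>\<in>{0<..<t}. rearr W u \<sigma> \<partial>lborel) = (\<integral>\<^sup>+ l\<in>{0<..}. min (distr_fun W u l) (ennreal t) \<partial>lborel)"
proof -
  let ?i = "\<lambda>\<sigma> l. indicator {0<..<t} \<sigma> * indicator {0<..} l * (if ennreal \<sigma> < distr_fun W u l then 1 else (0::ennreal))"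
  have [measurable]: "distr_fun W u \<in> borel_measurable borel" by (rule distr_fun_borel[OF assms(1,2)])
  have "(\<integral>\<^sup>+ \<sigma>\<in>{0<..<t}. rearr W u \<sigma> \<partial>lborel)
     = (\<integral>\<^sup>+ \<sigma>. (\<integral>\<^sup>+ l. ?i \<sigma> l \<partial>lborel) \<partial>lborel)"
    unfolding layer_cake_rearr[OF assms(1,2)]
  proof (intro nn_integral_cong)
    fix \<sigma> :: real
    show "(\<integral>\<^sup>+ l\<in>{0<..}. indicator {l. ennreal \<sigma> < distr_fun W u l} l \<partial>lborel) * indicator {0<..<t} \<sigma> =
      (\<integral>\<^sup>+ l. ?i \<sigma> l \<partial>lborel)"
      by (subst nn_integral_multc[symmetric]) (auto intro!: nn_integral_cong simp: indicator_def)
  qed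
  also have "\<dots> = (\<integral>\<^sup>+ l. (\<integral>\<^sup>+ \<sigma>. ?i \<sigma> l \<partial>lborel) \<partial>lborel)"
    by (rule lborel_pair.Fubini') simp
  also have "\<dots> = (\<integral>\<^sup>+ l\<in>{0<..}. min (distr_fun W u l) (ennreal t) \<partial>lborel)"
  proof (intro nn_integral_cong)
    fix l :: real
    have "(\<integral>\<^sup>+ \<sigma>. ?i \<sigma> l \<partial>lborel)
       = (\<integral>\<^sup>+ \<sigma>. indicator {0<..} l * indicator {\<sigma>. 0 < \<sigma> \<and> ennreal \<sigma> < min (distr_fun W u l) (ennreal t)} \<sigma> \<partial>lborel)"
      by (intro nn_integral_cong) (use \<open>t>0\<close> in \<open>auto simp: indicator_def ennreal_less_iff\<close>)
    also have "\<dots> = indicator {0<..} l * min (distr_fun W u l) (ennreal t)"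
      by (subst nn_integral_cmult_indicator) (auto simp: emeasure_positive_below simp del: min_less_iff_conj)
    finally show "(\<integral>\<^sup>+ \<sigma>. ?i \<sigma> l \<partial>lborel)
      = min (distr_fun W u l) (ennreal t) * indicator {0<..} l" by (simp add: mult.commute)
  qed
  finally show ?thesis .
qed

lemma enn_powr_1[simp]: "enn_powr x 1 = x"
  unfolding enn_powr_def by (cases x) auto

lemma lorentz_weight_mono: "s \<le> s' \<Longrightarrow> lorentz_weight p T s \<le> lorentz_weight p T s'"
  unfolding lorentz_weight_def
  by (intro nn_integral_mono mult_right_mono mult_left_mono min.mono) auto

text \<open>This formula replaces rearrangements by distribution functions in everything that follows.\<close>

lemma lorentz_norm_1_eq:
  assumes [measurable]: "u \<in> borel_measurable (lebesgue_on W)" "W \<in> sets lebesgue"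
  shows "lorentz_norm p 1 W u = 1 / emeasure lebesgue W *
    (\<integral>\<^sup>+ l\<in>{0<..}. lorentz_weight p (measure lebesgue W) (distr_fun W u l) \<partial>lborel)"
proof -
  define T where "T = measure lebesgue W"
  let ?i = "\<lambda>t l. indicator {0<..<T} t * ennreal (t powr (1/p - 2)) * (min (distr_fun W u l) (ennreal t) * indicator {0<..} l)"
  have [measurable]: "distr_fun W u \<in> borel_measurable borel" by (rule distr_fun_borel[OF assms(1,2)])
  have "(\<integral>\<^sup>+ t\<in>{0<..<T}. enn_powr (ennreal (t powr (1/p)) * rearr_avg W u t) 1 / ennreal t \<partial>lborel)
     = (\<integral>\<^sup>+ t. (\<integral>\<^sup>+ l. ?i t l \<partial>lborel) \<partial>lborel)"
  proof (intro nn_integral_cong)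
    fix t :: real
    show "enn_powr (ennreal (t powr (1/p)) * rearr_avg W u t) 1 / ennreal t * indicator {0<..<T} t =
      (\<integral>\<^sup>+ l. ?i t l \<partial>lborel)"
    proof (cases "0 < t \<and> t < T")
      case True
      define R where "R = (\<integral>\<^sup>+ l\<in>{0<..}. min (distr_fun W u l) (ennreal t) \<partial>lborel)"
      have "enn_powr (ennreal (t powr (1/p)) * rearr_avg W u t) 1 / ennreal t
         = (ennreal (t powr (1/p)) * inverse (ennreal t) * inverse (ennreal t)) * R"
        unfolding enn_powr_1 rearr_avg_def nn_integral_rearr[OF assms True[THEN conjunct1]] R_def[symmetric] divide_ennreal_def
        by (simp add: mult_ac)
      also have "ennreal (t powr (1/p)) * inverse (ennreal t) * inverse (ennreal t) = ennreal (t powr (1/p) * inverse t * inverse t)"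
        using True by (simp add: inverse_ennreal ennreal_mult)
      also have "t powr (1/p) * inverse t * inverse t = t powr (1/p - 2)"
        using True by (simp add: powr_diff field_simps power2_eq_square)
      finally show ?thesis using True unfolding R_def
        by (simp add: nn_integral_cmult)
    qed (auto simp: indicator_def)
  qed
  also have "\<dots> = (\<integral>\<^sup>+ l. (\<integral>\<^sup>+ t. ?i t l \<partial>lborel) \<partial>lborel)"
    by (rule lborel_pair.Fubini') simp
  also have "\<dots> = (\<integral>\<^sup>+ l\<in>{0<..}. lorentz_weight p T (distr_fun W u l) \<partial>lborel)"
    unfolding lorentz_weight_def
    by (intro nn_integral_cong, subst nn_integral_multc[symmetric]) (auto intro!: nn_integral_cong simp: mult_ac)
  finally show ?thesis unfolding lorentz_norm_def T_def[symmetric] by simp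
qed

section \<open>The weight and its quasi-norm\<close>

lemma nn_integral_powr_from_0:
  assumes "a > 0" "T \<ge> 0"
  shows "(\<integral>\<^sup>+ t\<in>{0<..<T}. ennreal (t powr (a - 1)) \<partial>lborel) = ennreal (T powr a / a)"
proof -
  have "((\<lambda>x. x powr (a - 1)) has_integral (T powr (a - 1 + 1) / (a - 1 + 1))) {0..T}"
    by (rule has_integral_powr_from_0) (use assms in auto)
  hence "(\<integral>\<^sup>+ t. ennreal (t powr (a - 1)) * indicator {0..T} t \<partial>lborel) = ennreal (T powr (a - 1 + 1) / (a - 1 + 1))"
    by (intro nn_integral_has_integral_lebesgue') auto
  moreover have "(\<integral>\<^sup>+ t\<in>{0<..<T}. ennreal (t powr (a - 1)) \<partial>lborel)
      = (\<integral>\<^sup>+ t. ennreal (t powr (a - 1)) * indicator {0..T} t \<partial>lborel)"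
  proof (rule nn_integral_cong_AE)
    have "AE t in lborel. t \<noteq> 0 \<and> t \<noteq> T"
      using AE_lborel_singleton[of 0] AE_lborel_singleton[of T] by eventually_elim auto
    thus "AE t in lborel. ennreal (t powr (a - 1)) * indicator {0<..<T} t = ennreal (t powr (a - 1)) * indicator {0..T} t"
      by eventually_elim (auto simp: indicator_def)
  qed
  ultimately show ?thesis by simp
qed

lemma nn_integral_powr_to_infinity:
  assumes "q > 1" "c > 0"
  shows "(\<integral>\<^sup>+ t\<in>{c..}. ennreal (t powr (-q)) \<partial>lborel) = ennreal (c powr (1 - q) / (q - 1))"
proof -
  have "((\<lambda>x. x powr (-q)) has_integral -(c powr (-q + 1)) / (-q + 1)) {c..}"
    by (rule has_integral_powr_to_inf) (use assms in auto)
  hence "(\<integral>\<^sup>+ t. ennreal (t powr (-q)) * indicator {c..} t \<partial>lborel) = ennreal (-(c powr (-q + 1)) / (-q + 1))"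
    by (intro nn_integral_has_integral_lebesgue') auto
  also have "-(c powr (-q + 1)) / (-q + 1) = c powr (1 - q) / (q - 1)"
    using assms by (simp add: field_simps)
  finally show ?thesis .
qed

lemma nn_integral_inverse_to_infinity:
  assumes "c > 0"
  shows "(\<integral>\<^sup>+ t\<in>{c..}. ennreal (1 / t) \<partial>lborel) = \<infinity>"
proof (rule ccontr)
  assume "\<not> ?thesis"
  then obtain M where M: "(\<integral>\<^sup>+ t\<in>{c..}. ennreal (1 / t) \<partial>lborel) = ennreal M" "M \<ge> 0"
    by (cases "\<integral>\<^sup>+ t\<in>{c..}. ennreal (1 / t) \<partial>lborel") auto
  \<comment> \<open>Chosen so that the integral of \<open>1/t\<close> over \<open>[c,d]\<close> is \<open>M + 1\<close>.\<close>
  define d where "d = c * exp (M + 1)"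
  have cd: "c \<le> d" using assms M(2) unfolding d_def by (simp add: mult_le_cancel_left1)
  have "(\<integral>\<^sup>+ t. ennreal (1 / t) * indicator {c..d} t \<partial>lborel) = ennreal (ln d - ln c)"
    by (rule nn_integral_FTC_Icc) (use assms cd in \<open>auto intro!: derivative_eq_intros simp: has_real_derivative_iff_has_vector_derivative[symmetric]\<close>)
  also have "ln d - ln c = M + 1"
    using assms unfolding d_def by (simp add: ln_mult)
  finally have "ennreal (M + 1) = (\<integral>\<^sup>+ t. ennreal (1 / t) * indicator {c..d} t \<partial>lborel)" by simp
  also have "\<dots> \<le> (\<integral>\<^sup>+ t\<in>{c..}. ennreal (1 / t) \<partial>lborel)"
    by (intro nn_integral_mono) (auto simp: indicator_def)
  finally show False using M by (simp add: ennreal_le_iff del: ennreal_plus)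
qed

text \<open>Interpolation: \<open>min(s,t) \<le> s^b t^(1-b)\<close>, and the remaining power of \<open>t\<close> is integrable at 0
  exactly when \<open>b < 1/p\<close>. For \<open>p = n/2\<close> with \<open>n = 2\<close> the exponent \<open>b = 1/p\<close> is lost to a logarithm.\<close>

lemma lorentz_weight_le_powr:
  assumes "p > 0" "T \<ge> 0" "s \<ge> 0" "0 \<le> b" "b \<le> 1" "b < 1/p"
  shows "lorentz_weight p T (ennreal s) \<le> ennreal (T powr (1/p - b) / (1/p - b)) * ennreal (s powr b)"
proof -
  have "lorentz_weight p T (ennreal s) \<le> (\<integral>\<^sup>+ t\<in>{0<..<T}. ennreal (t powr ((1/p - b) - 1)) * ennreal (s powr b) \<partial>lborel)"
    unfolding lorentz_weight_def
  proof (intro nn_integral_mono)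
    fix t :: real
    show "ennreal (t powr (1/p - 2)) * min (ennreal s) (ennreal t) * indicator {0<..<T} t
      \<le> ennreal (t powr ((1/p - b) - 1)) * ennreal (s powr b) * indicator {0<..<T} t"
    proof (cases "0 < t \<and> t < T")
      case True
      have "min s t \<le> s powr b * t powr (1 - b)"
      proof (cases "s = 0")
        case True thus ?thesis by auto
      next
        case False
        have "min s t = min s t powr b * min s t powr (1 - b)"
          using False True assms by (simp flip: powr_add)
        also have "\<dots> \<le> s powr b * t powr (1 - b)"
          using True assms by (intro mult_mono powr_mono2) auto
        finally show ?thesis .
      qed
      hence "t powr (1/p - 2) * min s t \<le> t powr (1/p - 2) * (s powr b * t powr (1 - b))"
        by (intro mult_left_mono) auto
      also have "\<dots> = t powr (1/p - b - 1) * s powr b"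
      proof -
        have "t powr (1/p - 2) * t powr (1 - b) = t powr (1/p - b - 1)"
          by (subst powr_add[symmetric]) (simp add: algebra_simps)
        thus ?thesis by (metis mult.assoc mult.commute)
      qed
      finally have "ennreal (t powr (1/p - 2) * min s t) \<le> ennreal (t powr (1/p - b - 1) * s powr b)"
        by (rule ennreal_leI)
      moreover have "min (ennreal s) (ennreal t) = ennreal (min s t)"
        using True assms by (auto simp: min_def)
      ultimately show ?thesis using True assms by (simp add: ennreal_mult)
    qed auto
  qed
  also have "\<dots> = ennreal (s powr b) * (\<integral>\<^sup>+ t\<in>{0<..<T}. ennreal (t powr ((1/p - b) - 1)) \<partial>lborel)"
    by (subst nn_integral_cmult[symmetric]) (auto intro!: nn_integral_cong simp: mult_ac)
  also have "\<dots> = ennreal (s powr b) * ennreal (T powr (1/p - b) / (1/p - b))"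
    by (subst nn_integral_powr_from_0) (use assms in auto)
  finally show ?thesis by (simp add: mult.commute)
qed

text \<open>Keep only the part \<open>t < s\<close> of the integral.\<close>

lemma lorentz_weight_ge_powr:
  assumes "p > 0" "0 \<le> s" "s \<le> T"
  shows "ennreal (p * s powr (1/p)) \<le> lorentz_weight p T (ennreal s)"
proof -
  have "ennreal (p * s powr (1/p)) = (\<integral>\<^sup>+ t\<in>{0<..<s}. ennreal (t powr (1/p - 1)) \<partial>lborel)"
    by (subst nn_integral_powr_from_0) (use assms in \<open>auto simp: mult.commute\<close>)
  also have "\<dots> \<le> lorentz_weight p T (ennreal s)"
    unfolding lorentz_weight_def
  proof (intro nn_integral_mono)
    fix t :: real
    show "ennreal (t powr (1/p - 1)) * indicator {0<..<s} t
       \<le> ennreal (t powr (1/p - 2)) * min (ennreal s) (ennreal t) * indicator {0<..<T} t"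
    proof (cases "0 < t \<and> t < s")
      case True
      have "t powr (1/p - 1) = t powr (1/p - 2) * t powr 1"
        by (subst powr_add[symmetric]) (simp add: algebra_simps)
      hence "ennreal (t powr (1/p - 1)) = ennreal (t powr (1/p - 2)) * ennreal t"
        using True by (simp add: ennreal_mult)
      moreover have "min (ennreal s) (ennreal t) = ennreal t"
        using True by (simp add: min_def)
      ultimately show ?thesis using True assms by simp
    qed auto
  qed
  finally show ?thesis .
qed

lemma lorentz_weight_add:
  "lorentz_weight p T (s + s') \<le> lorentz_weight p T s + lorentz_weight p T s'"
proof -
  let ?i = "\<lambda>s t. ennreal (t powr (1/p - 2)) * min s (ennreal t) * indicator {0<..<T} t"
  have m: "min (s + s') c \<le> min s c + min s' c" for c :: ennreal
  proof (cases "s \<le> c \<and> s' \<le> c")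
    case True
    thus ?thesis by (simp add: min_absorb1)
  next
    case False
    hence "c \<le> min s c \<or> c \<le> min s' c" by (auto simp: min_def)
    thus ?thesis by (metis add_increasing add_increasing2 min.coboundedI2 zero_le)
  qed
  have "lorentz_weight p T (s + s') \<le> (\<integral>\<^sup>+ t. ?i s t
     + ?i s' t \<partial>lborel)"
    unfolding lorentz_weight_def
  proof (intro nn_integral_mono)
    fix t :: real
    have "ennreal (t powr (1/p - 2)) * min (s + s') (ennreal t)
       \<le> ennreal (t powr (1/p - 2)) * (min s (ennreal t) + min s' (ennreal t))"
      by (intro mult_left_mono m) simp
    thus "?i (s + s') t
       \<le> ?i s t
     + ?i s' t"
      by (cases "t \<in> {0<..<T}") (simp_all add: distrib_left)
  qed
  also have "\<dots> = lorentz_weight p T s + lorentz_weight p T s'"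
    unfolding lorentz_weight_def by (subst nn_integral_add) auto
  finally show ?thesis .
qed

lemma lorentz_weight_mono_domain: "T \<le> T' \<Longrightarrow> lorentz_weight p T s \<le> lorentz_weight p T' s"
  unfolding lorentz_weight_def
proof (rule nn_integral_mono)
  fix t assume "T \<le> T'"
  hence "indicator {0<..<T} t \<le> (indicator {0<..<T'} t :: ennreal)"
    by (simp add: indicator_def)
  thus "ennreal (t powr (1 / p - 2)) * min s (ennreal t) * indicator {0<..<T} t
      \<le> ennreal (t powr (1 / p - 2)) * min s (ennreal t) * indicator {0<..<T'} t"
    by (rule mult_left_mono) simp
qed

lemma lorentz_weight_borel[measurable]: "lorentz_weight p T \<in> borel_measurable borel"
  unfolding lorentz_weight_def by measurable

text \<open>For \<open>T = |W|\<close> this is \<open>|W|\<close> times the \<open>L^(p,1)\<close> norm of \<open>u\<close> on \<open>W\<close>. The parameter \<open>T\<close> is free so that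
  functions on a set and on a larger set can be compared.\<close>

definition lorentz_int :: "real \<Rightarrow> real \<Rightarrow> 'a::euclidean_space set \<Rightarrow> ('a \<Rightarrow> ennreal) \<Rightarrow> ennreal" where
  "lorentz_int p T W u = (\<integral>\<^sup>+ l\<in>{0<..}. lorentz_weight p T (distr_fun W u l) \<partial>lborel)"

lemma lorentz_int_mono_distr:
  assumes "\<And>l. l > 0 \<Longrightarrow> distr_fun W u l \<le> distr_fun W' v l" "T \<le> T'"
  shows "lorentz_int p T W u \<le> lorentz_int p T' W' v"
  unfolding lorentz_int_def
proof (intro nn_integral_mono)
  fix l :: real
  show "lorentz_weight p T (distr_fun W u l) * indicator {0<..} l \<le> lorentz_weight p T' (distr_fun W' v l) * indicator {0<..} l"
    using assms(1)[of l] lorentz_weight_mono[of "distr_fun W u l" "distr_fun W' v l" p T]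
      lorentz_weight_mono_domain[OF assms(2), of p "distr_fun W' v l"]
    by (auto simp: indicator_def)
qed

lemma distr_fun_mono:
  assumes "u \<in> borel_measurable (lebesgue_on W)" "v \<in> borel_measurable (lebesgue_on W')"
    and "W \<in> sets lebesgue" "W' \<in> sets lebesgue" "W \<subseteq> W'"
    and "AE x in lebesgue. x \<in> W \<longrightarrow> u x \<le> v x"
  shows "distr_fun W u l \<le> distr_fun W' v l"
  unfolding distr_fun_def
proof (rule emeasure_mono_AE)
  show "{x \<in> W'. ennreal l < v x} \<in> sets lebesgue"
    using assms by (intro superlevel_measurable)
  show "AE x in lebesgue. x \<in> {x \<in> W. ennreal l < u x} \<longrightarrow> x \<in> {x \<in> W'. ennreal l < v x}"
    using assms(6) by eventually_elim (use assms(5) in auto)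
qed

lemma lorentz_int_scale:
  assumes [measurable]: "u \<in> borel_measurable (lebesgue_on W)" "W \<in> sets lebesgue" and "c > 0"
  shows "lorentz_int p T W (\<lambda>x. ennreal c * u x) = ennreal c * lorentz_int p T W u"
proof -
  have [measurable]: "distr_fun W u \<in> borel_measurable borel" by (rule distr_fun_borel[OF assms(1,2)])
  have *: "(ennreal (c * l) < ennreal c * v) = (ennreal l < v)" if "l > 0" for v l
  proof (cases v)
    case (real r)
    thus ?thesis using that \<open>c > 0\<close> by (simp add: ennreal_mult[symmetric] ennreal_less_iff)
  qed (use \<open>c>0\<close> in \<open>simp add: ennreal_mult_top\<close>)
  have d: "distr_fun W (\<lambda>x. ennreal c * u x) (c * l) = distr_fun W u l" if "l > 0" for l
    unfolding distr_fun_def by (simp add: *[OF that])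
  have [measurable]: "distr_fun W (\<lambda>x. ennreal c * u x) \<in> borel_measurable borel" by (rule distr_fun_borel) auto
  have "lorentz_int p T W (\<lambda>x. ennreal c * u x) = ennreal \<bar>c\<bar> * (\<integral>\<^sup>+ l. lorentz_weight p T (distr_fun W (\<lambda>x. ennreal c * u x) (0 + c * l)) * indicator {0<..} (0 + c * l) \<partial>lborel)"
    unfolding lorentz_int_def by (rule nn_integral_real_affine) (use \<open>c>0\<close> in auto)
  also have "(\<integral>\<^sup>+ l. lorentz_weight p T (distr_fun W (\<lambda>x. ennreal c * u x) (0 + c * l)) * indicator {0<..} (0 + c * l) \<partial>lborel)
    = lorentz_int p T W u"
    unfolding lorentz_int_def
    by (intro nn_integral_cong) (use \<open>c > 0\<close> in \<open>auto simp: indicator_def d zero_less_mult_iff\<close>)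
  finally show ?thesis using \<open>c > 0\<close> by simp
qed

text \<open>If \<open>u + v > 2l\<close> then \<open>u > l\<close> or \<open>v > l\<close>, and the weight is subadditive. The factor 2 comes from
  rescaling the levels.\<close>

lemma lorentz_int_add:
  assumes [measurable]: "u \<in> borel_measurable (lebesgue_on W)" "v \<in> borel_measurable (lebesgue_on W)"
   "W \<in> sets lebesgue"
  shows "lorentz_int p T W (\<lambda>x. u x + v x) \<le> 2 * lorentz_int p T W u + 2 * lorentz_int p T W v"
proof -
  let ?w = "\<lambda>u l. lorentz_weight p T (distr_fun W u l) * indicator {0<..} l"
  have [measurable]: "distr_fun W u \<in> borel_measurable borel" "distr_fun W v \<in> borel_measurable borel"
    by (rule distr_fun_borel; simp)+
  have [measurable]: "distr_fun W (\<lambda>x. u x + v x) \<in> borel_measurable borel" by (rule distr_fun_borel) auto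
  have d: "distr_fun W (\<lambda>x. u x + v x) (2 * l) \<le> distr_fun W u l + distr_fun W v l" if "l > 0" for l
  proof -
    have "{x\<in>W. ennreal (2*l) < u x + v x} \<subseteq> {x\<in>W. ennreal l < u x} \<union> {x\<in>W. ennreal l < v x}"
    proof safe
      fix x assume x: "x \<in> W" "ennreal (2 * l) < u x + v x" "\<not> ennreal l < v x"
      show "ennreal l < u x"
      proof (rule ccontr)
        assume "\<not> ?thesis"
        hence "u x + v x \<le> ennreal l + ennreal l" using x by (intro add_mono) auto
        also have "\<dots> = ennreal (2 * l)" using that by (simp flip: ennreal_plus)
        finally show False using x by simp
      qed
    qed
    hence "distr_fun W (\<lambda>x. u x + v x) (2 * l) \<le> emeasure lebesgue ({x\<in>W. ennreal l < u x} \<union> {x\<in>W. ennreal l < v x})"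
      unfolding distr_fun_def
      by (intro emeasure_mono sets.Un superlevel_measurable) auto
    also have "\<dots> \<le> distr_fun W u l + distr_fun W v l"
      unfolding distr_fun_def by (intro emeasure_subadditive superlevel_measurable) auto
    finally show ?thesis .
  qed
  have "lorentz_int p T W (\<lambda>x. u x + v x) = ennreal \<bar>2\<bar> * (\<integral>\<^sup>+ l. ?w (\<lambda>x. u x + v x) (0 + 2 * l) \<partial>lborel)"
    unfolding lorentz_int_def by (rule nn_integral_real_affine) auto
  also have "\<dots> \<le> ennreal \<bar>2\<bar> * (\<integral>\<^sup>+ l. ?w u l
      + ?w v l \<partial>lborel)"
  proof (intro mult_left_mono nn_integral_mono)
    fix l :: real
    show "?w (\<lambda>x. u x + v x) (0 + 2 * l)
     \<le> ?w u l + ?w v l"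
      using order_trans[OF lorentz_weight_mono[OF d] lorentz_weight_add, of l p T] by (auto simp: indicator_def)
  qed auto
  also have "\<dots> = ennreal \<bar>2\<bar> * (lorentz_int p T W u + lorentz_int p T W v)"
    unfolding lorentz_int_def by (subst nn_integral_add) auto
  finally show ?thesis by (simp add: distrib_left)
qed

lemma lorentz_int_const:
  assumes "W \<in> sets lebesgue" "c \<ge> 0"
  shows "lorentz_int p T W (\<lambda>x. ennreal c) = ennreal c * lorentz_weight p T (emeasure lebesgue W)"
proof -
  have "lorentz_int p T W (\<lambda>x. ennreal c) = (\<integral>\<^sup>+ l. lorentz_weight p T (emeasure lebesgue W) * indicator {0<..<c} l \<partial>lborel)"
    unfolding lorentz_int_def distr_fun_def
  proof (intro nn_integral_cong)
    fix l :: real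
    have w0: "lorentz_weight p T 0 = 0" unfolding lorentz_weight_def by simp
    show "lorentz_weight p T (emeasure lebesgue {x \<in> W. ennreal l < ennreal c}) * indicator {0<..} l =
         lorentz_weight p T (emeasure lebesgue W) * indicator {0<..<c} l"
    proof (cases "l > 0")
      case True
      show ?thesis
      proof (cases "l < c")
        case lc: True
        have S: "{x \<in> W. ennreal l < ennreal c} = W"
          using True lc by (simp add: ennreal_less_iff)
        show ?thesis unfolding S using True lc by (simp only: indicator_def greaterThan_iff greaterThanLessThan_iff) simp
      next
        case lc: False
        have S: "{x \<in> W. ennreal l < ennreal c} = {}"
          using True lc by (simp add: ennreal_less_iff)
        show ?thesis unfolding S emeasure_empty w0 using lc by (simp only: indicator_def greaterThan_iff greaterThanLessThan_iff) simp
      qed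
    next
      case False
      hence z: "indicator {0<..} l = (0::ennreal)" "indicator {0<..<c} l = (0::ennreal)"
        by (simp_all add: indicator_def)
      show ?thesis unfolding z by (simp only: mult_zero_right)
    qed
  qed
  also have "\<dots> = lorentz_weight p T (emeasure lebesgue W) * emeasure lborel {0<..<c}"
    by (rule nn_integral_cmult_indicator) simp
  also have "emeasure lborel {0<..<c} = ennreal c" using assms(2) by simp
  finally show ?thesis by (simp only: mult.commute)
qed

text \<open>Functions bounded by 1 and small in \<open>L\<^sup>1\<close> are small in \<open>L^(p,1)\<close>: Markov's inequality gives
  \<open>\<mu>(l) \<le> \<delta>/l\<close>, levels above 1 do not occur, and \<open>l^(-b)\<close> is integrable on \<open>(0,1)\<close>.\<close>

lemma lorentz_int_bounded_by_L1:
  assumes u[measurable]: "u \<in> borel_measurable (lebesgue_on W)" "W \<in> sets lebesgue"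
    and le1: "\<And>x. x \<in> W \<Longrightarrow> u x \<le> 1" and d: "(\<integral>\<^sup>+ x. u x \<partial>lebesgue_on W) \<le> ennreal \<delta>" "\<delta> \<ge> 0"
    and b: "p > 0" "T \<ge> 0" "0 < b" "b < 1" "b < 1/p"
  shows "lorentz_int p T W u \<le> ennreal (T powr (1/p - b) / (1/p - b) / (1 - b)) * ennreal (\<delta> powr b)"
proof -
  define C where "C = T powr (1/p - b) / (1/p - b)"
  have C: "C \<ge> 0" unfolding C_def using b by auto
  have D: "distr_fun W u l \<le> ennreal (\<delta> / l)" if l: "l > 0" for l
  proof -
    have "ennreal l * emeasure (lebesgue_on W) {x\<in>W. ennreal l < u x} \<le> (\<integral>\<^sup>+ x. ennreal l * indicator {x\<in>W. ennreal l < u x} x \<partial>lebesgue_on W)"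
      using superlevel_measurable[OF u] u(2) by (subst nn_integral_cmult_indicator) (auto simp: sets_restrict_space_iff)
    also have "\<dots> \<le> (\<integral>\<^sup>+ x. u x \<partial>lebesgue_on W)"
      by (intro nn_integral_mono) (auto simp: indicator_def)
    also have "emeasure (lebesgue_on W) {x\<in>W. ennreal l < u x} = distr_fun W u l"
      unfolding distr_fun_def using u(2) by (subst emeasure_restrict_space) auto
    finally have "ennreal l * distr_fun W u l \<le> ennreal \<delta>" using d by simp
    hence "inverse (ennreal l) * (ennreal l * distr_fun W u l) \<le> inverse (ennreal l) * ennreal \<delta>"
      by (rule mult_left_mono) auto
    moreover have "inverse (ennreal l) * (ennreal l * distr_fun W u l) = distr_fun W u l"
      using l by (simp add: inverse_ennreal mult.assoc[symmetric] ennreal_mult[symmetric])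
    moreover have "inverse (ennreal l) * ennreal \<delta> = ennreal (\<delta> / l)"
      using l d by (simp add: inverse_ennreal ennreal_mult[symmetric] field_simps)
    ultimately show ?thesis by simp
  qed
  have "lorentz_int p T W u \<le> (\<integral>\<^sup>+ l. ennreal (C * \<delta> powr b) * (ennreal (l powr ((1 - b) - 1)) * indicator {0<..<1} l) \<partial>lborel)"
    unfolding lorentz_int_def
  proof (rule nn_integral_mono_AE)
    have "AE l in lborel. l \<noteq> (1::real)" by (rule AE_lborel_singleton)
    thus "AE l in lborel. lorentz_weight p T (distr_fun W u l) * indicator {0<..} l
       \<le> ennreal (C * \<delta> powr b) * (ennreal (l powr ((1 - b) - 1)) * indicator {0<..<1} l)"
    proof eventually_elim
      case (elim l)
      consider "l \<le> 0" | "0 < l" "l < 1" | "l > 1" using elim by linarith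
      thus ?case
      proof cases
        case 2
        have "lorentz_weight p T (distr_fun W u l) \<le> lorentz_weight p T (ennreal (\<delta> / l))"
          by (intro lorentz_weight_mono D 2)
        also have "\<dots> \<le> ennreal C * ennreal ((\<delta> / l) powr b)"
          unfolding C_def by (rule lorentz_weight_le_powr) (use b d 2 in auto)
        also have "\<dots> = ennreal (C * (\<delta> powr b * l powr (-b)))"
        proof -
          have "(\<delta> / l) powr b = \<delta> powr b * l powr (-b)"
            using d 2 by (simp add: powr_divide powr_minus divide_inverse[of "\<delta> powr b"])
          thus ?thesis using C by (simp add: ennreal_mult)
        qed
        finally show ?thesis using 2 C by (simp add: ennreal_mult[symmetric] mult_ac)
      next
        case 3
        have "{x\<in>W. ennreal l < u x} = {}"
        proof -
          have "ennreal 1 < ennreal l" using 3 by (simp add: ennreal_less_iff del: ennreal_1)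
          hence "\<not> ennreal l < u x" if "x \<in> W" for x
            using le1[OF that] by (metis ennreal_1 leD less_le_trans less_imp_le)
          thus ?thesis by blast
        qed
        hence "lorentz_weight p T (distr_fun W u l) = 0"
          unfolding distr_fun_def lorentz_weight_def by (simp only: emeasure_empty) simp
        thus ?thesis by simp
      qed auto
    qed
  qed
  also have "\<dots> = ennreal (C * \<delta> powr b) * ennreal (1 powr (1 - b) / (1 - b))"
    by (subst nn_integral_cmult) (use b nn_integral_powr_from_0[of "1 - b" 1] in auto)
  also have "\<dots> = ennreal (C / (1 - b)) * ennreal (\<delta> powr b)"
    using b C by (simp add: ennreal_mult[symmetric] field_simps)
  finally show ?thesis unfolding C_def .
qed

section \<open>The Riesz kernel of order one\<close>

text \<open>The value at \<open>z = 0\<close> is 0, because \<open>0 powr a = 0\<close>.\<close>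

definition riesz_kernel :: "'a::euclidean_space \<Rightarrow> real" where
  "riesz_kernel z = norm z powr (1 - real DIM('a))"

definition riesz_pot :: "('a::euclidean_space \<Rightarrow> ennreal) \<Rightarrow> 'a \<Rightarrow> ennreal" where
  "riesz_pot f x = (\<integral>\<^sup>+ y. f y * ennreal (riesz_kernel (x - y)) \<partial>lborel)"

definition riesz_const :: "'a::euclidean_space itself \<Rightarrow> real" where
  "riesz_const _ = real DIM('a) * unit_ball_vol (real DIM('a)) + 1"

lemma riesz_kernel_borel[measurable]: "riesz_kernel \<in> borel_measurable borel"
  unfolding riesz_kernel_def by measurable

lemma riesz_kernel_minus_commute: "riesz_kernel (x - y) = riesz_kernel (y - x)"
  unfolding riesz_kernel_def by (simp add: norm_minus_commute)

text \<open>The part of \<open>f\<close> that is assembled from its superlevel sets at the levels in \<open>L\<close>. Splitting the levels splits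
  \<open>f\<close> into a sum; for \<open>L = {..\<tau>}\<close> with \<open>\<tau> \<ge> 0\<close> the two parts are \<open>min(f,\<tau>)\<close> and the excess of \<open>f\<close> over \<open>\<tau>\<close>.\<close>

definition layers :: "real set \<Rightarrow> ('a \<Rightarrow> ennreal) \<Rightarrow> 'a \<Rightarrow> ennreal" where
  "layers L f x = (\<integral>\<^sup>+ l. indicator ({0<..} \<inter> L) l * (if ennreal l < f x then 1 else 0) \<partial>lborel)"

lemma layers_borel[measurable]:
  fixes f :: "'a::euclidean_space \<Rightarrow> ennreal"
  assumes [measurable]: "f \<in> borel_measurable borel" "L \<in> sets borel"
  shows "layers L f \<in> borel_measurable borel"
  unfolding layers_def by measurable

lemma layers_UNIV: "layers UNIV f x = f x"
  unfolding layers_def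
  by (subst nn_integral_below[of "f x", symmetric], rule nn_integral_cong) (simp add: indicator_def)

lemma layers_split:
  fixes f :: "'a::euclidean_space \<Rightarrow> ennreal"
  assumes [measurable]: "f \<in> borel_measurable borel" "L \<in> sets borel"
  shows "f x = layers L f x + layers (-L) f x"
proof -
  have "f x = layers UNIV f x" by (simp add: layers_UNIV)
  also have "\<dots> = layers L f x + layers (-L) f x"
    unfolding layers_def
    by (subst nn_integral_add[symmetric]) (auto intro!: nn_integral_cong simp: indicator_def)
  finally show ?thesis .
qed

lemma nn_integral_layers:
  fixes f :: "'a::euclidean_space \<Rightarrow> ennreal"
  assumes [measurable]: "f \<in> borel_measurable borel" "L \<in> sets borel" "k \<in> borel_measurable borel"
  shows "(\<integral>\<^sup>+ x. layers L f x * k x \<partial>lborel)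
    = (\<integral>\<^sup>+ l. indicator ({0<..} \<inter> L) l * (\<integral>\<^sup>+ x. (if ennreal l < f x then 1 else 0) * k x \<partial>lborel) \<partial>lborel)"
proof -
  have "(\<integral>\<^sup>+ x. layers L f x * k x \<partial>lborel)
      = (\<integral>\<^sup>+ x. (\<integral>\<^sup>+ l. indicator ({0<..} \<inter> L) l * (if ennreal l < f x then 1 else 0) * k x \<partial>lborel) \<partial>lborel)"
    unfolding layers_def by (subst nn_integral_multc) auto
  also have "\<dots> = (\<integral>\<^sup>+ l. (\<integral>\<^sup>+ x. indicator ({0<..} \<inter> L) l * (if ennreal l < f x then 1 else 0) * k x \<partial>lborel) \<partial>lborel)"
    by (rule lborel_pair.Fubini') measurable
  also have "\<dots> = (\<integral>\<^sup>+ l. indicator ({0<..} \<inter> L) l * (\<integral>\<^sup>+ x. (if ennreal l < f x then 1 else 0) * k x \<partial>lborel) \<partial>lborel)"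
    unfolding mult.assoc by (subst nn_integral_cmult) auto
  finally show ?thesis .
qed

lemma nn_integral_superlevel:
  fixes f :: "'a::euclidean_space \<Rightarrow> ennreal"
  assumes [measurable]: "f \<in> borel_measurable borel"
  shows "(\<integral>\<^sup>+ x. (if c < f x then 1 else 0) \<partial>lborel) = emeasure lborel {x. c < f x}"
proof -
  have "(\<integral>\<^sup>+ x. (if c < f x then 1 else 0) \<partial>lborel) = (\<integral>\<^sup>+ x. indicator {x. c < f x} x \<partial>lborel)"
    by (intro nn_integral_cong) (simp add: indicator_def)
  also have "\<dots> = emeasure lborel {x. c < f x}" by (rule nn_integral_indicator) measurable
  finally show ?thesis .
qed

text \<open>Layer cake over the levels of the kernel: the superlevel set at \<open>l\<close> lies in the ball of radius
  \<open>min(r, l^(-1/(n-1)))\<close> around \<open>x\<close>, and the two regimes meet at \<open>l = r^(1-n)\<close>.\<close>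

lemma nn_integral_riesz_ball:
  fixes x :: "'a::euclidean_space"
  assumes n: "DIM('a) \<ge> 2" and r: "r > 0"
  shows "(\<integral>\<^sup>+ y. indicator (ball x r) y * ennreal (riesz_kernel (x - y)) \<partial>lborel)
    \<le> ennreal (real DIM('a) * unit_ball_vol (real DIM('a)) * r)"
proof -
  define n where "n = real DIM('a)"
  define w where "w = unit_ball_vol n"
  define q where "q = n / (n - 1)"
  define l0 where "l0 = r powr (1 - n)"
  let ?b = "\<lambda>l. ennreal (w * r powr n) * indicator {0..l0} l + ennreal w * (ennreal (l powr (-q)) * indicator {l0..} l)"
  have n2: "n \<ge> 2" using n unfolding n_def by simp
  have w: "w \<ge> 0" unfolding w_def using n2 by (simp add: unit_ball_vol_nonneg)
  have q: "q > 1" using n2 unfolding q_def by (simp add: field_simps)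
  have l0: "l0 > 0" unfolding l0_def using r by simp
  define f where "f = (\<lambda>y. indicator (ball x r) y * ennreal (riesz_kernel (x - y)))"
  have [measurable]: "ball x r \<in> sets borel" by simp
  have [measurable]: "f \<in> borel_measurable borel" unfolding f_def by measurable
  have lev: "emeasure lborel {y. ennreal l < f y} \<le> ennreal (w * \<rho> ^ DIM('a))"
    if "\<And>y. y \<in> ball x r \<Longrightarrow> l < riesz_kernel (x - y) \<Longrightarrow> y \<in> ball x \<rho>" "\<rho> \<ge> 0" "l > 0" for l \<rho>
  proof -
    have "{y. ennreal l < f y} \<subseteq> ball x \<rho>"
    proof
      fix y assume "y \<in> {y. ennreal l < f y}"
      hence "y \<in> ball x r \<and> ennreal l < ennreal (riesz_kernel (x - y))"
        unfolding f_def by (cases "y \<in> ball x r") auto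
      thus "y \<in> ball x \<rho>" using that by (simp add: ennreal_less_iff)
    qed
    hence "emeasure lborel {y. ennreal l < f y} \<le> emeasure lborel (ball x \<rho>)"
      by (intro emeasure_mono) auto
    thus ?thesis using \<open>\<rho> \<ge> 0\<close> by (simp add: emeasure_ball w_def n_def)
  qed
  have B1: "emeasure lborel {y. ennreal l < f y} \<le> ennreal (w * r powr n)" if "l > 0" for l
    using lev[of l r] that r by (simp add: powr_realpow[symmetric] n_def)
  have B2: "emeasure lborel {y. ennreal l < f y} \<le> ennreal (w * l powr (-q))" if "l > 0" for l
  proof -
    have "emeasure lborel {y. ennreal l < f y} \<le> ennreal (w * (l powr (-1/(n-1))) ^ DIM('a))"
    proof (rule lev)
      fix y assume y: "l < riesz_kernel (x - y)"
      have "norm (x - y) > 0"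
        using y that by (cases "x = y") (auto simp: riesz_kernel_def)
      have "riesz_kernel (x - y) powr (-1/(n-1)) < l powr (-1/(n-1))"
        using y that n2 by (intro powr_less_mono2_neg) (auto simp: field_simps)
      moreover have "riesz_kernel (x - y) powr (-1/(n-1)) = norm (x - y)"
      proof -
        have "(1 - n) * (-1/(n-1)) = 1" using n2 by (simp add: field_simps)
        thus ?thesis unfolding riesz_kernel_def n_def[symmetric] powr_powr
          using \<open>norm (x - y) > 0\<close> by simp
      qed
      ultimately show "y \<in> ball x (l powr (-1/(n-1)))" by (simp add: dist_norm)
    qed (use that in auto)
    also have "(l powr (-1/(n-1))) ^ DIM('a) = (l powr (-1/(n-1))) powr n"
      using that unfolding n_def by (simp add: powr_realpow)
    also have "\<dots> = l powr (-q)"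
      unfolding powr_powr q_def by (simp add: field_simps)
    finally show ?thesis .
  qed
  have "(\<integral>\<^sup>+ y. f y \<partial>lborel) = (\<integral>\<^sup>+ y. layers UNIV f y * 1 \<partial>lborel)" by (simp add: layers_UNIV)
  also have "\<dots> = (\<integral>\<^sup>+ l. indicator ({0<..} \<inter> UNIV) l * emeasure lborel {y. ennreal l < f y} \<partial>lborel)"
    by (subst nn_integral_layers) (simp_all add: nn_integral_superlevel)
  also have "\<dots> \<le> (\<integral>\<^sup>+ l. ?b l \<partial>lborel)"
  proof (rule nn_integral_mono)
    fix l :: real
    consider "l \<le> 0" | "0 < l" "l \<le> l0" | "l > l0" by linarith
    thus "indicator ({0<..} \<inter> UNIV) l * emeasure lborel {y. ennreal l < f y}
      \<le> ?b l"
    proof cases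
      case 1 hence "indicator ({0<..} \<inter> UNIV) l = (0::ennreal)" by simp
      thus ?thesis by simp
    next
      case 2
      have "ennreal (w * r powr n) \<le> ?b l"
        using 2 by (simp add: add_increasing2)
      thus ?thesis using order_trans[OF B1[OF 2(1)]] 2 by (simp add: indicator_def)
    next
      case 3
      thus ?thesis using B2[of l] l0 w by (simp add: ennreal_mult)
    qed
  qed
  also have "\<dots> = ennreal (w * r powr n) * ennreal l0 + ennreal w * ennreal (l0 powr (1 - q) / (q - 1))"
    using l0 by (subst nn_integral_add; (subst nn_integral_cmult)?) (simp_all add: nn_integral_cmult nn_integral_powr_to_infinity[OF q l0])
  also have "l0 powr (1 - q) / (q - 1) = (n - 1) * r"
  proof -
    have q1: "q - 1 = 1 / (n - 1)" using n2 unfolding q_def by (simp add: field_simps)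
    have "(1 - n) * (1 - q) = 1" using n2 unfolding q_def by (simp add: field_simps)
    hence "l0 powr (1 - q) = r" unfolding l0_def powr_powr using r by simp
    thus ?thesis unfolding q1 by simp
  qed
  also have "ennreal (w * r powr n) * ennreal l0 = ennreal (w * r)"
  proof -
    have "r powr n * l0 = r" unfolding l0_def using r by (simp flip: powr_add)
    thus ?thesis using w l0 by (simp add: ennreal_mult[symmetric] mult.assoc)
  qed
  also have "ennreal (w * r) + ennreal w * ennreal ((n - 1) * r) = ennreal (n * w * r)"
  proof -
    have "w * r \<ge> 0" "w * ((n - 1) * r) \<ge> 0" using w r n2 by auto
    hence "ennreal (w * r) + ennreal (w * ((n - 1) * r)) = ennreal (w * r + w * ((n - 1) * r))"
      by (rule ennreal_plus[symmetric])
    also have "w * r + w * ((n - 1) * r) = n * w * r" by (simp add: algebra_simps)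
    finally show ?thesis using w r n2 by (simp add: ennreal_mult)
  qed
  finally show ?thesis unfolding f_def n_def w_def .
qed

text \<open>The integral of the kernel over a set of measure \<open>s\<close> is at most of the order of the one over a ball of
  measure \<open>s\<close>: inside the ball of radius \<open>s^(1/n)\<close> use the previous bound, outside it the kernel is at most
  \<open>s^((1-n)/n)\<close>.\<close>

lemma nn_integral_riesz_set:
  fixes x :: "'a::euclidean_space"
  assumes n: "DIM('a) \<ge> 2" and F[measurable]: "F \<in> sets borel" and s: "emeasure lborel F = ennreal s" "s \<ge> 0"
  shows "(\<integral>\<^sup>+ y. indicator F y * ennreal (riesz_kernel (x - y)) \<partial>lborel)
    \<le> ennreal (riesz_const TYPE('a) * s powr (1 / real DIM('a)))"
proof (cases "s = 0")
  case True
  hence "F \<in> null_sets lborel" using s by auto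
  hence "AE y in lborel. y \<notin> F" by (rule AE_not_in)
  hence "AE y in lborel. indicator F y * ennreal (riesz_kernel (x - y)) = 0"
    by eventually_elim simp
  hence "(\<integral>\<^sup>+ y. indicator F y * ennreal (riesz_kernel (x - y)) \<partial>lborel) = 0"
    by (subst nn_integral_0_iff_AE) auto
  thus ?thesis by simp
next
  case False
  define n where "n = real DIM('a)"
  define r where "r = s powr (1/n)"
  have [measurable]: "ball x r \<in> sets borel" by simp
  have n2: "n \<ge> 2" using n unfolding n_def by simp
  have r: "r > 0" unfolding r_def using False s by simp
  have "(\<integral>\<^sup>+ y. indicator F y * ennreal (riesz_kernel (x - y)) \<partial>lborel)
    \<le> (\<integral>\<^sup>+ y. indicator (ball x r) y * ennreal (riesz_kernel (x - y)) + ennreal (r powr (1 - n)) * indicator F y \<partial>lborel)"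
  proof (rule nn_integral_mono)
    fix y
    have "riesz_kernel (x - y) \<le> r powr (1 - n)" if "y \<notin> ball x r"
      using that r n2 unfolding riesz_kernel_def n_def[symmetric]
      by (intro powr_mono2') (auto simp: dist_norm)
    hence "ennreal (riesz_kernel (x - y)) \<le> ennreal (r powr (1 - n))" if "y \<notin> ball x r"
      using that by (intro ennreal_leI) auto
    thus "indicator F y * ennreal (riesz_kernel (x - y)) \<le>
      indicator (ball x r) y * ennreal (riesz_kernel (x - y)) + ennreal (r powr (1 - n)) * indicator F y"
      by (cases "y \<in> F"; cases "y \<in> ball x r") (simp_all add: add_increasing2)
  qed
  also have "\<dots> = (\<integral>\<^sup>+ y. indicator (ball x r) y * ennreal (riesz_kernel (x - y)) \<partial>lborel) + ennreal (r powr (1 - n)) * ennreal s"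
    by (subst nn_integral_add) (simp_all add: nn_integral_cmult_indicator s)
  also have "\<dots> \<le> ennreal (n * unit_ball_vol n * r) + ennreal (r powr (1 - n)) * ennreal s"
    using nn_integral_riesz_ball[OF n r, of x] by (intro add_right_mono) (simp add: n_def)
  also have "ennreal (r powr (1 - n)) * ennreal s = ennreal r"
  proof -
    have "s = r powr n" unfolding r_def powr_powr using n2 False s by simp
    hence "r powr (1 - n) * s = r" using r by (simp flip: powr_add)
    thus ?thesis using s by (simp add: ennreal_mult[symmetric])
  qed
  also have "ennreal (n * unit_ball_vol n * r) + ennreal r = ennreal (riesz_const TYPE('a) * r)"
    unfolding riesz_const_def n_def[symmetric] using r n2
    by (subst ennreal_plus[symmetric]) (auto simp: algebra_simps unit_ball_vol_nonneg)
  finally show ?thesis unfolding r_def n_def .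
qed

lemma distr_fun_eq_lborel:
  fixes f :: "'a::euclidean_space \<Rightarrow> ennreal"
  assumes [measurable]: "f \<in> borel_measurable borel" and "\<And>x. x \<notin> W \<Longrightarrow> f x = 0"
  shows "distr_fun W f l = emeasure lborel {x. ennreal l < f x}"
proof -
  have "{x\<in>W. ennreal l < f x} = {x. ennreal l < f x}" using assms(2) by fastforce
  moreover have "{x. ennreal l < f x} \<in> sets borel" by measurable
  ultimately show ?thesis unfolding distr_fun_def by simp
qed

lemma measurable_lebesgue_onI:
  assumes "f \<in> borel_measurable borel"
  shows "f \<in> borel_measurable (lebesgue_on W)"
  using assms by (simp add: measurable_completion measurable_restrict_space1)

text \<open>The potential is the integral, over the levels in \<open>L\<close>, of the potentials of the superlevel sets, and each
  of these is bounded by \<open>nn_integral_riesz_set\<close>.\<close>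

lemma riesz_pot_layers_le:
  fixes f :: "'a::euclidean_space \<Rightarrow> ennreal"
  assumes n: "DIM('a) \<ge> 2" and f[measurable]: "f \<in> borel_measurable borel" and L[measurable]: "L \<in> sets borel"
    and W: "W \<in> sets borel" "emeasure lborel W < \<infinity>" and f0: "\<And>x. x \<notin> W \<Longrightarrow> f x = 0"
  shows "riesz_pot (layers L f) x \<le> (\<integral>\<^sup>+ l. indicator ({0<..} \<inter> L) l *
     ennreal (riesz_const TYPE('a) * enn2real (distr_fun W f l) powr (1 / real DIM('a))) \<partial>lborel)"
proof -
  have "riesz_pot (layers L f) x = (\<integral>\<^sup>+ l. indicator ({0<..} \<inter> L) l *
      (\<integral>\<^sup>+ y. (if ennreal l < f y then 1 else 0) * ennreal (riesz_kernel (x - y)) \<partial>lborel) \<partial>lborel)"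
    unfolding riesz_pot_def by (rule nn_integral_layers) auto
  also have "\<dots> \<le> (\<integral>\<^sup>+ l. indicator ({0<..} \<inter> L) l *
     ennreal (riesz_const TYPE('a) * enn2real (distr_fun W f l) powr (1 / real DIM('a))) \<partial>lborel)"
  proof (intro nn_integral_mono mult_left_mono)
    fix l :: real
    have F: "{y. ennreal l < f y} \<in> sets borel" by measurable
    have "{y. ennreal l < f y} \<subseteq> W" using f0 by fastforce
    hence "emeasure lborel {y. ennreal l < f y} \<le> emeasure lborel W"
      using W by (intro emeasure_mono) auto
    hence "emeasure lborel {y. ennreal l < f y} < \<infinity>" using W by simp
    hence e: "emeasure lborel {y. ennreal l < f y} = ennreal (enn2real (distr_fun W f l))"
      using distr_fun_eq_lborel[OF f f0, of W l] by simp
    have "(\<integral>\<^sup>+ y. (if ennreal l < f y then 1 else 0) * ennreal (riesz_kernel (x - y)) \<partial>lborel)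
      = (\<integral>\<^sup>+ y. indicator {y. ennreal l < f y} y * ennreal (riesz_kernel (x - y)) \<partial>lborel)"
      by (intro nn_integral_cong) (simp add: indicator_def)
    also have "\<dots> \<le> ennreal (riesz_const TYPE('a) * enn2real (distr_fun W f l) powr (1 / real DIM('a)))"
      by (rule nn_integral_riesz_set[OF n F e]) simp
    finally show "(\<integral>\<^sup>+ y. (if ennreal l < f y then 1 else 0) * ennreal (riesz_kernel (x - y)) \<partial>lborel) \<le> \<dots>" .
  qed auto
  finally show ?thesis .
qed

section \<open>Riesz potentials in Lorentz spaces\<close>

text \<open>Split the kernel at distance \<open>r\<close>. The far part is bounded by its sup norm \<open>r^(1-n)\<close> times \<open>\<integral>f\<close>; the near
  part \<open>N\<close> is a convolution of \<open>f\<close> with an integrable kernel of mass of order \<open>r\<close>.\<close>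

lemma riesz_pot_near_far:
  fixes f :: "'a::euclidean_space \<Rightarrow> ennreal"
  assumes n: "DIM('a) \<ge> 2" and [measurable]: "f \<in> borel_measurable borel" and r: "r > 0"
  obtains N where "N \<in> borel_measurable borel"
    "\<And>x. riesz_pot f x \<le> ennreal (r powr (1 - real DIM('a))) * (\<integral>\<^sup>+ y. f y \<partial>lborel) + N x"
    "(\<integral>\<^sup>+ x. N x \<partial>lborel) \<le> ennreal (real DIM('a) * unit_ball_vol (real DIM('a)) * r) * (\<integral>\<^sup>+ y. f y \<partial>lborel)"
proof
  let ?c = "ennreal (real DIM('a) * unit_ball_vol (real DIM('a)) * r)"
  let ?k = "\<lambda>x y. (if dist x y < r then 1 else 0) * ennreal (riesz_kernel (x - y))"
  define N where "N = (\<lambda>x. \<integral>\<^sup>+ y. f y * ?k x y \<partial>lborel)"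
  show [measurable]: "N \<in> borel_measurable borel" unfolding N_def by measurable
  show "riesz_pot f x \<le> ennreal (r powr (1 - real DIM('a))) * (\<integral>\<^sup>+ y. f y \<partial>lborel) + N x" for x
  proof -
    have "riesz_pot f x \<le> (\<integral>\<^sup>+ y. ennreal (r powr (1 - real DIM('a))) * f y
        + f y * ?k x y \<partial>lborel)"
      unfolding riesz_pot_def
    proof (rule nn_integral_mono)
      fix y
      have "riesz_kernel (x - y) \<le> r powr (1 - real DIM('a))" if "\<not> dist x y < r"
        using that r n unfolding riesz_kernel_def
        by (intro powr_mono2') (auto simp: dist_norm)
      hence "f y * ennreal (riesz_kernel (x - y)) \<le> ennreal (r powr (1 - real DIM('a))) * f y" if "\<not> dist x y < r"
        using that by (subst mult.commute) (intro mult_right_mono ennreal_leI; simp)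
      thus "f y * ennreal (riesz_kernel (x - y)) \<le> ennreal (r powr (1 - real DIM('a))) * f y
        + f y * ?k x y"
        by (cases "dist x y < r") simp_all
    qed
    also have "\<dots> = ennreal (r powr (1 - real DIM('a))) * (\<integral>\<^sup>+ y. f y \<partial>lborel) + N x"
      unfolding N_def by (subst nn_integral_add) (auto simp: nn_integral_cmult)
    finally show ?thesis .
  qed
  have "(\<integral>\<^sup>+ x. N x \<partial>lborel) = (\<integral>\<^sup>+ y. (\<integral>\<^sup>+ x. f y * ?k x y \<partial>lborel) \<partial>lborel)"
    unfolding N_def by (rule lborel_pair.Fubini') measurable
  also have "\<dots> \<le> (\<integral>\<^sup>+ y. f y * ?c \<partial>lborel)"
  proof (rule nn_integral_mono)
    fix y :: 'a
    have "(\<integral>\<^sup>+ x. f y * ?k x y \<partial>lborel)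
        = f y * (\<integral>\<^sup>+ x. (if dist x y < r then 1 else 0) * ennreal (riesz_kernel (x - y)) \<partial>lborel)"
      by (rule nn_integral_cmult) measurable
    also have "(\<integral>\<^sup>+ x. (if dist x y < r then 1 else 0) * ennreal (riesz_kernel (x - y)) \<partial>lborel)
       = (\<integral>\<^sup>+ x. indicator (ball y r) x * ennreal (riesz_kernel (y - x)) \<partial>lborel)"
      by (intro nn_integral_cong) (simp add: indicator_def dist_commute riesz_kernel_minus_commute[of y])
    also have "f y * \<dots> \<le> f y * ?c"
      by (intro mult_left_mono nn_integral_riesz_ball n r) simp
    finally show "(\<integral>\<^sup>+ x. f y * ?k x y \<partial>lborel)
       \<le> f y * ?c" .
  qed
  also have "\<dots> = ?c * (\<integral>\<^sup>+ y. f y \<partial>lborel)"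
    by (subst nn_integral_multc) (auto simp: mult.commute)
  finally show "(\<integral>\<^sup>+ x. N x \<partial>lborel) \<le> \<dots>" .
qed

text \<open>One half of the fact that \<open>t g\<^sub>*\<^sub>*(t)\<close> is the \<open>K\<close>-functional of \<open>g\<close> between \<open>L\<^sup>1\<close> and
  bounded functions: if \<open>g \<le> a + b\<close> with \<open>a\<close> constant, then levels below \<open>a\<close> contribute at most \<open>t\<close> each, and
  \<open>g > l > a\<close> forces \<open>b > l - a\<close>.\<close>

lemma truncated_distr_le:
  fixes g b :: "'a::euclidean_space \<Rightarrow> ennreal"
  assumes [measurable]: "g \<in> borel_measurable borel" "b \<in> borel_measurable borel" and W: "W \<in> sets borel"
    and le: "\<And>x. x \<in> W \<Longrightarrow> g x \<le> a + b x" and t: "t > 0"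
  shows "(\<integral>\<^sup>+ l\<in>{0<..}. min (distr_fun W g l) (ennreal t) \<partial>lborel) \<le> ennreal t * a + (\<integral>\<^sup>+ x. b x \<partial>lborel)"
proof (cases a)
  case top
  thus ?thesis using t by (simp add: ennreal_mult_top)
next
  case (real c)
  define h where "h = (\<lambda>l. emeasure lborel {x. ennreal l < b x})"
  have [measurable]: "h \<in> borel_measurable borel"
    unfolding h_def by (intro measurable_antimono_ennreal emeasure_mono) (auto intro: le_less_trans ennreal_leI)
  have "(\<integral>\<^sup>+ l\<in>{0<..}. min (distr_fun W g l) (ennreal t) \<partial>lborel)
    \<le> (\<integral>\<^sup>+ l. ennreal t * indicator {0<..<c} l + indicator {c<..} l * h (l - c) \<partial>lborel)"
  proof (rule nn_integral_mono_AE)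
    have "AE l in lborel. l \<noteq> c" by (rule AE_lborel_singleton)
    thus "AE l in lborel. min (distr_fun W g l) (ennreal t) * indicator {0<..} l
       \<le> ennreal t * indicator {0<..<c} l + indicator {c<..} l * h (l - c)"
    proof eventually_elim
      case (elim l)
      consider "l \<le> 0" | "0 < l" "l < c" | "0 < l" "c < l" using elim by linarith
      thus ?case
      proof cases
        case 3
        have "{x\<in>W. ennreal l < g x} \<subseteq> {x. ennreal (l - c) < b x}"
        proof safe
          fix x assume x: "x \<in> W" "ennreal l < g x"
          hence *: "ennreal l < ennreal c + b x" using le[OF x(1)] real by simp
          show "ennreal (l - c) < b x"
          proof (cases "b x")
            case r: (real r)
            hence "ennreal l < ennreal (c + r)" using * real by simp
            hence "l < c + r" using 3 by (subst (asm) ennreal_less_iff) auto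
            thus ?thesis using r 3 by (simp add: ennreal_less_iff)
          qed auto
        qed
        moreover have "{x. ennreal (l - c) < b x} \<in> sets borel" by measurable
        ultimately have "distr_fun W g l \<le> emeasure lebesgue {x. ennreal (l - c) < b x}"
          unfolding distr_fun_def by (intro emeasure_mono) auto
        also have "\<dots> = h (l - c)" unfolding h_def by simp
        finally have "distr_fun W g l \<le> h (l - c)" .
        thus ?thesis using 3 by (simp add: min.coboundedI1)
      qed simp_all
    qed
  qed
  also have "\<dots> = (\<integral>\<^sup>+ l. ennreal t * indicator {0<..<c} l \<partial>lborel) + (\<integral>\<^sup>+ l. indicator {c<..} l * h (l - c) \<partial>lborel)"
    by (rule nn_integral_add) auto
  also have "(\<integral>\<^sup>+ l. ennreal t * indicator {0<..<c} l \<partial>lborel) = ennreal t * ennreal c"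
    using real by (subst nn_integral_cmult_indicator) simp_all
  also have "(\<integral>\<^sup>+ l. indicator {c<..} l * h (l - c) \<partial>lborel) = ennreal \<bar>1\<bar> * (\<integral>\<^sup>+ l. indicator {c<..} (c + 1 * l) * h (c + 1 * l - c) \<partial>lborel)"
    by (rule nn_integral_real_affine) auto
  also have "\<dots> = (\<integral>\<^sup>+ l. indicator ({0<..} \<inter> UNIV) l * h l \<partial>lborel)"
    by (simp, intro nn_integral_cong) (simp add: indicator_def)
  also have "\<dots> = (\<integral>\<^sup>+ x. layers UNIV b x * 1 \<partial>lborel)"
    unfolding h_def by (subst nn_integral_layers) (simp_all add: nn_integral_superlevel)
  also have "\<dots> = (\<integral>\<^sup>+ x. b x \<partial>lborel)" by (simp add: layers_UNIV)
  finally show ?thesis using real by simp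
qed

text \<open>In \<open>t \<ge> s\<close> the two integrands coincide. In \<open>t < s\<close> the left one integrates to \<open>n s^(2/n)\<close>, twice the value
  \<open>(n/2) s^(2/n)\<close> of the right one.\<close>

lemma nn_integral_weight_split_le:
  assumes n: "n \<ge> 2" and s: "0 \<le> s" "s \<le> T"
  shows "(\<integral>\<^sup>+ t\<in>{0<..<T}. ennreal (t powr (1/n - 2)) * ennreal (if t < s then t * s powr (1/n) else s * t powr (1/n)) \<partial>lborel)
     \<le> 2 * lorentz_weight (n/2) T (ennreal s)"
proof -
  let ?l = "\<lambda>t. ennreal (t powr (1/n - 2)) * ennreal (if t < s then t * s powr (1/n) else s * t powr (1/n))"
  let ?m = "\<lambda>t. ennreal (s powr (1/n)) * (ennreal (t powr (1/n - 1)) * indicator {0<..<s} t)"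
  let ?r = "\<lambda>t. ennreal s * ennreal (t powr (2/n - 2)) * indicator {s..<T} t"
  let ?R = "\<integral>\<^sup>+ t. ?r t \<partial>lborel"
  have "(\<integral>\<^sup>+ t\<in>{0<..<T}. ?l t \<partial>lborel)
     \<le> (\<integral>\<^sup>+ t. ?m t
        + ?r t \<partial>lborel)"
  proof (rule nn_integral_mono)
    fix t :: real
    consider "t \<le> 0" | "t \<ge> T" | "0 < t" "t < s" "t < T" | "0 < t" "s \<le> t" "t < T" by linarith
    thus "?l t * indicator {0<..<T} t
      \<le> ?m t
        + ?r t"
    proof cases
      case 3
      have "t powr (1/n - 1) = t powr (1/n - 2) * t powr 1" by (subst powr_add[symmetric]) (simp add: algebra_simps)
      thus ?thesis using 3 by (simp add: ennreal_mult'[symmetric] mult_ac)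
    next
      case 4
      have "t powr (2/n - 2) = t powr (1/n - 2) * t powr (1/n)" by (subst powr_add[symmetric]) (simp add: algebra_simps)
      thus ?thesis using 4 s by (simp add: ennreal_mult'[symmetric] mult_ac)
    qed (use s in simp_all)
  qed
  also have "\<dots> = ennreal (s powr (1/n)) * ennreal (s powr (1/n) / (1/n)) + ?R"
    using n s by (subst nn_integral_add) (simp_all add: nn_integral_cmult nn_integral_powr_from_0)
  also have "ennreal (s powr (1/n)) * ennreal (s powr (1/n) / (1/n)) = 2 * ennreal (s powr (2/n) / (2/n))"
  proof -
    have "s powr (1/n) * (s powr (1/n) / (1/n)) = 2 * (s powr (2/n) / (2/n))"
      using n by (simp add: powr_add[symmetric])
    thus ?thesis using n by (simp add: ennreal_mult'[symmetric] ennreal_mult''[symmetric] flip: ennreal_numeral)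
  qed
  also have "2 * ennreal (s powr (2/n) / (2/n)) + ?R
     \<le> 2 * (ennreal (s powr (2/n) / (2/n)) + ?R)"
    unfolding distrib_left by (intro add_left_mono) (simp add: mult_2 add_increasing)
  also have "ennreal (s powr (2/n) / (2/n)) + ?R
     = (\<integral>\<^sup>+ t. ennreal (t powr (2/n - 1)) * indicator {0<..<s} t + ?r t \<partial>lborel)"
    using n s by (subst nn_integral_add) (simp_all add: nn_integral_powr_from_0)
  also have "\<dots> \<le> lorentz_weight (n/2) T (ennreal s)"
    unfolding lorentz_weight_def
  proof (rule nn_integral_mono)
    fix t :: real
    consider "t \<le> 0" "t < s" | "t \<ge> T" "t \<ge> s" | "0 < t" "t < s" "t < T" | "0 < t" "s \<le> t" "t < T" | "t \<le> 0" "t = s" | "t \<le> 0" "t > s" using s by linarith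
    thus "ennreal (t powr (2/n - 1)) * indicator {0<..<s} t + ?r t
       \<le> ennreal (t powr (1 / (n/2) - 2)) * min (ennreal s) (ennreal t) * indicator {0<..<T} t"
    proof cases
      case 3
      have "t powr (2/n - 1) = t powr (2/n - 2) * t powr 1" by (subst powr_add[symmetric]) (simp add: algebra_simps)
      moreover have "min (ennreal s) (ennreal t) = ennreal t" using 3 by (simp add: min_absorb2)
      ultimately show ?thesis using 3 by (simp add: ennreal_mult'[symmetric] mult_ac)
    next
      case 4
      have "min (ennreal s) (ennreal t) = ennreal s" using 4 by (simp add: min_absorb1)
      thus ?thesis using 4 s by (simp add: mult_ac)
    qed (use s in simp_all)
  qed
  finally show ?thesis by (simp add: mult_left_mono)
qed

text \<open>The potential of order one maps \<open>L^(n/2,1)\<close> to \<open>L^(n,1)\<close>. Fix \<open>t\<close> and split \<open>f\<close> into the layers at levels with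
  \<open>\<mu>(l) > t\<close> and \<open>\<mu>(l) \<le> t\<close>. The potential of the first part is bounded by \<open>C \<integral> \<mu>(l)^(1/n) dl\<close>; the second one
  is split at the radius \<open>r = t^(1/n)\<close> into a bounded and an integrable piece. By the \<open>K\<close>-functional bound,
  \<open>t g\<^sub>*\<^sub>*(t)\<close> is at most \<open>C\<close> times the integral over the levels of \<open>t \<mu>(l)^(1/n)\<close> or \<open>\<mu>(l) t^(1/n)\<close>
  respectively, and integrating against \<open>t^(1/n-2)\<close> gives the weight of \<open>L^(n/2,1)\<close>.\<close>

lemma lorentz_int_riesz_pot:
  fixes f g :: "'a::euclidean_space \<Rightarrow> ennreal"
  assumes n: "DIM('a) \<ge> 2" and f[measurable]: "f \<in> borel_measurable borel" and g[measurable]: "g \<in> borel_measurable borel"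
    and W: "W \<in> sets borel" "emeasure lborel W = ennreal T" "T \<ge> 0"
    and f0: "\<And>x. x \<notin> W \<Longrightarrow> f x = 0"
    and le: "\<And>x. x \<in> W \<Longrightarrow> g x \<le> riesz_pot f x"
  shows "lorentz_int (real DIM('a)) T W g
    \<le> ennreal (2 * riesz_const TYPE('a)) * lorentz_int (real DIM('a) / 2) T W f"
proof -
  define n where "n = real DIM('a)"
  \<comment> \<open>The constant of the near part; \<open>C = w + 1\<close> is the constant for superlevel sets.\<close>
  define w where "w = n * unit_ball_vol n"
  define C where "C = riesz_const TYPE('a)"
  have n2: "n \<ge> 2" using n unfolding n_def by simp
  have w: "w \<ge> 0" unfolding w_def using n2 by simp
  have C: "C = w + 1" unfolding C_def riesz_const_def w_def n_def by simp
  have WL: "W \<in> sets lebesgue" using W by simp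
  have fm: "f \<in> borel_measurable (lebesgue_on W)" and gm: "g \<in> borel_measurable (lebesgue_on W)"
    by (rule measurable_lebesgue_onI; simp)+
  have [measurable]: "distr_fun W f \<in> borel_measurable borel" "distr_fun W g \<in> borel_measurable borel"
    using distr_fun_borel[OF fm WL] distr_fun_borel[OF gm WL] .
  define s where "s = (\<lambda>l. enn2real (distr_fun W f l))"
  have [measurable]: "s \<in> borel_measurable borel" unfolding s_def by measurable
  have dT: "distr_fun W f l \<le> ennreal T" for l
  proof -
    have "distr_fun W f l \<le> emeasure lebesgue W"
      unfolding distr_fun_def using WL by (intro emeasure_mono) auto
    thus ?thesis using W by simp
  qed
  have ds: "distr_fun W f l = ennreal (s l)" for l
  proof -
    have "distr_fun W f l < top" using le_less_trans[OF dT[of l]] by simp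
    thus ?thesis unfolding s_def by simp
  qed
  have s: "0 \<le> s l" "s l \<le> T" for l
    using dT[of l] W(3) unfolding ds by (auto simp: s_def)
  define H where "H = (\<lambda>t l. if t < s l then t * s l powr (1/n) else s l * t powr (1/n))"
  let ?k = "\<lambda>t. ennreal (t powr (1/n - 2)) * indicator {0<..<T} t"
  let ?g = "\<lambda>t l. min (distr_fun W g l) (ennreal t) * indicator {0<..} l"
  let ?h = "\<lambda>t l. ennreal (H t l) * indicator {0<..} l"
  let ?G = "\<lambda>t. \<integral>\<^sup>+ l. ?g t l \<partial>lborel" and ?H = "\<lambda>t. \<integral>\<^sup>+ l. ?h t l \<partial>lborel"
  have key: "?G t
     \<le> ennreal C * ?H t" if t: "t > 0" for t
  proof -
    \<comment> \<open>The levels with large superlevel sets.\<close>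
    define L where "L = {l. t < s l}"
    have L[measurable]: "L \<in> sets borel" unfolding L_def by measurable
    define r where "r = t powr (1/n)"
    have r: "r > 0" unfolding r_def using t by simp
    define f1 f2 where "f1 = layers L f" and "f2 = layers (-L) f"
    have [measurable]: "f1 \<in> borel_measurable borel" "f2 \<in> borel_measurable borel"
      unfolding f1_def f2_def by auto
    define P where "P = (\<integral>\<^sup>+ l. indicator ({0<..} \<inter> L) l * ennreal (s l powr (1/n)) \<partial>lborel)"
    define Q where "Q = (\<integral>\<^sup>+ l. indicator ({0<..} \<inter> -L) l * ennreal (s l) \<partial>lborel)"
    have Q: "(\<integral>\<^sup>+ y. f2 y \<partial>lborel) = Q"
    proof -
      have "(\<integral>\<^sup>+ y. layers (-L) f y * 1 \<partial>lborel) = Q"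
        unfolding Q_def by (subst nn_integral_layers) (simp_all add: nn_integral_superlevel distr_fun_eq_lborel[OF f f0, symmetric] ds)
      thus ?thesis unfolding f2_def by simp
    qed
    have P: "riesz_pot f1 x \<le> ennreal C * P" for x
    proof -
      have "riesz_pot f1 x \<le> (\<integral>\<^sup>+ l. indicator ({0<..} \<inter> L) l * ennreal (C * s l powr (1/n)) \<partial>lborel)"
        unfolding f1_def C_def s_def n_def by (rule riesz_pot_layers_le[OF n f L W(1) _ f0]) (simp_all add: W)
      also have "\<dots> = (\<integral>\<^sup>+ l. ennreal C * (indicator ({0<..} \<inter> L) l * ennreal (s l powr (1/n))) \<partial>lborel)"
        by (intro nn_integral_cong) (simp add: ennreal_mult' C w mult_ac)
      also have "\<dots> = ennreal C * P" unfolding P_def by (rule nn_integral_cmult) measurable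
      finally show ?thesis .
    qed
    obtain N where N: "N \<in> borel_measurable borel"
      "\<And>x. riesz_pot f2 x \<le> ennreal (r powr (1 - n)) * Q + N x"
      "(\<integral>\<^sup>+ x. N x \<partial>lborel) \<le> ennreal (w * r) * Q"
      using riesz_pot_near_far[OF n _ r, of f2] unfolding Q n_def[symmetric] w_def[symmetric] by auto
    have pot: "riesz_pot f x = riesz_pot f1 x + riesz_pot f2 x" for x
      unfolding riesz_pot_def using layers_split[OF f L]
      by (subst nn_integral_add[symmetric]) (auto intro!: nn_integral_cong simp: f1_def f2_def distrib_right)
    have "?G t
       \<le> ennreal t * (ennreal C * P + ennreal (r powr (1 - n)) * Q) + (\<integral>\<^sup>+ x. N x \<partial>lborel)"
    proof (rule truncated_distr_le[OF g N(1) W(1) _ t])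
      fix x assume "x \<in> W"
      hence "g x \<le> riesz_pot f1 x + riesz_pot f2 x" using le pot by simp
      also have "\<dots> \<le> ennreal C * P + (ennreal (r powr (1 - n)) * Q + N x)"
        by (intro add_mono P N)
      finally show "g x \<le> ennreal C * P + ennreal (r powr (1 - n)) * Q + N x" by (simp add: add.assoc)
    qed
    also have "\<dots> \<le> ennreal t * (ennreal C * P + ennreal (r powr (1 - n)) * Q) + ennreal (w * r) * Q"
      by (intro add_left_mono N)
    also have "\<dots> = ennreal C * (ennreal t * P) + (ennreal (t * r powr (1 - n)) + ennreal (w * r)) * Q"
      using t by (simp add: distrib_left distrib_right ennreal_mult mult_ac add_ac)
    \<comment> \<open>The choice of \<open>r\<close> balances the far and the near part.\<close>
    also have "t * r powr (1 - n) = r"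
    proof -
      have "t powr 1 * t powr (1/n * (1 - n)) = t powr (1/n)"
        using n2 by (subst powr_add[symmetric]) (simp add: field_simps)
      thus ?thesis unfolding r_def powr_powr using t by simp
    qed
    also have "ennreal r + ennreal (w * r) = ennreal C * ennreal r"
      using r w by (simp add: C ennreal_mult[symmetric] ennreal_plus[symmetric] distrib_right add.commute del: ennreal_plus)
    also have "ennreal C * (ennreal t * P) + ennreal C * ennreal r * Q = ennreal C * (ennreal t * P + ennreal r * Q)"
      by (simp add: distrib_left mult.assoc)
    also have "ennreal t * P + ennreal r * Q = ?H t"
    proof -
      have "ennreal t * P + ennreal r * Q = (\<integral>\<^sup>+ l. ennreal t * (indicator ({0<..} \<inter> L) l * ennreal (s l powr (1/n)))
          + ennreal r * (indicator ({0<..} \<inter> -L) l * ennreal (s l)) \<partial>lborel)"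
        unfolding P_def Q_def by (subst nn_integral_add) (auto simp: nn_integral_cmult)
      also have "\<dots> = ?H t"
      proof (rule nn_integral_cong)
        fix l :: real
        show "ennreal t * (indicator ({0<..} \<inter> L) l * ennreal (s l powr (1/n)))
          + ennreal r * (indicator ({0<..} \<inter> -L) l * ennreal (s l)) = ennreal (H t l) * indicator {0<..} l"
        proof (cases "l > 0")
          case True
          thus ?thesis using t r s[of l]
            by (cases "t < s l") (simp_all add: L_def H_def ennreal_mult r_def mult_ac)
        qed simp
      qed
      finally show ?thesis .
    qed
    finally show ?thesis .
  qed
  have [measurable]: "(\<lambda>(t,l). H t l) \<in> borel_measurable (borel \<Otimes>\<^sub>M borel)"
    unfolding H_def by measurable
  have "lorentz_int n T W g = (\<integral>\<^sup>+ l. (\<integral>\<^sup>+ t. ?k t * ?g t l \<partial>lborel) \<partial>lborel)"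
    unfolding lorentz_int_def lorentz_weight_def
    by (intro nn_integral_cong, subst nn_integral_multc[symmetric]) (auto intro!: nn_integral_cong simp: mult_ac)
  also have "\<dots> = (\<integral>\<^sup>+ t. (\<integral>\<^sup>+ l. ?k t * ?g t l \<partial>lborel) \<partial>lborel)"
    by (rule lborel_pair.Fubini') measurable
  also have "\<dots> = (\<integral>\<^sup>+ t. ?k t * ?G t \<partial>lborel)"
    by (intro nn_integral_cong nn_integral_cmult) measurable
  also have "\<dots> \<le> (\<integral>\<^sup>+ t. ?k t * (ennreal C * ?H t) \<partial>lborel)"
  proof (rule nn_integral_mono)
    fix t :: real
    show "?k t * ?G t
      \<le> ?k t * (ennreal C * ?H t)"
    proof (cases "t > 0")
      case True
      show ?thesis by (rule mult_left_mono[OF key[OF True]]) simp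
    qed simp
  qed
  also have "\<dots> = (\<integral>\<^sup>+ t. (\<integral>\<^sup>+ l. ennreal C * (?k t * ?h t l) \<partial>lborel) \<partial>lborel)"
  proof (rule nn_integral_cong)
    fix t :: real
    have "(\<integral>\<^sup>+ l. ennreal C * (?k t * ?h t l) \<partial>lborel)
      = (\<integral>\<^sup>+ l. (?k t * ennreal C) * ?h t l \<partial>lborel)"
      by (intro nn_integral_cong) (simp only: mult_ac)
    also have "\<dots> = (?k t * ennreal C) * (\<integral>\<^sup>+ l. ennreal (H t l) * indicator {0<..} l \<partial>lborel)"
      by (rule nn_integral_cmult) measurable
    finally show "?k t * (ennreal C * ?H t)
      = (\<integral>\<^sup>+ l. ennreal C * (?k t * ?h t l) \<partial>lborel)"
      by (simp only: mult.assoc)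
  qed
  also have "\<dots> = (\<integral>\<^sup>+ l. (\<integral>\<^sup>+ t. ennreal C * (?k t * ?h t l) \<partial>lborel) \<partial>lborel)"
    by (rule lborel_pair.Fubini') measurable
  also have "\<dots> \<le> (\<integral>\<^sup>+ l. ennreal (2 * C) * (lorentz_weight (n/2) T (distr_fun W f l) * indicator {0<..} l) \<partial>lborel)"
  proof (rule nn_integral_mono)
    fix l :: real
    have "(\<integral>\<^sup>+ t. ennreal C * (?k t * ?h t l) \<partial>lborel)
      = (\<integral>\<^sup>+ t. (ennreal C * indicator {0<..} l) * (ennreal (t powr (1/n - 2)) * ennreal (H t l) * indicator {0<..<T} t) \<partial>lborel)"
      by (intro nn_integral_cong) (simp only: mult_ac)
    also have "\<dots> = (ennreal C * indicator {0<..} l) * (\<integral>\<^sup>+ t\<in>{0<..<T}. ennreal (t powr (1/n - 2)) * ennreal (H t l) \<partial>lborel)"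
      by (rule nn_integral_cmult) measurable
    also have "\<dots> \<le> (ennreal C * indicator {0<..} l) * (2 * lorentz_weight (n/2) T (ennreal (s l)))"
      unfolding H_def by (rule mult_left_mono[OF nn_integral_weight_split_le[OF n2 s]]) simp
    also have "\<dots> = ennreal (2 * C) * (lorentz_weight (n/2) T (distr_fun W f l) * indicator {0<..} l)"
    proof -
      have "ennreal (2 * C) = ennreal C * 2" using w C by (simp add: ennreal_mult mult.commute)
      thus ?thesis unfolding ds by (simp only: mult_ac)
    qed
    finally show "(\<integral>\<^sup>+ t. ennreal C * (?k t * ?h t l) \<partial>lborel)
      \<le> \<dots>" .
  qed
  also have "\<dots> = ennreal (2 * C) * lorentz_int (n/2) T W f"
    unfolding lorentz_int_def by (rule nn_integral_cmult) measurable
  finally show ?thesis unfolding n_def C_def .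
qed

text \<open>The potential of order one maps \<open>L^(n,1)\<close> to bounded functions, because \<open>\<mu>(l)^(1/n)\<close> is dominated by the
  weight of \<open>L^(n,1)\<close>.\<close>

lemma riesz_pot_le_lorentz_int:
  fixes f :: "'a::euclidean_space \<Rightarrow> ennreal"
  assumes n: "DIM('a) \<ge> 2" and f[measurable]: "f \<in> borel_measurable borel"
    and W: "W \<in> sets borel" "emeasure lborel W = ennreal T" "T \<ge> 0"
    and f0: "\<And>x. x \<notin> W \<Longrightarrow> f x = 0"
  shows "riesz_pot f x \<le> ennreal (riesz_const TYPE('a)) * lorentz_int (real DIM('a)) T W f"
proof -
  define n where "n = real DIM('a)"
  define C where "C = riesz_const TYPE('a)"
  have n2: "n \<ge> 2" using n unfolding n_def by simp
  have C: "C \<ge> 0" unfolding C_def riesz_const_def by simp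
  have WL: "W \<in> sets lebesgue" using W by simp
  have fm: "f \<in> borel_measurable (lebesgue_on W)" by (rule measurable_lebesgue_onI) simp
  have [measurable]: "distr_fun W f \<in> borel_measurable borel" using distr_fun_borel[OF fm WL] .
  have dT: "distr_fun W f l \<le> ennreal T" for l
  proof -
    have "distr_fun W f l \<le> emeasure lebesgue W"
      unfolding distr_fun_def using WL by (intro emeasure_mono) auto
    thus ?thesis using W by simp
  qed
  have "layers UNIV f = f" by (rule ext) (rule layers_UNIV)
  hence "riesz_pot f x \<le> (\<integral>\<^sup>+ l. indicator ({0<..} \<inter> UNIV) l * ennreal (C * enn2real (distr_fun W f l) powr (1/n)) \<partial>lborel)"
    using riesz_pot_layers_le[OF n f _ W(1) _ f0, of UNIV x] W unfolding C_def n_def by simp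
  also have "\<dots> \<le> (\<integral>\<^sup>+ l. ennreal C * (lorentz_weight n T (distr_fun W f l) * indicator {0<..} l) \<partial>lborel)"
  proof (rule nn_integral_mono)
    fix l :: real
    define s where "s = enn2real (distr_fun W f l)"
    have "distr_fun W f l < top" using le_less_trans[OF dT[of l]] by simp
    hence ds: "distr_fun W f l = ennreal s" unfolding s_def by simp
    have s: "0 \<le> s" "s \<le> T" using dT[of l] W(3) unfolding ds by (auto simp: s_def)
    have "s powr (1/n) \<le> n * s powr (1/n)" using n2 by (simp add: mult_le_cancel_right1)
    hence "ennreal (s powr (1/n)) \<le> lorentz_weight n T (ennreal s)"
      using lorentz_weight_ge_powr[OF _ s, of n] n2 by (meson ennreal_leI order_trans less_le_trans zero_less_numeral)
    hence "ennreal C * ennreal (s powr (1/n)) * indicator {0<..} l \<le> ennreal C * lorentz_weight n T (ennreal s) * indicator {0<..} l"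
      by (intro mult_left_mono mult_right_mono) simp_all
    thus "indicator ({0<..} \<inter> UNIV) l * ennreal (C * enn2real (distr_fun W f l) powr (1/n))
       \<le> ennreal C * (lorentz_weight n T (distr_fun W f l) * indicator {0<..} l)"
      using C by (simp add: s_def[symmetric] ds[symmetric] ennreal_mult mult_ac)
  qed
  also have "\<dots> = ennreal C * lorentz_int n T W f"
    unfolding lorentz_int_def by (rule nn_integral_cmult) measurable
  finally show ?thesis unfolding C_def n_def .
qed

section \<open>Partial derivatives and integration by parts\<close>

lemma partial_deriv_eqI: "(f has_derivative D) (at x) \<Longrightarrow> partial_deriv b f x = D b"
  unfolding partial_deriv_def using frechet_derivative_at by metis

lemma has_derivative_along_line:
  fixes f :: "'a::euclidean_space \<Rightarrow> real"
  assumes "f differentiable (at (x + t *\<^sub>R b))"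
  shows "((\<lambda>t. f (x + t *\<^sub>R b)) has_real_derivative partial_deriv b f (x + t *\<^sub>R b)) (at t)"
proof -
  define D where "D = frechet_derivative f (at (x + t *\<^sub>R b))"
  have D: "(f has_derivative D) (at (x + t *\<^sub>R b))"
    using assms unfolding D_def by (simp add: frechet_derivative_works[symmetric])
  have "((\<lambda>t. x + t *\<^sub>R b) has_derivative (\<lambda>h. h *\<^sub>R b)) (at t)"
    by (auto intro!: derivative_eq_intros)
  hence "((\<lambda>t. f (x + t *\<^sub>R b)) has_derivative (\<lambda>h. D (h *\<^sub>R b))) (at t)"
    by (rule has_derivative_compose) (rule D)
  moreover have "D (h *\<^sub>R b) = partial_deriv b f (x + t *\<^sub>R b) * h" for h
    using linear_scale[OF has_derivative_linear[OF D], of h b] by (simp add: partial_deriv_def D_def)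
  ultimately show ?thesis by (simp add: has_field_derivative_def)
qed

lemma mvt_partial:
  fixes f :: "'a::euclidean_space \<Rightarrow> real"
  assumes "\<And>x. f differentiable (at x)" "h > 0"
  obtains t where "0 < t" "t < h" "f (x + h *\<^sub>R b) - f x = h * partial_deriv b f (x + t *\<^sub>R b)"
proof -
  have "\<exists>t>0. t < h \<and> f (x + h *\<^sub>R b) - f (x + 0 *\<^sub>R b) = (h - 0) * partial_deriv b f (x + t *\<^sub>R b)"
    by (rule MVT2[OF \<open>h > 0\<close>]) (rule has_derivative_along_line[OF assms(1)])
  thus ?thesis using that by auto
qed

lemma partial_deriv_translate_diff:
  fixes f :: "'a::euclidean_space \<Rightarrow> real"
  assumes "\<And>x. f differentiable (at x)"
  shows "(\<lambda>y. f (y + v) - f y) differentiable (at x)"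
    and "partial_deriv b (\<lambda>y. f (y + v) - f y) x = partial_deriv b f (x + v) - partial_deriv b f x"
proof -
  have D: "(f has_derivative frechet_derivative f (at y)) (at y)" for y
    using assms frechet_derivative_works by blast
  have "((\<lambda>y. y + v) has_derivative (\<lambda>h. h)) (at x)" by (auto intro!: derivative_eq_intros)
  hence "((\<lambda>y. f (y + v)) has_derivative (\<lambda>h. frechet_derivative f (at (x + v)) h)) (at x)"
    by (rule has_derivative_compose) (rule D)
  from has_derivative_diff[OF this D[of x]]
  have *: "((\<lambda>y. f (y + v) - f y) has_derivative
     (\<lambda>h. frechet_derivative f (at (x + v)) h - frechet_derivative f (at x) h)) (at x)" .
  show "(\<lambda>y. f (y + v) - f y) differentiable (at x)" using * unfolding differentiable_def by blast
  show "partial_deriv b (\<lambda>y. f (y + v) - f y) x = partial_deriv b f (x + v) - partial_deriv b f x"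
    using partial_deriv_eqI[OF *] by (simp add: partial_deriv_def)
qed

text \<open>Two applications of the mean value theorem, first in direction \<open>b\<close> to the increment in direction \<open>c\<close>.\<close>

lemma second_difference:
  fixes f :: "'a::euclidean_space \<Rightarrow> real"
  assumes f: "\<And>x. f differentiable (at x)" and fb: "\<And>x. partial_deriv b f differentiable (at x)"
    and h: "h > 0" and nb: "norm b = 1" and nc: "norm c = 1"
  obtains p where "dist p x \<le> 2 * h"
    "f (x + h *\<^sub>R b + h *\<^sub>R c) - f (x + h *\<^sub>R b) - f (x + h *\<^sub>R c) + f x = h * h * partial_deriv c (partial_deriv b f) p"
proof -
  define g where "g = (\<lambda>y. f (y + h *\<^sub>R c) - f y)"
  obtain s where s: "0 < s" "s < h" "g (x + h *\<^sub>R b) - g x = h * partial_deriv b g (x + s *\<^sub>R b)"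
    using mvt_partial[of g h x b] partial_deriv_translate_diff(1)[OF f] h unfolding g_def by blast
  obtain t where t: "0 < t" "t < h" "partial_deriv b f (x + s *\<^sub>R b + h *\<^sub>R c) - partial_deriv b f (x + s *\<^sub>R b)
       = h * partial_deriv c (partial_deriv b f) (x + s *\<^sub>R b + t *\<^sub>R c)"
    using mvt_partial[of "partial_deriv b f" h "x + s *\<^sub>R b" c] fb h by blast
  have "dist (x + s *\<^sub>R b + t *\<^sub>R c) x \<le> norm (s *\<^sub>R b) + norm (t *\<^sub>R c)"
    using norm_triangle_ineq[of "s *\<^sub>R b" "t *\<^sub>R c"] by (simp add: dist_norm add.assoc)
  also have "\<dots> \<le> 2 * h" using s t nb nc by simp
  finally have "dist (x + s *\<^sub>R b + t *\<^sub>R c) x \<le> 2 * h" .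
  moreover have "f (x + h *\<^sub>R b + h *\<^sub>R c) - f (x + h *\<^sub>R b) - f (x + h *\<^sub>R c) + f x = g (x + h *\<^sub>R b) - g x"
    unfolding g_def by (simp add: algebra_simps)
  ultimately show ?thesis
    using that s t partial_deriv_translate_diff(2)[OF f, of b "h *\<^sub>R c"] unfolding g_def by simp
qed

text \<open>The second difference is symmetric in \<open>b\<close> and \<open>c\<close>, so both mixed derivatives take a common value at
  points arbitrarily close to \<open>x\<close>.\<close>

lemma partial_deriv_commute:
  fixes f :: "'a::euclidean_space \<Rightarrow> real"
  assumes f: "\<And>x. f differentiable (at x)" and fb: "\<And>x. partial_deriv b f differentiable (at x)"
    and fc: "\<And>x. partial_deriv c f differentiable (at x)"
    and cb: "continuous_on UNIV (partial_deriv c (partial_deriv b f))"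
    and bc: "continuous_on UNIV (partial_deriv b (partial_deriv c f))"
    and nb: "norm b = 1" and nc: "norm c = 1"
  shows "partial_deriv c (partial_deriv b f) x = partial_deriv b (partial_deriv c f) x"
proof (rule ccontr)
  define P Q where "P = partial_deriv c (partial_deriv b f)" and "Q = partial_deriv b (partial_deriv c f)"
  assume "partial_deriv c (partial_deriv b f) x \<noteq> partial_deriv b (partial_deriv c f) x"
  hence e: "\<bar>P x - Q x\<bar> / 2 > 0" (is "?e > 0") unfolding P_def Q_def by simp
  obtain d1 where d1: "d1 > 0" "\<And>y. dist y x < d1 \<Longrightarrow> dist (P y) (P x) < ?e"
    using cb e unfolding continuous_on_iff P_def[symmetric] by (metis UNIV_I)
  obtain d2 where d2: "d2 > 0" "\<And>y. dist y x < d2 \<Longrightarrow> dist (Q y) (Q x) < ?e"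
    using bc e unfolding continuous_on_iff Q_def[symmetric] by (metis UNIV_I)
  \<comment> \<open>The points produced by \<open>second_difference\<close> are within \<open>2 h\<close> of \<open>x\<close>.\<close>
  define h where "h = min d1 d2 / 4"
  have h: "h > 0" "2 * h < d1" "2 * h < d2" unfolding h_def using d1 d2 by auto
  obtain p where p: "dist p x \<le> 2 * h"
    "f (x + h *\<^sub>R b + h *\<^sub>R c) - f (x + h *\<^sub>R b) - f (x + h *\<^sub>R c) + f x = h * h * P p"
    using second_difference[OF f fb h(1) nb nc] unfolding P_def by blast
  obtain q where q: "dist q x \<le> 2 * h"
    "f (x + h *\<^sub>R c + h *\<^sub>R b) - f (x + h *\<^sub>R c) - f (x + h *\<^sub>R b) + f x = h * h * Q q"
    using second_difference[OF f fc h(1) nc nb] unfolding Q_def by blast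
  have "h * h * P p = h * h * Q q" using p(2) q(2) by (simp add: algebra_simps)
  hence "P p = Q q" using h(1) by simp
  moreover have "dist (P p) (P x) < ?e" using d1(2) p(1) h by simp
  moreover have "dist (Q q) (Q x) < ?e" using d2(2) q(1) h by simp
  ultimately show False by (simp add: dist_real_def abs_if split: if_splits)
qed

lemma integrable_compact_support:
  fixes f :: "'a::euclidean_space \<Rightarrow> real"
  assumes "continuous_on UNIV f" "compact K" "\<And>x. x \<notin> K \<Longrightarrow> f x = 0"
  shows "integrable lborel f"
proof -
  have "integrable lborel (\<lambda>x. indicator K x *\<^sub>R f x)"
    using assms by (intro borel_integrable_compact) (auto intro: continuous_on_subset)
  also have "(\<lambda>x. indicator K x *\<^sub>R f x) = f" using assms(3) by (intro ext) (auto simp: indicator_def)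
  finally show ?thesis .
qed

lemma partial_deriv_outside_support:
  fixes f :: "'a::euclidean_space \<Rightarrow> real"
  assumes "closed K" "\<And>x. x \<notin> K \<Longrightarrow> f x = 0" "x \<notin> K"
  shows "partial_deriv b f x = 0"
proof -
  have "(f has_derivative (\<lambda>_. 0)) (at x)"
    by (rule has_derivative_transform_within_open[of "\<lambda>_. 0" _ x UNIV "- K"]) (use assms in auto)
  thus ?thesis by (rule partial_deriv_eqI)
qed

text \<open>The difference quotients have integral 0 by translation invariance, and they converge to the derivative
  under a fixed bound on a fixed ball.\<close>

lemma integral_partial_deriv_eq_0:
  fixes f :: "'a::euclidean_space \<Rightarrow> real"
  assumes f: "\<And>x. f differentiable (at x)" and c: "continuous_on UNIV (partial_deriv b f)"
    and K: "compact K" "\<And>x. x \<notin> K \<Longrightarrow> f x = 0" and nb: "norm b = 1"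
  shows "(\<integral>x. partial_deriv b f x \<partial>lborel) = 0"
proof -
  have cf: "continuous_on UNIV f"
    using f by (intro continuous_at_imp_continuous_on) (auto intro: differentiable_imp_continuous_within)
  have fint: "integrable lborel f" by (rule integrable_compact_support[OF cf K])
  have [measurable]: "f \<in> borel_measurable borel" using cf by (rule borel_measurable_continuous_onI)
  have [measurable]: "partial_deriv b f \<in> borel_measurable borel" using c by (rule borel_measurable_continuous_onI)
  have pd0: "partial_deriv b f x = 0" if "x \<notin> K" for x
    using partial_deriv_outside_support[of K f x] K that compact_imp_closed by blast
  have "compact (partial_deriv b f ` K)" by (rule compact_continuous_image) (use c K in \<open>auto intro: continuous_on_subset\<close>)
  hence "bounded (partial_deriv b f ` K)" by (rule compact_imp_bounded)
  then obtain M0 where M0: "\<And>x. x \<in> K \<Longrightarrow> \<bar>partial_deriv b f x\<bar> \<le> M0" unfolding bounded_iff by auto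
  define M where "M = max M0 0"
  have M: "\<bar>partial_deriv b f x\<bar> \<le> M" for x
    using M0[of x] pd0[of x] unfolding M_def by (cases "x \<in> K") auto
  obtain R where R: "\<And>x. x \<in> K \<Longrightarrow> norm x \<le> R" using compact_imp_bounded[OF K(1)] unfolding bounded_iff by auto
  define h where "h = (\<lambda>k::nat. 1 / (real k + 1))"
  have h: "0 < h k" "h k \<le> 1" for k unfolding h_def by auto
  have hlim: "h \<longlonglongrightarrow> 0" unfolding h_def using LIMSEQ_inverse_real_of_nat by (simp add: inverse_eq_divide add.commute)
  define D where "D = (\<lambda>k x. (f (x + h k *\<^sub>R b) - f x) / h k)"
  have lim: "(\<lambda>k. (\<integral>x. D k x \<partial>lborel)) \<longlonglongrightarrow> (\<integral>x. partial_deriv b f x \<partial>lborel)"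
  proof (rule integral_dominated_convergence[where w = "\<lambda>x. M * indicator (cball 0 (R + 1)) x"])
    show "integrable lborel (\<lambda>x::'a. M * indicator (cball 0 (R + 1)) x)"
      by (intro integrable_mult_right integrable_real_indicator) (use emeasure_lborel_cball_finite[of "0::'a" "R + 1"] in auto)
    show "AE x in lborel. (\<lambda>k. D k x) \<longlonglongrightarrow> partial_deriv b f x"
    proof (rule AE_I2)
      fix x
      have "((\<lambda>t. f (x + t *\<^sub>R b)) has_real_derivative partial_deriv b f (x + 0 *\<^sub>R b)) (at 0)"
        by (rule has_derivative_along_line) (use f in auto)
      hence l: "((\<lambda>t. (f (x + t *\<^sub>R b) - f x) / t) \<longlongrightarrow> partial_deriv b f x) (at 0)"
        by (simp add: has_field_derivative_iff)
      have "filterlim h (at 0) sequentially"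
        using hlim h(1) by (intro filterlim_atI always_eventually allI) (auto simp: less_imp_neq[symmetric])
      from filterlim_compose[OF l this] show "(\<lambda>k. D k x) \<longlonglongrightarrow> partial_deriv b f x"
        unfolding D_def .
    qed
    show "AE x in lborel. norm (D k x) \<le> M * indicator (cball 0 (R + 1)) x" for k
    proof (rule AE_I2)
      fix x
      show "norm (D k x) \<le> M * indicator (cball 0 (R + 1)) x"
      proof (cases "norm x \<le> R + 1")
        case True
        obtain t where "f (x + h k *\<^sub>R b) - f x = h k * partial_deriv b f (x + t *\<^sub>R b)"
          using mvt_partial[OF f h(1)] by blast
        hence "D k x = partial_deriv b f (x + t *\<^sub>R b)" unfolding D_def using h(1)[of k] by simp
        thus ?thesis using True M by simp
      next
        case False
        have "norm x - norm (h k *\<^sub>R b) \<le> norm (x + h k *\<^sub>R b)"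
          using norm_triangle_ineq2[of x "- (h k *\<^sub>R b)"] by simp
        moreover have "norm (h k *\<^sub>R b) \<le> 1" using nb h[of k] by simp
        ultimately have "\<not> norm (x + h k *\<^sub>R b) \<le> R" "\<not> norm x \<le> R" using False by linarith+
        hence "x + h k *\<^sub>R b \<notin> K" "x \<notin> K" using R by blast+
        thus ?thesis using K(2) False unfolding D_def by simp
      qed
    qed
  qed (auto simp: D_def)
  have "(\<integral>x. D k x \<partial>lborel) = 0" for k
  proof -
    have dist: "distr lborel borel ((+) (h k *\<^sub>R b)) = lborel" by (rule lborel_distr_plus)
    have m: "(+) (h k *\<^sub>R b) \<in> measurable lborel borel" by measurable
    have i1: "integrable lborel (\<lambda>x. f (h k *\<^sub>R b + x))"
      using integrable_distr[OF m, of f] fint unfolding dist by simp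
    have "(\<integral>x. f (h k *\<^sub>R b + x) \<partial>lborel) = (\<integral>x. f x \<partial>distr lborel borel ((+) (h k *\<^sub>R b)))"
      by (rule integral_distr[symmetric]) auto
    hence "(\<integral>x. f (h k *\<^sub>R b + x) - f x \<partial>lborel) = 0"
      using i1 fint unfolding dist by simp
    thus ?thesis unfolding D_def by (simp add: add.commute)
  qed
  hence "(\<lambda>k. (\<integral>x. D k x \<partial>lborel)) \<longlonglongrightarrow> 0" by simp
  thus ?thesis using LIMSEQ_unique[OF lim] by simp
qed

lemma partial_deriv_mult:
  fixes f g :: "'a::euclidean_space \<Rightarrow> real"
  assumes "f differentiable (at x)" "g differentiable (at x)"
  shows "partial_deriv b (\<lambda>x. f x * g x) x = f x * partial_deriv b g x + partial_deriv b f x * g x"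
proof -
  have "(f has_derivative frechet_derivative f (at x)) (at x)" "(g has_derivative frechet_derivative g (at x)) (at x)"
    using assms frechet_derivative_works by blast+
  from partial_deriv_eqI[OF has_derivative_mult[OF this]] show ?thesis
    by (simp add: partial_deriv_def)
qed

lemma partial_deriv_add:
  fixes f g :: "'a::euclidean_space \<Rightarrow> real"
  assumes "f differentiable (at x)" "g differentiable (at x)"
  shows "partial_deriv b (\<lambda>x. f x + g x) x = partial_deriv b f x + partial_deriv b g x"
proof -
  have "(f has_derivative frechet_derivative f (at x)) (at x)" "(g has_derivative frechet_derivative g (at x)) (at x)"
    using assms frechet_derivative_works by blast+
  from partial_deriv_eqI[OF has_derivative_add[OF this]] show ?thesis
    by (simp add: partial_deriv_def)
qed

lemma differentiable_everywhere_continuous: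
  fixes f :: "'a::euclidean_space \<Rightarrow> real"
  assumes "\<And>x. f differentiable (at x)" shows "continuous_on UNIV f"
  using assms by (intro continuous_at_imp_continuous_on) (auto intro: differentiable_imp_continuous_within)

lemma integration_by_parts:
  fixes f g :: "'a::euclidean_space \<Rightarrow> real"
  assumes f: "\<And>x. f differentiable (at x)" and cf: "continuous_on UNIV (partial_deriv b f)"
    and g: "\<And>x. g differentiable (at x)" and cg: "continuous_on UNIV (partial_deriv b g)"
    and K: "compact K" "\<And>x. x \<notin> K \<Longrightarrow> f x = 0" and nb: "norm b = 1"
  shows "(\<integral>x. f x * partial_deriv b g x \<partial>lborel) = - (\<integral>x. partial_deriv b f x * g x \<partial>lborel)"
proof -
  note cont = differentiable_everywhere_continuous[OF f] differentiable_everywhere_continuous[OF g]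
  have eq: "partial_deriv b (\<lambda>x. f x * g x) = (\<lambda>x. f x * partial_deriv b g x + partial_deriv b f x * g x)"
    by (rule ext) (rule partial_deriv_mult[OF f g])
  have c1: "continuous_on UNIV (\<lambda>x. f x * partial_deriv b g x)" and c2: "continuous_on UNIV (\<lambda>x. partial_deriv b f x * g x)"
    by (intro continuous_on_mult cont cf cg)+
  have i1: "integrable lborel (\<lambda>x. f x * partial_deriv b g x)"
    by (rule integrable_compact_support[OF c1 K(1)]) (simp add: K)
  have i2: "integrable lborel (\<lambda>x. partial_deriv b f x * g x)"
    by (rule integrable_compact_support[OF c2 K(1)])
       (simp add: partial_deriv_outside_support[of K f] K compact_imp_closed)
  have "(\<integral>x. partial_deriv b (\<lambda>x. f x * g x) x \<partial>lborel) = 0"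
  proof (rule integral_partial_deriv_eq_0[OF _ _ K(1) _ nb])
    show "(\<lambda>x. f x * g x) differentiable at x" for x by (intro differentiable_mult f g)
    show "continuous_on UNIV (partial_deriv b (\<lambda>x. f x * g x))"
      unfolding eq by (intro continuous_on_add c1 c2)
  qed (simp add: K)
  thus ?thesis unfolding eq using i1 i2 by simp
qed

section \<open>Representation by potentials of derivatives\<close>

text \<open>The field \<open>z / |z|^n\<close> is a multiple of the gradient of the fundamental solution of the Laplacian. With \<open>|z|\<^sup>2\<close>
  replaced by \<open>|z|\<^sup>2 + e\<^sup>2\<close> it becomes smooth (\<open>reg_field\<close> below), and \<open>reg_factor'\<close> appears in its derivative.\<close>

definition reg_factor :: "real \<Rightarrow> 'a::euclidean_space \<Rightarrow> 'a \<Rightarrow> real" where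
  "reg_factor e x y = ((y - x) \<bullet> (y - x) + e\<^sup>2) powr (- real DIM('a) / 2)"

definition reg_factor' :: "real \<Rightarrow> 'a::euclidean_space \<Rightarrow> 'a \<Rightarrow> real" where
  "reg_factor' e x y = real DIM('a) * ((y - x) \<bullet> (y - x) + e\<^sup>2) powr (- real DIM('a) / 2 - 1)"

definition reg_field :: "real \<Rightarrow> 'a::euclidean_space \<Rightarrow> 'a \<Rightarrow> 'a \<Rightarrow> real" where
  "reg_field e x b y = ((y - x) \<bullet> b) * reg_factor e x y"

lemma reg_base_pos: "e > 0 \<Longrightarrow> (y - x) \<bullet> (y - x) + e\<^sup>2 > 0"
  by (simp add: add_nonneg_pos)

lemma reg_field_has_derivative:
  fixes x :: "'a::euclidean_space"
  assumes e: "e > 0"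
  shows "(reg_field e x b has_derivative (\<lambda>h. (h \<bullet> b) * reg_factor e x y - ((y - x) \<bullet> b) * ((y - x) \<bullet> h) * reg_factor' e x y)) (at y)"
proof -
  define q where "q = - real DIM('a) / 2"
  define E where "E = (y - x) \<bullet> (y - x) + e\<^sup>2"
  have E: "E > 0" unfolding E_def by (rule reg_base_pos[OF e])
  have EE: "E powr (q - 1) = E powr q / E" using E by (simp add: powr_diff)
  have "((\<lambda>y. ((y - x) \<bullet> b) * ((y - x) \<bullet> (y - x) + e\<^sup>2) powr q) has_derivative
     (\<lambda>h. ((y - x) \<bullet> b) * (((y - x) \<bullet> (y - x) + e\<^sup>2) powr q * (0 * ln ((y - x) \<bullet> (y - x) + e\<^sup>2)
        + ((y - x) \<bullet> h + h \<bullet> (y - x)) * q / ((y - x) \<bullet> (y - x) + e\<^sup>2))) + (h \<bullet> b) * ((y - x) \<bullet> (y - x) + e\<^sup>2) powr q)) (at y)"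
    using reg_base_pos[OF e, of y x]
    by (auto intro!: derivative_eq_intros)
  thus ?thesis
    unfolding reg_field_def reg_factor_def reg_factor'_def q_def[symmetric] E_def[symmetric] EE
    by (rule has_derivative_eq_rhs) (use E in \<open>auto simp: fun_eq_iff q_def field_simps inner_commute\<close>)
qed

lemma reg_field_differentiable: "e > 0 \<Longrightarrow> reg_field e x b differentiable (at y)"
  using reg_field_has_derivative unfolding differentiable_def by blast

lemma partial_deriv_reg_field:
  fixes x :: "'a::euclidean_space"
  assumes "e > 0"
  shows "partial_deriv c (reg_field e x b) y = (c \<bullet> b) * reg_factor e x y - ((y - x) \<bullet> b) * ((y - x) \<bullet> c) * reg_factor' e x y"
  by (rule partial_deriv_eqI[OF reg_field_has_derivative[OF assms]])

lemma continuous_reg_factor: "e > 0 \<Longrightarrow> continuous_on UNIV (reg_factor e x)"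
  and continuous_reg_factor': "e > 0 \<Longrightarrow> continuous_on UNIV (reg_factor' e x)"
  unfolding reg_factor_def reg_factor'_def using reg_base_pos[of e _ x]
  by (intro continuous_intros; metis less_irrefl)+

lemma continuous_partial_deriv_reg_field:
  assumes "e > 0" shows "continuous_on UNIV (partial_deriv c (reg_field e x b))"
proof -
  have "partial_deriv c (reg_field e x b) = (\<lambda>y. (c \<bullet> b) * reg_factor e x y - ((y - x) \<bullet> b) * ((y - x) \<bullet> c) * reg_factor' e x y)"
    by (rule ext) (rule partial_deriv_reg_field[OF assms])
  thus ?thesis
    by (auto intro!: continuous_intros continuous_reg_factor continuous_reg_factor' assms)
qed

text \<open>The divergence of the regularised field, which concentrates at \<open>x\<close> as \<open>e\<close> tends to 0.\<close>

definition approx_delta :: "real \<Rightarrow> 'a::euclidean_space \<Rightarrow> 'a \<Rightarrow> real" where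
  "approx_delta e x y = e\<^sup>2 * reg_factor' e x y"

lemma divergence_reg_field:
  fixes x :: "'a::euclidean_space"
  assumes e: "e > 0"
  shows "(\<Sum>b\<in>Basis. partial_deriv b (reg_field e x b) y) = approx_delta e x y"
proof -
  define E where "E = (y - x) \<bullet> (y - x) + e\<^sup>2"
  have E: "E > 0" unfolding E_def by (rule reg_base_pos[OF e])
  have "(\<Sum>b\<in>Basis. partial_deriv b (reg_field e x b) y)
     = (\<Sum>b\<in>Basis. reg_factor e x y - ((y - x) \<bullet> b) * ((y - x) \<bullet> b) * reg_factor' e x y)"
    by (intro sum.cong) (auto simp: partial_deriv_reg_field[OF e])
  also have "\<dots> = real DIM('a) * reg_factor e x y - ((y - x) \<bullet> (y - x)) * reg_factor' e x y"
    by (simp add: sum_subtractf sum_distrib_right[symmetric] euclidean_inner[of "y - x" "y - x"])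
  also have "reg_factor e x y = E * E powr (- real DIM('a) / 2 - 1)"
    unfolding reg_factor_def E_def[symmetric] using E by (simp add: powr_diff)
  also have "real DIM('a) * (E * E powr (- real DIM('a) / 2 - 1)) = E * reg_factor' e x y"
    unfolding reg_factor'_def E_def by simp
  finally show ?thesis unfolding approx_delta_def E_def by (simp add: algebra_simps)
qed

lemma norm_reg_field_le_riesz_kernel:
  fixes x :: "'a::euclidean_space"
  assumes e: "e > 0"
  shows "norm (y - x) * reg_factor e x y \<le> riesz_kernel (x - y)"
proof (cases "y = x")
  case False
  define n where "n = real DIM('a)"
  have nz: "norm (y - x) > 0" using False by simp
  have "reg_factor e x y \<le> ((norm (y - x))\<^sup>2) powr (- n / 2)"
    unfolding reg_factor_def n_def power2_norm_eq_inner using False e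
    by (intro powr_mono2') auto
  also have "\<dots> = norm (y - x) powr (- n)"
    using nz powr_powr[of "norm (y - x)" 2 "- n / 2"] by simp
  finally have "norm (y - x) * reg_factor e x y \<le> norm (y - x) powr 1 * norm (y - x) powr (- n)"
    using nz by (intro mult_mono) (auto simp: reg_factor_def)
  also have "\<dots> = riesz_kernel (x - y)"
    unfolding riesz_kernel_def n_def by (subst powr_add[symmetric]) (simp add: norm_minus_commute)
  finally show ?thesis .
qed (simp add: riesz_kernel_def)

text \<open>A lower bound, the same for every \<open>e > 0\<close>, for the integral of \<open>approx_delta e x\<close> over the ball of radius \<open>e\<close>
  around \<open>x\<close>; this is all that an upper bound for \<open>|v x|\<close> requires.\<close>

definition approx_delta_mass :: "'a::euclidean_space itself \<Rightarrow> real" where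
  "approx_delta_mass _ = real DIM('a) * 2 powr (- real DIM('a) / 2 - 1) * unit_ball_vol (real DIM('a))"

lemma approx_delta_mass_pos: "approx_delta_mass TYPE('a::euclidean_space) > 0"
  unfolding approx_delta_mass_def by simp

text \<open>Let \<open>\<kappa> > 0\<close> and choose \<open>d\<close> such that \<open>v\<close> varies by less than \<open>\<kappa>\<close> on the ball of radius \<open>d\<close>. If
  \<open>|v x| > \<kappa>\<close>, then \<open>v\<close> keeps its sign there and the ball of radius \<open>e\<close> alone contributes at least
  \<open>(|v x| - \<kappa>)\<close> times the constant. Outside the ball of radius \<open>d\<close> the kernel is of order \<open>e\<^sup>2\<close>. Let \<open>e\<close> and
  then \<open>\<kappa>\<close> tend to 0.\<close>

lemma approx_delta_concentrates:
  fixes v :: "'a::euclidean_space \<Rightarrow> real"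
  assumes cv: "continuous_on UNIV v" and K: "compact K" "\<And>y. y \<notin> K \<Longrightarrow> v y = 0"
    and M: "\<And>e. e > 0 \<Longrightarrow> \<bar>\<integral>y. v y * approx_delta e x y \<partial>lborel\<bar> \<le> M"
  shows "approx_delta_mass TYPE('a) * \<bar>v x\<bar> \<le> M"
proof -
  define n where "n = real DIM('a)"
  have n: "n > 0" unfolding n_def by simp
  define c0 where "c0 = approx_delta_mass TYPE('a)"
  have c0: "c0 > 0" unfolding c0_def by (rule approx_delta_mass_pos)
  have M0: "0 \<le> M" using M[of 1] by linarith
  have vint: "integrable lborel v" by (rule integrable_compact_support[OF cv K])
  have main: "c0 * (\<bar>v x\<bar> - \<kappa>) \<le> M" if \<kappa>: "\<kappa> > 0" for \<kappa>
  proof (cases "\<bar>v x\<bar> \<le> \<kappa>")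
    case True
    hence "c0 * (\<bar>v x\<bar> - \<kappa>) \<le> 0" using c0 by (simp add: mult_nonneg_nonpos)
    thus ?thesis using M0 by simp
  next
    case False
    define A where "A = \<bar>v x\<bar> - \<kappa>"
    have A: "A > 0" using False unfolding A_def by simp
    obtain d where d: "d > 0" "\<And>y. dist y x < d \<Longrightarrow> dist (v y) (v x) < \<kappa>"
      using cv \<kappa> unfolding continuous_on_iff by (metis UNIV_I)
    define B where "B = n * (d\<^sup>2) powr (- n / 2 - 1) * (\<integral>y. \<bar>v y\<bar> \<partial>lborel)"
    have *: "c0 * A \<le> M + e\<^sup>2 * B" if e: "0 < e" "e \<le> d" for e
    proof -
      define J where "J = A * (e\<^sup>2 * n * (2 * e\<^sup>2) powr (- n / 2 - 1))"
      define I where "I = e\<^sup>2 * n * (d\<^sup>2) powr (- n / 2 - 1)"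
      have kn: "approx_delta e x y \<ge> 0" for y unfolding approx_delta_def reg_factor'_def by simp
      \<comment> \<open>Pointwise: the main contribution of the small ball, minus what the far field can take away.\<close>
      have low: "J * indicator (ball x e) y - I * \<bar>v y\<bar> \<le> sgn (v x) * (v y * approx_delta e x y)" for y
      proof (cases "y \<in> ball x d")
        case True
        have vy: "A \<le> sgn (v x) * v y"
        proof -
          have "\<bar>v y - v x\<bar> < \<kappa>" using d(2)[of y] True by (simp add: dist_commute dist_real_def)
          thus ?thesis using False unfolding A_def by (auto simp: sgn_if abs_if split: if_splits)
        qed
        have I0: "I * \<bar>v y\<bar> \<ge> 0" unfolding I_def using n by simp
        have "J * indicator (ball x e) y \<le> sgn (v x) * (v y * approx_delta e x y)"
        proof (cases "y \<in> ball x e")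
          case True
          have "(y - x) \<bullet> (y - x) = (dist x y)\<^sup>2" by (simp add: dist_norm power2_norm_eq_inner[symmetric] norm_minus_commute)
          also have "\<dots> \<le> e\<^sup>2" using True e by (intro power_mono) auto
          finally have "(2 * e\<^sup>2) powr (- n / 2 - 1) \<le> ((y - x) \<bullet> (y - x) + e\<^sup>2) powr (- n / 2 - 1)"
            using reg_base_pos[OF e(1), of y x] n by (intro powr_mono2') auto
          hence "e\<^sup>2 * n * (2 * e\<^sup>2) powr (- n / 2 - 1) \<le> approx_delta e x y"
            unfolding approx_delta_def reg_factor'_def n_def[symmetric] mult.assoc using n
            by (intro mult_left_mono) auto
          hence "J \<le> (sgn (v x) * v y) * approx_delta e x y"
            unfolding J_def using vy A n by (intro mult_mono) auto
          thus ?thesis using True by (simp add: mult_ac)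
        next
          case False
          have "0 \<le> (sgn (v x) * v y) * approx_delta e x y"
            by (rule mult_nonneg_nonneg) (use vy A kn[of y] in linarith)+
          thus ?thesis using False by (simp add: mult_ac)
        qed
        thus ?thesis using I0 by linarith
      next
        case False
        hence "y \<notin> ball x e" using e by auto
        have "d\<^sup>2 \<le> (y - x) \<bullet> (y - x)"
          using False d power_mono[of d "dist x y" 2] by (simp add: dist_norm power2_norm_eq_inner[symmetric] norm_minus_commute)
        hence "((y - x) \<bullet> (y - x) + e\<^sup>2) powr (- n / 2 - 1) \<le> (d\<^sup>2) powr (- n / 2 - 1)"
          using d(1) n by (intro powr_mono2') (auto intro: add_increasing2)
        hence bI: "approx_delta e x y \<le> I"
          unfolding approx_delta_def reg_factor'_def n_def[symmetric] I_def mult.assoc using n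
          by (intro mult_left_mono) auto
        have "\<bar>sgn (v x) * (v y * approx_delta e x y)\<bar> \<le> \<bar>v y\<bar> * approx_delta e x y"
          using kn[of y] by (simp add: abs_mult sgn_if)
        also have "\<dots> \<le> \<bar>v y\<bar> * I" using bI by (intro mult_left_mono) auto
        finally show ?thesis using \<open>y \<notin> ball x e\<close> by (simp add: mult_ac)
      qed
      have cb: "continuous_on UNIV (\<lambda>y. v y * approx_delta e x y)"
        unfolding approx_delta_def by (intro continuous_intros cv continuous_reg_factor' e)
      have i1: "integrable lborel (\<lambda>y. v y * approx_delta e x y)"
        by (rule integrable_compact_support[OF cb K(1)]) (simp add: K)
      have ib: "integrable lborel (\<lambda>y. J * indicator (ball x e) y :: real)"
        by (intro integrable_mult_right integrable_real_indicator) (use emeasure_lborel_ball_finite[of x e] in auto)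
      have "(\<integral>y. J * indicator (ball x e) y - I * \<bar>v y\<bar> \<partial>lborel) \<le> (\<integral>y. sgn (v x) * (v y * approx_delta e x y) \<partial>lborel)"
        by (rule integral_mono) (use low ib vint i1 in auto)
      also have "\<dots> = sgn (v x) * (\<integral>y. v y * approx_delta e x y \<partial>lborel)" by simp
      also have "\<dots> \<le> \<bar>\<integral>y. v y * approx_delta e x y \<partial>lborel\<bar>"
      proof -
        have "sgn a * b \<le> \<bar>b\<bar>" for a b :: real by (auto simp: sgn_if)
        thus ?thesis .
      qed
      also have "\<dots> \<le> M" by (rule M[OF e(1)])
      also have "(\<integral>y. J * indicator (ball x e) y - I * \<bar>v y\<bar> \<partial>lborel) = J * measure lborel (ball x e) - I * (\<integral>y. \<bar>v y\<bar> \<partial>lborel)"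
        using ib vint by simp
      also have "J * measure lborel (ball x e) = c0 * A"
      proof -
        have m: "measure lborel (ball x e) = unit_ball_vol n * e powr n"
          using e content_ball[of e x] by (simp add: n_def powr_realpow)
        have p: "(2 * e\<^sup>2) powr (- n / 2 - 1) = 2 powr (- n / 2 - 1) * e powr (- n - 2)"
        proof -
          have "(e\<^sup>2) powr (- n / 2 - 1) = (e powr 2) powr (- n / 2 - 1)" using e by simp
          also have "\<dots> = e powr (2 * (- n / 2 - 1))" by (rule powr_powr)
          also have "2 * (- n / 2 - 1) = - n - 2" by simp
          finally show ?thesis using e by (simp add: powr_mult)
        qed
        have u: "e\<^sup>2 * (e powr (- n - 2) * e powr n) = 1"
        proof -
          have "e powr (- n - 2) * e powr n = e powr (-2)" by (simp add: powr_add[symmetric])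
          thus ?thesis using e by (simp add: powr_minus)
        qed
        have "J * measure lborel (ball x e)
           = n * 2 powr (- n / 2 - 1) * unit_ball_vol n * A * (e\<^sup>2 * (e powr (- n - 2) * e powr n))"
          unfolding J_def m p by (simp only: mult_ac)
        thus ?thesis unfolding u by (simp add: c0_def approx_delta_mass_def n_def)
      qed
      finally show ?thesis unfolding I_def B_def by (simp add: mult_ac)
    qed
    have "((\<lambda>e. M + e\<^sup>2 * B) \<longlongrightarrow> M + 0\<^sup>2 * B) (at_right 0)"
      by (intro tendsto_intros)
    moreover have "eventually (\<lambda>e. c0 * A \<le> M + e\<^sup>2 * B) (at_right 0)"
      unfolding eventually_at_right_field using d(1) * by (intro exI[of _ d]) auto
    ultimately have "c0 * A \<le> M + 0\<^sup>2 * B"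
      by (intro tendsto_lowerbound) auto
    thus ?thesis unfolding A_def by simp
  qed
  have "((\<lambda>\<kappa>. c0 * (\<bar>v x\<bar> - \<kappa>)) \<longlongrightarrow> c0 * (\<bar>v x\<bar> - 0)) (at_right 0)"
    by (intro tendsto_intros)
  moreover have "eventually (\<lambda>\<kappa>. c0 * (\<bar>v x\<bar> - \<kappa>) \<le> M) (at_right 0)"
    unfolding eventually_at_right_field using main by (intro exI[of _ 1]) auto
  ultimately have "c0 * (\<bar>v x\<bar> - 0) \<le> M"
    by (intro tendsto_upperbound) auto
  thus ?thesis unfolding c0_def by simp
qed

lemma Ck_on_2_D:
  fixes u :: "'a::euclidean_space \<Rightarrow> real"
  assumes "Ck_on 2 u UNIV"
  shows "\<And>x. u differentiable (at x)"
    and "\<And>b x. b \<in> Basis \<Longrightarrow> partial_deriv b u differentiable (at x)"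
    and "\<And>b c. b \<in> Basis \<Longrightarrow> c \<in> Basis \<Longrightarrow> continuous_on UNIV (partial_deriv c (partial_deriv b u))"
    and "continuous_on UNIV u"
    and "\<And>b. b \<in> Basis \<Longrightarrow> continuous_on UNIV (partial_deriv b u)"
proof -
  show d: "\<And>x. u differentiable (at x)"
    and db: "\<And>b x. b \<in> Basis \<Longrightarrow> partial_deriv b u differentiable (at x)"
    and "\<And>b c. b \<in> Basis \<Longrightarrow> c \<in> Basis \<Longrightarrow> continuous_on UNIV (partial_deriv c (partial_deriv b u))"
    using assms by (auto simp: numeral_2_eq_2)
  show "continuous_on UNIV u" by (rule differentiable_everywhere_continuous[OF d])
  show "\<And>b. b \<in> Basis \<Longrightarrow> continuous_on UNIV (partial_deriv b u)"
    by (rule differentiable_everywhere_continuous[OF db])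
qed

lemma continuous_laplacian:
  assumes "Ck_on 2 u UNIV" shows "continuous_on UNIV (laplacian u)"
  unfolding laplacian_def by (intro continuous_on_sum Ck_on_2_D(3)[OF assms])

lemma continuous_gradient:
  assumes "Ck_on 2 u UNIV" shows "continuous_on UNIV (gradient u)"
  unfolding gradient_def by (intro continuous_on_sum continuous_on_scaleR continuous_on_const Ck_on_2_D(5)[OF assms])

lemma abs_integral_le_nn_integral:
  assumes "(\<integral>\<^sup>+ y. g y \<partial>lborel) = ennreal M" "M \<ge> 0" "\<And>y. ennreal \<bar>f y\<bar> \<le> g y"
  shows "\<bar>\<integral>y. f y \<partial>lborel\<bar> \<le> M"
proof -
  have "ennreal \<bar>\<integral>y. f y \<partial>lborel\<bar> \<le> (\<integral>\<^sup>+ y. ennreal \<bar>f y\<bar> \<partial>lborel)"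
    using integral_norm_bound_ennreal[of lborel f] by (cases "integrable lborel f") (auto simp: not_integrable_integral_eq)
  also have "\<dots> \<le> (\<integral>\<^sup>+ y. g y \<partial>lborel)" by (intro nn_integral_mono assms)
  finally show ?thesis using assms by simp
qed

text \<open>With \<open>G\<close> the regularised field, integrate by parts repeatedly:
  \<open>\<integral> \<partial>\<^sub>i u div G = - \<Sum>\<^sub>k \<integral> \<partial>\<^sub>k \<partial>\<^sub>i u G\<^sub>k = \<Sum>\<^sub>k \<integral> \<partial>\<^sub>k u \<partial>\<^sub>i G\<^sub>k = \<Sum>\<^sub>k \<integral> \<partial>\<^sub>k u \<partial>\<^sub>k G\<^sub>i = - \<integral> \<Delta>u G\<^sub>i\<close>.
  The middle steps use that the second derivatives of \<open>u\<close> commute and that \<open>G\<close> is curl free. Since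
  \<open>|G\<^sub>i|\<close> is at most the Riesz kernel for every \<open>e\<close>, letting \<open>e\<close> tend to 0 gives the claim.\<close>

lemma partial_deriv_le_riesz_pot_laplacian:
  fixes u :: "'a::euclidean_space \<Rightarrow> real"
  assumes u: "Ck_on 2 u UNIV" and K: "compact K" "\<And>y. y \<notin> K \<Longrightarrow> u y = 0" and i: "i \<in> Basis"
  shows "ennreal (approx_delta_mass TYPE('a) * \<bar>partial_deriv i u x\<bar>) \<le> riesz_pot (\<lambda>y. ennreal \<bar>laplacian u y\<bar>) x"
proof (cases "riesz_pot (\<lambda>y. ennreal \<bar>laplacian u y\<bar>) x")
  case (real M)
  note d = Ck_on_2_D[OF u]
  have clK: "closed K" using K(1) by (rule compact_imp_closed)
  have p0: "partial_deriv b u y = 0" if "y \<notin> K" for b y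
    by (rule partial_deriv_outside_support[OF clK K(2) that])
  have pp0: "partial_deriv c (partial_deriv b u) y = 0" if "y \<notin> K" for b c y
    by (rule partial_deriv_outside_support[OF clK p0 that])
  have "approx_delta_mass TYPE('a) * \<bar>partial_deriv i u x\<bar> \<le> M"
  proof (rule approx_delta_concentrates[OF d(5)[OF i] K(1) p0])
    fix e :: real assume e: "e > 0"
    define G where "G = (\<lambda>b. reg_field e x b)"
    note Gd = reg_field_differentiable[OF e, of x, folded G_def]
    note Gc = continuous_partial_deriv_reg_field[OF e, of _ x, folded G_def]
    have cG: "continuous_on UNIV (G b)" for b by (rule differentiable_everywhere_continuous[OF Gd])
    have int1: "integrable lborel (\<lambda>y. partial_deriv a u y * partial_deriv c (G b) y)" if "a \<in> Basis" for a b c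
      by (rule integrable_compact_support[OF _ K(1)]) (auto simp: p0 intro!: continuous_on_mult d(5) Gc that)
    have int2: "integrable lborel (\<lambda>y. partial_deriv c (partial_deriv a u) y * G b y)" if "a \<in> Basis" "c \<in> Basis" for a b c
      by (rule integrable_compact_support[OF _ K(1)]) (auto simp: pp0 intro!: continuous_on_mult d(3) cG that)
    have Gsym: "partial_deriv i (G k) y = partial_deriv k (G i) y" for k y
      unfolding G_def partial_deriv_reg_field[OF e] by (simp add: inner_commute mult_ac)
    have ibp: "(\<integral>y. partial_deriv a u y * partial_deriv c (G b) y \<partial>lborel) = - (\<integral>y. partial_deriv c (partial_deriv a u) y * G b y \<partial>lborel)"
      if "a \<in> Basis" "c \<in> Basis" for a b c
      by (rule integration_by_parts[OF d(2)[OF that(1)] d(3)[OF that] Gd Gc K(1) p0]) (use that in auto)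
    have "(\<integral>y. partial_deriv i u y * approx_delta e x y \<partial>lborel)
       = (\<integral>y. (\<Sum>k\<in>Basis. partial_deriv i u y * partial_deriv k (G k) y) \<partial>lborel)"
      unfolding divergence_reg_field[OF e, symmetric] G_def by (simp add: sum_distrib_left)
    also have "\<dots> = (\<Sum>k\<in>Basis. (\<integral>y. partial_deriv i u y * partial_deriv k (G k) y \<partial>lborel))"
      by (rule Bochner_Integration.integral_sum) (rule int1[OF i])
    also have "\<dots> = (\<Sum>k\<in>Basis. (\<integral>y. partial_deriv k u y * partial_deriv k (G i) y \<partial>lborel))"
    proof (rule sum.cong[OF refl])
      fix k :: 'a assume k: "k \<in> Basis"
      have sym: "partial_deriv k (partial_deriv i u) y = partial_deriv i (partial_deriv k u) y" for y
        by (rule partial_deriv_commute[OF d(1) d(2)[OF i] d(2)[OF k] d(3)[OF i k] d(3)[OF k i]]) (use i k in auto)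
      have "(\<integral>y. partial_deriv i u y * partial_deriv k (G k) y \<partial>lborel) = - (\<integral>y. partial_deriv i (partial_deriv k u) y * G k y \<partial>lborel)"
        unfolding ibp[OF i k] sym ..
      also have "\<dots> = (\<integral>y. partial_deriv k u y * partial_deriv i (G k) y \<partial>lborel)"
        using ibp[OF k i, of k] by simp
      finally show "(\<integral>y. partial_deriv i u y * partial_deriv k (G k) y \<partial>lborel)
         = (\<integral>y. partial_deriv k u y * partial_deriv k (G i) y \<partial>lborel)" unfolding Gsym .
    qed
    also have "\<dots> = (\<Sum>k\<in>Basis. - (\<integral>y. partial_deriv k (partial_deriv k u) y * G i y \<partial>lborel))"
      by (intro sum.cong refl ibp)
    also have "\<dots> = - (\<integral>y. (\<Sum>k\<in>Basis. partial_deriv k (partial_deriv k u) y * G i y) \<partial>lborel)"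
      unfolding sum_negf by (subst Bochner_Integration.integral_sum) (auto intro: int2)
    also have "\<dots> = - (\<integral>y. laplacian u y * G i y \<partial>lborel)"
      unfolding laplacian_def sum_distrib_right ..
    finally have eq: "\<bar>\<integral>y. partial_deriv i u y * approx_delta e x y \<partial>lborel\<bar> = \<bar>\<integral>y. laplacian u y * G i y \<partial>lborel\<bar>"
      by simp
    have "\<bar>\<integral>y. laplacian u y * G i y \<partial>lborel\<bar> \<le> M"
    proof (rule abs_integral_le_nn_integral[OF real(2)[unfolded riesz_pot_def] real(1)])
      fix y
      have "\<bar>G i y\<bar> = \<bar>(y - x) \<bullet> i\<bar> * reg_factor e x y"
        unfolding G_def reg_field_def by (simp add: abs_mult reg_factor_def)
      also have "\<dots> \<le> norm (y - x) * reg_factor e x y"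
        using Basis_le_norm[OF i] by (intro mult_right_mono) (auto simp: reg_factor_def)
      also have "\<dots> \<le> riesz_kernel (x - y)" by (rule norm_reg_field_le_riesz_kernel[OF e])
      finally have "\<bar>laplacian u y * G i y\<bar> \<le> \<bar>laplacian u y\<bar> * riesz_kernel (x - y)"
        unfolding abs_mult by (rule mult_left_mono) simp
      thus "ennreal \<bar>laplacian u y * G i y\<bar> \<le> ennreal \<bar>laplacian u y\<bar> * ennreal (riesz_kernel (x - y))"
        by (subst ennreal_mult'[symmetric]) (auto intro: ennreal_leI simp: riesz_kernel_def)
    qed
    thus "\<bar>\<integral>y. partial_deriv i u y * approx_delta e x y \<partial>lborel\<bar> \<le> M" unfolding eq .
  qed
  thus ?thesis unfolding real(2) by (rule ennreal_leI)
qed simp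

text \<open>The same argument with one integration by parts: \<open>\<integral> u div G = - \<integral> \<nabla>u \<bullet> G\<close>.\<close>

lemma le_riesz_pot_gradient:
  fixes u :: "'a::euclidean_space \<Rightarrow> real"
  assumes u: "Ck_on 2 u UNIV" and K: "compact K" "\<And>y. y \<notin> K \<Longrightarrow> u y = 0"
  shows "ennreal (approx_delta_mass TYPE('a) * \<bar>u x\<bar>) \<le> riesz_pot (\<lambda>y. ennreal (norm (gradient u y))) x"
proof (cases "riesz_pot (\<lambda>y. ennreal (norm (gradient u y))) x")
  case (real M)
  note d = Ck_on_2_D[OF u]
  have clK: "closed K" using K(1) by (rule compact_imp_closed)
  have p0: "partial_deriv b u y = 0" if "y \<notin> K" for b y
    by (rule partial_deriv_outside_support[OF clK K(2) that])
  have "approx_delta_mass TYPE('a) * \<bar>u x\<bar> \<le> M"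
  proof (rule approx_delta_concentrates[OF d(4) K])
    fix e :: real assume e: "e > 0"
    define G where "G = (\<lambda>b. reg_field e x b)"
    note Gd = reg_field_differentiable[OF e, of x, folded G_def]
    note Gc = continuous_partial_deriv_reg_field[OF e, of _ x, folded G_def]
    have cG: "continuous_on UNIV (G b)" for b by (rule differentiable_everywhere_continuous[OF Gd])
    have int1: "integrable lborel (\<lambda>y. u y * partial_deriv c (G b) y)" for b c
      by (rule integrable_compact_support[OF _ K(1)]) (auto simp: K intro!: continuous_on_mult d(4) Gc)
    have int2: "integrable lborel (\<lambda>y. partial_deriv c u y * G b y)" if "c \<in> Basis" for b c
      by (rule integrable_compact_support[OF _ K(1)]) (auto simp: p0 intro!: continuous_on_mult d(5) cG that)
    have "(\<integral>y. u y * approx_delta e x y \<partial>lborel) = (\<integral>y. (\<Sum>k\<in>Basis. u y * partial_deriv k (G k) y) \<partial>lborel)"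
      unfolding divergence_reg_field[OF e, symmetric] G_def by (simp add: sum_distrib_left)
    also have "\<dots> = (\<Sum>k\<in>Basis. (\<integral>y. u y * partial_deriv k (G k) y \<partial>lborel))"
      by (rule Bochner_Integration.integral_sum) (rule int1)
    also have "\<dots> = (\<Sum>k\<in>Basis. - (\<integral>y. partial_deriv k u y * G k y \<partial>lborel))"
      by (intro sum.cong refl integration_by_parts[OF d(1) d(5) Gd Gc K]) auto
    also have "\<dots> = - (\<integral>y. (\<Sum>k\<in>Basis. partial_deriv k u y * G k y) \<partial>lborel)"
      unfolding sum_negf by (subst Bochner_Integration.integral_sum) (auto intro: int2)
    also have "(\<lambda>y. \<Sum>k\<in>Basis. partial_deriv k u y * G k y) = (\<lambda>y. (gradient u y \<bullet> (y - x)) * reg_factor e x y)"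
    proof (rule ext)
      fix y
      have "gradient u y \<bullet> (y - x) = (\<Sum>k\<in>Basis. partial_deriv k u y * ((y - x) \<bullet> k))"
        unfolding gradient_def inner_sum_left by (simp add: inner_commute)
      thus "(\<Sum>k\<in>Basis. partial_deriv k u y * G k y) = (gradient u y \<bullet> (y - x)) * reg_factor e x y"
        unfolding G_def reg_field_def by (simp add: sum_distrib_right mult.assoc)
    qed
    finally have eq: "\<bar>\<integral>y. u y * approx_delta e x y \<partial>lborel\<bar> = \<bar>\<integral>y. (gradient u y \<bullet> (y - x)) * reg_factor e x y \<partial>lborel\<bar>"
      by simp
    have "\<bar>\<integral>y. (gradient u y \<bullet> (y - x)) * reg_factor e x y \<partial>lborel\<bar> \<le> M"
    proof (rule abs_integral_le_nn_integral[OF real(2)[unfolded riesz_pot_def] real(1)])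
      fix y
      have "\<bar>(gradient u y \<bullet> (y - x)) * reg_factor e x y\<bar> = \<bar>gradient u y \<bullet> (y - x)\<bar> * reg_factor e x y"
        by (simp add: abs_mult reg_factor_def)
      also have "\<dots> \<le> (norm (gradient u y) * norm (y - x)) * reg_factor e x y"
        by (intro mult_right_mono Cauchy_Schwarz_ineq2) (simp add: reg_factor_def)
      also have "\<dots> \<le> norm (gradient u y) * riesz_kernel (x - y)"
        unfolding mult.assoc by (intro mult_left_mono norm_reg_field_le_riesz_kernel[OF e]) simp
      finally show "ennreal \<bar>(gradient u y \<bullet> (y - x)) * reg_factor e x y\<bar> \<le> ennreal (norm (gradient u y)) * ennreal (riesz_kernel (x - y))"
        by (subst ennreal_mult'[symmetric]) (auto intro: ennreal_leI simp: riesz_kernel_def)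
    qed
    thus "\<bar>\<integral>y. u y * approx_delta e x y \<partial>lborel\<bar> \<le> M" unfolding eq .
  qed
  thus ?thesis unfolding real(2) by (rule ennreal_leI)
qed simp

section \<open>Cutoff functions\<close>

lemma Ck_on_Suc_imp: "Ck_on (Suc k) f UNIV \<Longrightarrow> Ck_on k f UNIV"
proof (induction k arbitrary: f)
  case 0
  thus ?case by (auto intro: differentiable_everywhere_continuous)
next
  case (Suc k)
  have "Ck_on k (partial_deriv b f) UNIV" if "b \<in> Basis" for b
    by (rule Suc.IH) (use Suc.prems that in simp)
  thus ?case using Suc.prems by simp
qed

lemma Ck_on_add: "Ck_on k f UNIV \<Longrightarrow> Ck_on k g UNIV \<Longrightarrow> Ck_on k (\<lambda>x. f x + g x) UNIV"
proof (induction k arbitrary: f g)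
  case 0
  thus ?case by (auto intro: continuous_on_add)
next
  case (Suc k)
  have d: "\<And>x. f differentiable at x" "\<And>x. g differentiable at x" using Suc.prems by auto
  have "partial_deriv b (\<lambda>x. f x + g x) = (\<lambda>x. partial_deriv b f x + partial_deriv b g x)" for b
    by (rule ext) (rule partial_deriv_add[OF d])
  thus ?case using Suc by (auto intro: differentiable_add)
qed

lemma Ck_on_mult: "Ck_on k f UNIV \<Longrightarrow> Ck_on k g UNIV \<Longrightarrow> Ck_on k (\<lambda>x. f x * g x) UNIV"
proof (induction k arbitrary: f g)
  case 0
  thus ?case by (auto intro: continuous_on_mult)
next
  case (Suc k)
  have d: "\<And>x. f differentiable at x" "\<And>x. g differentiable at x" using Suc.prems by auto
  have eq: "partial_deriv b (\<lambda>x. f x * g x) = (\<lambda>x. f x * partial_deriv b g x + partial_deriv b f x * g x)" for b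
    by (rule ext) (rule partial_deriv_mult[OF d])
  have "Ck_on k (partial_deriv b (\<lambda>x. f x * g x)) UNIV" if "b \<in> Basis" for b
    unfolding eq using Suc.prems that
    by (intro Ck_on_add Suc.IH Ck_on_Suc_imp[OF Suc.prems(1)] Ck_on_Suc_imp[OF Suc.prems(2)]) auto
  thus ?case using d by (auto intro: differentiable_mult)
qed

lemma partial_deriv_const: "partial_deriv b (\<lambda>x. c) = (\<lambda>x. 0)"
  by (rule ext, rule partial_deriv_eqI[OF has_derivative_const])

lemma Ck_on_const: "Ck_on k (\<lambda>x. c) UNIV"
proof (induction k arbitrary: c)
  case (Suc k)
  thus ?case by (simp add: partial_deriv_const)
qed simp

lemma Ck_on_sum: "finite F \<Longrightarrow> (\<And>i. i \<in> F \<Longrightarrow> Ck_on k (f i) UNIV) \<Longrightarrow> Ck_on k (\<lambda>x. \<Sum>i\<in>F. f i x) UNIV"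
  by (induction F rule: finite_induct) (auto simp: Ck_on_const intro: Ck_on_add)

lemma DERIV_pos_part_power:
  "((\<lambda>s::real. max 0 s ^ Suc (Suc k)) has_real_derivative real (Suc (Suc k)) * max 0 s ^ Suc k) (at s)"
proof -
  consider "s < 0" | "s = 0" | "s > 0" by linarith
  thus ?thesis
  proof cases
    case 1
    have "((\<lambda>s::real. 0) has_real_derivative 0) (at s)" by simp
    hence "((\<lambda>s::real. max 0 s ^ Suc (Suc k)) has_real_derivative 0) (at s)"
      by (rule has_field_derivative_transform_within_open[where S="{..<0}"]) (use 1 in auto)
    thus ?thesis using 1 by simp
  next
    case 3
    have "((\<lambda>s::real. s ^ Suc (Suc k)) has_real_derivative real (Suc (Suc k)) * s ^ Suc k) (at s)"
      using DERIV_pow[of "Suc (Suc k)" s UNIV] by simp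
    hence "((\<lambda>s::real. max 0 s ^ Suc (Suc k)) has_real_derivative real (Suc (Suc k)) * s ^ Suc k) (at s)"
      by (rule has_field_derivative_transform_within_open[where S="{0<..}"]) (use 3 in auto)
    thus ?thesis using 3 by simp
  next
    case 2
    have "((\<lambda>h::real. max 0 h ^ Suc k * (max 0 h / h)) \<longlongrightarrow> 0) (at 0)"
    proof (rule Lim_null_comparison)
      show "eventually (\<lambda>h::real. norm (max 0 h ^ Suc k * (max 0 h / h)) \<le> max 0 h ^ Suc k) (at 0)"
        by (intro always_eventually allI) (auto simp: max_def)
      have "((\<lambda>h::real. max 0 h ^ Suc k) \<longlongrightarrow> max 0 0 ^ Suc k) (at 0)"
        by (intro tendsto_intros)
      thus "((\<lambda>h::real. max 0 h ^ Suc k) \<longlongrightarrow> 0) (at 0)" by simp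
    qed
    thus ?thesis using 2 by (simp add: has_field_derivative_iff mult_ac)
  qed
qed

text \<open>Used with \<open>k = 3\<close>, the smallest power of the positive part that is of class \<open>C\<^sup>2\<close>; lower powers occur in its
  derivatives.\<close>

definition ball_bump :: "'a::euclidean_space \<Rightarrow> real \<Rightarrow> nat \<Rightarrow> 'a \<Rightarrow> real" where
  "ball_bump a r k x = max 0 (r\<^sup>2 - (x - a) \<bullet> (x - a)) ^ k"

lemma ball_bump_has_derivative:
  "(ball_bump a r (Suc (Suc k)) has_derivative (\<lambda>h. real (Suc (Suc k)) * ball_bump a r (Suc k) x * (- 2 * ((x - a) \<bullet> h)))) (at x)"
proof -
  have "((\<lambda>x. r\<^sup>2 - (x - a) \<bullet> (x - a)) has_derivative (\<lambda>h. - 2 * ((x - a) \<bullet> h))) (at x)"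
    by (auto intro!: derivative_eq_intros simp: inner_commute)
  from has_derivative_compose[OF this DERIV_pos_part_power[of k, unfolded has_field_derivative_def]]
  show ?thesis unfolding ball_bump_def .
qed

lemma partial_deriv_ball_bump:
  "partial_deriv b (ball_bump a r (Suc (Suc k))) = (\<lambda>x. ball_bump a r (Suc k) x * (- 2 * real (Suc (Suc k)) * ((x - a) \<bullet> b)))"
  by (rule ext) (simp add: partial_deriv_eqI[OF ball_bump_has_derivative] algebra_simps)

lemma continuous_ball_bump: "continuous_on UNIV (ball_bump a r k)"
  unfolding ball_bump_def by (intro continuous_intros)

lemma Ck_on_2_ball_bump: "Ck_on 2 (ball_bump a r 3) UNIV"
proof -
  have d: "ball_bump a r (Suc (Suc k)) differentiable (at x)" for k x
    using ball_bump_has_derivative unfolding differentiable_def by blast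
  have C1: "Ck_on 1 (ball_bump a r (Suc (Suc 0))) UNIV"
    unfolding One_nat_def Ck_on.simps partial_deriv_ball_bump using d
    by (auto intro!: continuous_intros continuous_ball_bump)
  have L: "((\<lambda>x. c * ((x - a) \<bullet> b)) has_derivative (\<lambda>h. c * (h \<bullet> b))) (at x)" for c b x
    by (auto intro!: derivative_eq_intros)
  have pL: "partial_deriv e (\<lambda>x. c * ((x - a) \<bullet> b)) = (\<lambda>x. c * (e \<bullet> b))" for e c b
    by (rule ext) (rule partial_deriv_eqI[OF L])
  have C2: "Ck_on 1 (\<lambda>x. c * ((x - a) \<bullet> b)) UNIV" for c b
    unfolding One_nat_def Ck_on.simps pL using L unfolding differentiable_def by (auto intro!: continuous_intros)
  have "Ck_on 2 (ball_bump a r (Suc (Suc (Suc 0)))) UNIV"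
    unfolding numeral_2_eq_2 Ck_on.simps(2)[of "Suc 0"] partial_deriv_ball_bump
  proof (intro conjI ballI)
    fix b :: 'a
    show "Ck_on (Suc 0) (\<lambda>x. ball_bump a r (Suc (Suc 0)) x * (- 2 * real (Suc (Suc (Suc 0))) * ((x - a) \<bullet> b))) UNIV"
      by (rule Ck_on_mult[OF C1[unfolded One_nat_def] C2[unfolded One_nat_def]])
  qed (rule d)
  thus ?thesis by (simp add: numeral_3_eq_3)
qed

lemma ball_bump_nonneg: "ball_bump a r k x \<ge> 0"
  unfolding ball_bump_def by simp

lemma ball_bump_pos_iff:
  assumes "r > 0" "k > 0" shows "ball_bump a r k x > 0 \<longleftrightarrow> x \<in> ball a r"
proof -
  have "r\<^sup>2 \<le> (norm (x - a))\<^sup>2 \<longleftrightarrow> r \<le> norm (x - a)"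
    using assms by (intro power_mono_iff) auto
  hence "x \<in> ball a r \<longleftrightarrow> (norm (x - a))\<^sup>2 < r\<^sup>2"
    by (metis dist_norm mem_ball norm_minus_commute not_le)
  thus ?thesis unfolding ball_bump_def power2_norm_eq_inner using assms
    by (auto simp: max_def zero_less_power zero_power)
qed

lemma compact_finite_ball_cover:
  fixes K :: "'a::euclidean_space set"
  assumes "compact K" "open U" "K \<subseteq> U"
  obtains F r where "finite F" "r > 0" "\<And>a. a \<in> F \<Longrightarrow> cball a r \<subseteq> U" "K \<subseteq> (\<Union>a\<in>F. ball a r)"
proof -
  obtain e where e: "e > 0" "(\<Union>x\<in>K. ball x e) \<subseteq> U"
    using compact_subset_open_imp_ball_epsilon_subset[OF assms] by blast
  have "K \<subseteq> (\<Union>x\<in>K. ball x (e/2))" using e by force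
  then obtain F where F: "F \<subseteq> K" "finite F" "K \<subseteq> (\<Union>x\<in>F. ball x (e/2))"
    using compactE_image[OF assms(1), of K "\<lambda>x. ball x (e/2)"] by auto
  have "cball a (e/2) \<subseteq> U" if "a \<in> F" for a
  proof -
    have "cball a (e/2) \<subseteq> ball a e" using e(1) by auto
    thus ?thesis using e(2) F(1) that by blast
  qed
  thus ?thesis using that[of F "e/2"] F e by auto
qed

lemma compact_open_neighbourhood:
  fixes K :: "'a::euclidean_space set"
  assumes "compact K" "open U" "K \<subseteq> U"
  obtains W where "open W" "K \<subseteq> W" "compactly_inside W U"
proof -
  obtain F r where F: "finite F" "r > 0" "\<And>a. a \<in> F \<Longrightarrow> cball a r \<subseteq> U" "K \<subseteq> (\<Union>a\<in>F. ball a r)"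
    using compact_finite_ball_cover[OF assms] by metis
  have c: "compact (\<Union>a\<in>F. cball a r)" using F(1) by (intro compact_UN) auto
  have sub: "closure (\<Union>a\<in>F. ball a r) \<subseteq> (\<Union>a\<in>F. cball a r)"
    by (rule closure_minimal) (use c compact_imp_closed in \<open>auto intro!: UN_mono\<close>)
  have "compact (closure (\<Union>a\<in>F. ball a r))"
    using compact_Int_closed[OF c closed_closure, of "\<Union>a\<in>F. ball a r"] sub by (simp add: Int_absorb1)
  moreover have "closure (\<Union>a\<in>F. ball a r) \<subseteq> U" using sub F(3) by blast
  ultimately show ?thesis
    using that[of "\<Union>a\<in>F. ball a r"] F(4) unfolding compactly_inside_def by auto
qed

text \<open>Positivity on \<open>K\<close> suffices for the localisation, since the cutoff can be divided out afterwards; so a finite sum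
  of bumps does.\<close>

lemma C2_cutoff:
  fixes K :: "'a::euclidean_space set"
  assumes "compact K" "open U" "K \<subseteq> U"
  obtains B S where "Ck_on 2 B UNIV" "compact S" "S \<subseteq> U" "\<And>x. 0 \<le> B x" "\<And>x. x \<in> K \<Longrightarrow> 0 < B x" "\<And>x. x \<notin> S \<Longrightarrow> B x = 0"
proof -
  obtain F r where F: "finite F" "r > 0" "\<And>a. a \<in> F \<Longrightarrow> cball a r \<subseteq> U" "K \<subseteq> (\<Union>a\<in>F. ball a r)"
    using compact_finite_ball_cover[OF assms] by metis
  define B where "B = (\<lambda>x. \<Sum>a\<in>F. ball_bump a r 3 x)"
  define S where "S = (\<Union>a\<in>F. cball a r)"
  show ?thesis
  proof (rule that[of B S])
    show "Ck_on 2 B UNIV" unfolding B_def by (intro Ck_on_sum F Ck_on_2_ball_bump)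
    show "compact S" unfolding S_def using F(1) by (intro compact_UN) auto
    show "S \<subseteq> U" unfolding S_def using F(3) by blast
    show "0 \<le> B x" for x unfolding B_def by (intro sum_nonneg ball_bump_nonneg)
    show "0 < B x" if xK: "x \<in> K" for x
    proof -
      obtain a where a: "a \<in> F" "x \<in> ball a r" using F(4) xK by blast
      thus ?thesis unfolding B_def
        by (intro sum_pos2[of F a] F ball_bump_nonneg) (use F(2) ball_bump_pos_iff[of r 3 a x] in auto)
    qed
    show "B x = 0" if "x \<notin> S" for x
      unfolding B_def
    proof (intro sum.neutral ballI)
      fix a assume "a \<in> F"
      hence "x \<notin> ball a r" using that unfolding S_def by auto
      hence "\<not> ball_bump a r 3 x > 0" using ball_bump_pos_iff[of r 3 a x] F(2) by simp
      thus "ball_bump a r 3 x = 0" using ball_bump_nonneg[of a r 3 x] by simp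
    qed
  qed
qed

lemma partial_deriv_2_mult:
  fixes f g :: "'a::euclidean_space \<Rightarrow> real"
  assumes f: "Ck_on 2 f UNIV" and g: "Ck_on 2 g UNIV" and b: "b \<in> Basis"
  shows "partial_deriv b (partial_deriv b (\<lambda>x. f x * g x)) x = f x * partial_deriv b (partial_deriv b g) x
     + 2 * (partial_deriv b f x * partial_deriv b g x) + partial_deriv b (partial_deriv b f) x * g x"
proof -
  note df = Ck_on_2_D[OF f] and dg = Ck_on_2_D[OF g]
  have "partial_deriv b (\<lambda>x. f x * g x) = (\<lambda>x. f x * partial_deriv b g x + partial_deriv b f x * g x)"
    by (rule ext) (rule partial_deriv_mult[OF df(1) dg(1)])
  moreover have "partial_deriv b (\<lambda>x. f x * partial_deriv b g x + partial_deriv b f x * g x) x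
    = partial_deriv b (\<lambda>x. f x * partial_deriv b g x) x + partial_deriv b (\<lambda>x. partial_deriv b f x * g x) x"
    by (intro partial_deriv_add differentiable_mult df dg b)
  ultimately show ?thesis
    by (simp add: partial_deriv_mult df dg b)
qed

lemma laplacian_mult:
  fixes f g :: "'a::euclidean_space \<Rightarrow> real"
  assumes f: "Ck_on 2 f UNIV" and g: "Ck_on 2 g UNIV"
  shows "laplacian (\<lambda>x. f x * g x) x = f x * laplacian g x
     + 2 * (\<Sum>b\<in>Basis. partial_deriv b f x * partial_deriv b g x) + laplacian f x * g x"
proof -
  have "laplacian (\<lambda>x. f x * g x) x = (\<Sum>b\<in>Basis. f x * partial_deriv b (partial_deriv b g) x
     + 2 * (partial_deriv b f x * partial_deriv b g x) + partial_deriv b (partial_deriv b f) x * g x)"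
    unfolding laplacian_def by (intro sum.cong refl partial_deriv_2_mult[OF f g])
  thus ?thesis unfolding laplacian_def
    by (simp only: sum.distrib sum_distrib_left sum_distrib_right)
qed

lemma gradient_mult:
  fixes f g :: "'a::euclidean_space \<Rightarrow> real"
  assumes f: "Ck_on 2 f UNIV" and g: "Ck_on 2 g UNIV"
  shows "gradient (\<lambda>x. f x * g x) x = f x *\<^sub>R gradient g x + g x *\<^sub>R gradient f x"
  unfolding gradient_def
  by (simp add: partial_deriv_mult Ck_on_2_D(1)[OF f] Ck_on_2_D(1)[OF g] scaleR_add_left sum.distrib scaleR_sum_right mult.commute)

lemma abs_partial_deriv_le_gradient: "b \<in> Basis \<Longrightarrow> \<bar>partial_deriv b f x\<bar> \<le> norm (gradient f x)"
proof -
  assume b: "b \<in> Basis"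
  have "gradient f x \<bullet> b = partial_deriv b f x"
    unfolding gradient_def using b by (simp add: inner_sum_left inner_Basis if_distrib sum.delta cong: if_cong)
  thus ?thesis using Basis_le_norm[OF b, of "gradient f x"] by simp
qed

lemma norm_gradient_le: "norm (gradient f x) \<le> (\<Sum>b\<in>Basis. \<bar>partial_deriv b f x\<bar>)"
  unfolding gradient_def by (rule order_trans[OF norm_sum]) (simp add: sum_mono)

lemma bounded_compact_support:
  fixes f :: "'a::euclidean_space \<Rightarrow> real"
  assumes "continuous_on UNIV f" "compact K" "\<And>x. x \<notin> K \<Longrightarrow> f x = 0"
  obtains M where "M > 0" "\<And>x. \<bar>f x\<bar> \<le> M"
proof -
  have "compact (f ` K)" by (rule compact_continuous_image) (use assms in \<open>auto intro: continuous_on_subset\<close>)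
  hence "bounded (f ` K)" by (rule compact_imp_bounded)
  then obtain M where M: "\<And>x. x \<in> K \<Longrightarrow> \<bar>f x\<bar> \<le> M" unfolding bounded_iff by auto
  have "\<bar>f x\<bar> \<le> max M 1" for x using M[of x] assms(3)[of x] by (cases "x \<in> K") auto
  thus ?thesis using that[of "max M 1"] by simp
qed

lemma cutoff_derivative_bounds:
  fixes B :: "'a::euclidean_space \<Rightarrow> real"
  assumes B: "Ck_on 2 B UNIV" and S: "compact S" "\<And>x. x \<notin> S \<Longrightarrow> B x = 0"
  obtains M where "M > 0" "\<And>x. \<bar>B x\<bar> \<le> M" "\<And>x. 2 * (\<Sum>b\<in>Basis. \<bar>partial_deriv b B x\<bar>) \<le> M" "\<And>x. \<bar>laplacian B x\<bar> \<le> M"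
proof -
  note d = Ck_on_2_D[OF B]
  have clS: "closed S" using S by (simp add: compact_imp_closed)
  have p0: "partial_deriv b B y = 0" if "y \<notin> S" for b y
    by (rule partial_deriv_outside_support[OF clS S(2) that])
  have pp0: "partial_deriv c (partial_deriv b B) y = 0" if "y \<notin> S" for b c y
    by (rule partial_deriv_outside_support[OF clS p0 that])
  obtain M1 where M1: "M1 > 0" "\<And>x. \<bar>B x\<bar> \<le> M1"
    using bounded_compact_support[OF d(4) S] by blast
  have "continuous_on UNIV (\<lambda>x. 2 * (\<Sum>b\<in>Basis. \<bar>partial_deriv b B x\<bar>))"
    by (intro continuous_intros d(5))
  then obtain M2 where M2: "M2 > 0" "\<And>x. \<bar>2 * (\<Sum>b\<in>Basis. \<bar>partial_deriv b B x\<bar>)\<bar> \<le> M2"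
    by (rule bounded_compact_support[OF _ S(1)]) (simp_all add: p0)
  obtain M3 where M3: "M3 > 0" "\<And>x. \<bar>laplacian B x\<bar> \<le> M3"
    by (rule bounded_compact_support[OF continuous_laplacian[OF B] S(1)]) (simp_all add: pp0 laplacian_def)
  show ?thesis
  proof (rule that[of "M1 + M2 + M3"])
    show "\<bar>B x\<bar> \<le> M1 + M2 + M3" for x using M1(2)[of x] M2 M3 by linarith
    show "2 * (\<Sum>b\<in>Basis. \<bar>partial_deriv b B x\<bar>) \<le> M1 + M2 + M3" for x using M2(2)[of x] M1(1) M3(1) by linarith
    show "\<bar>laplacian B x\<bar> \<le> M1 + M2 + M3" for x using M3(2)[of x] M1(1) M2(1) by linarith
  qed (use M1 M2 M3 in simp)
qed

section \<open>Local convergence\<close>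

lemma tendsto_0_ennreal_le:
  assumes "\<And>j. f j \<le> ennreal (a j)" "a \<longlonglongrightarrow> 0"
  shows "f \<longlonglongrightarrow> 0"
proof (rule tendsto_sandwich[of "\<lambda>_. 0" f sequentially "\<lambda>j. ennreal (a j)"])
  show "(\<lambda>j. ennreal (a j)) \<longlonglongrightarrow> 0"
    using tendsto_ennrealI[OF assms(2)] by simp
qed (use assms in auto)

lemma lorentz_weight_finite:
  assumes "p > 0" "T \<ge> 0" "s \<ge> 0"
  obtains c where "c \<ge> 0" "lorentz_weight p T (ennreal s) = ennreal c"
proof -
  have "lorentz_weight p T (ennreal s) \<le> ennreal (T powr (1/p - 0) / (1/p - 0)) * ennreal (s powr 0)"
    by (rule lorentz_weight_le_powr) (use assms in auto)
  also have "\<dots> < top" by (simp add: ennreal_mult_less_top)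
  finally show ?thesis using that by (cases "lorentz_weight p T (ennreal s)") auto
qed

lemma laplacian_cutoff_le:
  fixes B \<psi> :: "'a::euclidean_space \<Rightarrow> real"
  assumes B: "Ck_on 2 B UNIV" and p: "Ck_on 2 \<psi> UNIV"
    and M: "\<bar>B x\<bar> \<le> M" "2 * (\<Sum>b\<in>Basis. \<bar>partial_deriv b B x\<bar>) \<le> M" "\<bar>laplacian B x\<bar> \<le> M"
  shows "\<bar>laplacian (\<lambda>x. B x * \<psi> x) x\<bar> \<le> M * (\<bar>laplacian \<psi> x\<bar> + norm (gradient \<psi> x) + \<bar>\<psi> x\<bar>)"
proof -
  have "\<bar>laplacian (\<lambda>x. B x * \<psi> x) x\<bar> \<le> \<bar>B x * laplacian \<psi> x\<bar>
     + \<bar>2 * (\<Sum>b\<in>Basis. partial_deriv b B x * partial_deriv b \<psi> x)\<bar> + \<bar>laplacian B x * \<psi> x\<bar>"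
    unfolding laplacian_mult[OF B p] by linarith
  also have "\<bar>B x * laplacian \<psi> x\<bar> \<le> M * \<bar>laplacian \<psi> x\<bar>"
    unfolding abs_mult using M by (intro mult_right_mono) auto
  also have "\<bar>laplacian B x * \<psi> x\<bar> \<le> M * \<bar>\<psi> x\<bar>"
    unfolding abs_mult using M by (intro mult_right_mono) auto
  also have "\<bar>2 * (\<Sum>b\<in>Basis. partial_deriv b B x * partial_deriv b \<psi> x)\<bar> \<le> M * norm (gradient \<psi> x)"
  proof -
    have "\<bar>\<Sum>b\<in>Basis. partial_deriv b B x * partial_deriv b \<psi> x\<bar> \<le> (\<Sum>b\<in>Basis. \<bar>partial_deriv b B x\<bar> * norm (gradient \<psi> x))"
      by (rule order_trans[OF sum_abs]) (auto intro!: sum_mono mult_left_mono abs_partial_deriv_le_gradient simp: abs_mult)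
    also have "\<dots> = (\<Sum>b\<in>Basis. \<bar>partial_deriv b B x\<bar>) * norm (gradient \<psi> x)"
      by (rule sum_distrib_right[symmetric])
    finally have "\<bar>2 * (\<Sum>b\<in>Basis. partial_deriv b B x * partial_deriv b \<psi> x)\<bar> \<le> (2 * (\<Sum>b\<in>Basis. \<bar>partial_deriv b B x\<bar>)) * norm (gradient \<psi> x)"
      by (simp add: abs_mult)
    also have "\<dots> \<le> M * norm (gradient \<psi> x)" using M by (intro mult_right_mono) auto
    finally show ?thesis .
  qed
  finally show ?thesis by (simp add: distrib_left)
qed

lemma enn_sqrt_le: "enn_powr v (1/2) \<le> 1 + v"
proof (cases v)
  case (real r)
  have "r powr (1/2) \<le> 1 + r"
  proof -
    have "sqrt r \<le> sqrt ((1 + r)\<^sup>2)"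
      using real by (intro real_sqrt_le_mono) (simp add: power2_eq_square algebra_simps)
    thus ?thesis using real by (simp add: powr_half_sqrt)
  qed
  hence "ennreal (r powr (1/2)) \<le> ennreal (1 + r)" by (rule ennreal_leI)
  thus ?thesis using real by (simp add: enn_powr_def)
qed simp

lemma laplacian_cutoff_le_potential:
  fixes B \<psi> :: "'a::euclidean_space \<Rightarrow> real" and v :: ennreal
  assumes "Ck_on 2 B UNIV" "Ck_on 2 \<psi> UNIV" "0 \<le> \<psi> x"
    and M: "M > 0" "\<bar>B x\<bar> \<le> M" "2 * (\<Sum>b\<in>Basis. \<bar>partial_deriv b B x\<bar>) \<le> M" "\<bar>laplacian B x\<bar> \<le> M"
    and e: "e > 0" and G: "ennreal (norm (gradient \<psi> x)) \<le> ennreal e * enn_powr v (1/2)"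
    and L: "ennreal \<bar>laplacian \<psi> x\<bar> \<le> ennreal e * v"
  shows "ennreal \<bar>laplacian (\<lambda>x. B x * \<psi> x) x\<bar> \<le> ennreal (2 * M * e) * v + (ennreal (M * e) + ennreal M * ennreal (\<psi> x))"
proof -
  have "ennreal \<bar>laplacian (\<lambda>x. B x * \<psi> x) x\<bar> \<le> ennreal (M * (\<bar>laplacian \<psi> x\<bar> + norm (gradient \<psi> x) + \<bar>\<psi> x\<bar>))"
    by (intro ennreal_leI laplacian_cutoff_le assms)
  also have "\<dots> = ennreal M * (ennreal \<bar>laplacian \<psi> x\<bar> + ennreal (norm (gradient \<psi> x)) + ennreal (\<psi> x))"
    using M(1) assms(3) by (simp add: ennreal_mult)
  also have "\<dots> \<le> ennreal M * (ennreal e * v + ennreal e * (1 + v) + ennreal (\<psi> x))"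
    using L order_trans[OF G mult_left_mono[OF enn_sqrt_le]]
    by (intro mult_left_mono add_mono order_refl) auto
  also have "\<dots> = ennreal (2 * M * e) * v + (ennreal (M * e) + ennreal M * ennreal (\<psi> x))"
  proof -
    have "ennreal (2 * M * e) = 2 * (ennreal M * ennreal e)" "ennreal (M * e) = ennreal M * ennreal e"
      using M(1) e by (simp_all add: ennreal_mult mult.assoc)
    moreover have "A * (E * v + E * (1 + v) + p) = 2 * (A * E) * v + (A * E + A * p)" for A E p :: ennreal
    proof -
      have "2 * (A * E) * v = A * E * v + A * E * v" by (simp only: mult_2 distrib_right)
      thus ?thesis by (simp only: distrib_left mult_1_right add_ac mult_ac)
    qed
    ultimately show ?thesis by simp
  qed
  finally show ?thesis .
qed

text \<open>Every term on the right tends to 0 with \<open>e\<close>: the first because \<open>V\<close> is in \<open>L^(n/2,1)\<close>, the last because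
  \<open>\<psi>\<close> is bounded by 1 and small in \<open>L\<^sup>1\<close>, where \<open>1/n\<close> serves as an exponent below \<open>1/p = 2/n\<close>.\<close>

lemma lorentz_int_laplacian_cutoff:
  fixes B \<psi> :: "'a::euclidean_space \<Rightarrow> real" and V :: "'a \<Rightarrow> ennreal"
  assumes n: "n \<ge> 2" and B: "Ck_on 2 B UNIV" and \<psi>: "Ck_on 2 \<psi> UNIV" "\<And>x. 0 \<le> \<psi> x \<and> \<psi> x \<le> 1"
    and M: "M > 0" "\<And>x. \<bar>B x\<bar> \<le> M" "\<And>x. 2 * (\<Sum>b\<in>Basis. \<bar>partial_deriv b B x\<bar>) \<le> M" "\<And>x. \<bar>laplacian B x\<bar> \<le> M"
    and e: "e > 0"
    and G: "AE x in lebesgue_on W. ennreal (norm (gradient \<psi> x)) \<le> ennreal e * enn_powr (V x) (1/2)"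
    and L: "AE x in lebesgue_on W. ennreal \<bar>laplacian \<psi> x\<bar> \<le> ennreal e * V x"
    and L1: "L1_norm W \<psi> \<le> ennreal e"
    and V: "V \<in> borel_measurable (lebesgue_on W)" and W: "W \<in> sets lebesgue" and T: "T \<ge> 0"
  shows "lorentz_int (n/2) T W (\<lambda>x. ennreal \<bar>laplacian (\<lambda>x. B x * \<psi> x) x\<bar>)
    \<le> 2 * (ennreal (2 * M * e) * lorentz_int (n/2) T W V)
      + 2 * (2 * (ennreal (M * e) * lorentz_weight (n/2) T (emeasure lebesgue W))
      + 2 * (ennreal M * (ennreal (T powr (1/(n/2) - 1/n) / (1/(n/2) - 1/n) / (1 - 1/n)) * ennreal (e powr (1/n)))))"
proof -
  let ?u = "\<lambda>x. ennreal \<bar>laplacian (\<lambda>x. B x * \<psi> x) x\<bar>"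
  let ?V = "\<lambda>x. ennreal (2 * M * e) * V x" and ?p = "\<lambda>x. ennreal M * ennreal (\<psi> x)"
  let ?N = "lorentz_int (n/2) T W"
  have [measurable]: "\<psi> \<in> borel_measurable borel" "laplacian (\<lambda>x. B x * \<psi> x) \<in> borel_measurable borel"
    using Ck_on_2_D(4)[OF \<psi>(1)] continuous_laplacian[OF Ck_on_mult[OF B \<psi>(1)]]
    by (auto intro: borel_measurable_continuous_onI)
  have um: "?u \<in> borel_measurable (lebesgue_on W)" and mp: "(\<lambda>x. ennreal (\<psi> x)) \<in> borel_measurable (lebesgue_on W)"
    by (rule measurable_lebesgue_onI; measurable)+
  have mV: "?V \<in> borel_measurable (lebesgue_on W)" and mMp: "?p \<in> borel_measurable (lebesgue_on W)"
    and mcMp: "(\<lambda>x. ennreal (M * e) + ?p x) \<in> borel_measurable (lebesgue_on W)"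
    using V mp by auto
  have "AE x in lebesgue_on W. ?u x \<le> ?V x + (ennreal (M * e) + ?p x)"
    using G L by eventually_elim (rule laplacian_cutoff_le_potential[OF B \<psi>(1) _ M e]; use \<psi>(2) in auto)
  hence ae: "AE x in lebesgue. x \<in> W \<longrightarrow> ?u x \<le> ?V x + (ennreal (M * e) + ?p x)"
    using W by (subst (asm) AE_restrict_space_iff) auto
  have "?N ?u \<le> ?N (\<lambda>x. ?V x + (ennreal (M * e) + ?p x))"
    by (intro lorentz_int_mono_distr distr_fun_mono ae um W order_refl borel_measurable_add mV mMp borel_measurable_const)
  also have "\<dots> \<le> 2 * ?N ?V + 2 * ?N (\<lambda>x. ennreal (M * e) + ?p x)"
    by (rule lorentz_int_add[OF mV mcMp W])
  also have "?N ?V = ennreal (2 * M * e) * ?N V"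
    by (rule lorentz_int_scale[OF V W]) (use M(1) e in simp)
  also have "?N (\<lambda>x. ennreal (M * e) + ?p x) \<le> 2 * ?N (\<lambda>x. ennreal (M * e)) + 2 * ?N ?p"
    by (rule lorentz_int_add[OF _ mMp W]) simp
  also have "?N (\<lambda>x. ennreal (M * e)) = ennreal (M * e) * lorentz_weight (n/2) T (emeasure lebesgue W)"
    by (rule lorentz_int_const[OF W]) (use M(1) e in simp)
  also have "?N ?p = ennreal M * ?N (\<lambda>x. ennreal (\<psi> x))"
    by (rule lorentz_int_scale[OF mp W M(1)])
  also have "?N (\<lambda>x. ennreal (\<psi> x)) \<le> ennreal (T powr (1/(n/2) - 1/n) / (1/(n/2) - 1/n) / (1 - 1/n)) * ennreal (e powr (1/n))"
  proof (rule lorentz_int_bounded_by_L1[OF mp W])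
    show "(\<integral>\<^sup>+ x. ennreal (\<psi> x) \<partial>lebesgue_on W) \<le> ennreal e"
      using L1 \<psi>(2) unfolding L1_norm_def by simp
    show "ennreal (\<psi> x) \<le> 1" for x using \<psi>(2)[of x] by (simp flip: ennreal_1)
  qed (use n T e in \<open>auto simp: field_simps\<close>)
  finally show ?thesis by (simp add: mult_left_mono add_left_mono)
qed

text \<open>The two potential estimates combined with the two mapping properties of the potential.\<close>

lemma lorentz_gradient_bound:
  fixes u :: "'a::euclidean_space \<Rightarrow> real"
  assumes n: "DIM('a) \<ge> 2" and u: "Ck_on 2 u UNIV" and S: "compact S" "\<And>x. x \<notin> S \<Longrightarrow> u x = 0"
    and W: "open W" "S \<subseteq> W" "emeasure lborel W = ennreal T" "T \<ge> 0"
  shows "ennreal (approx_delta_mass TYPE('a) / real DIM('a)) * lorentz_int (real DIM('a)) T W (\<lambda>x. ennreal (norm (gradient u x)))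
      \<le> ennreal (2 * riesz_const TYPE('a)) * lorentz_int (real DIM('a) / 2) T W (\<lambda>x. ennreal \<bar>laplacian u x\<bar>)"
    and "ennreal (approx_delta_mass TYPE('a) * \<bar>u x\<bar>) \<le> ennreal (riesz_const TYPE('a)) * lorentz_int (real DIM('a)) T W (\<lambda>x. ennreal (norm (gradient u x)))"
proof -
  have clS: "closed S" using S by (simp add: compact_imp_closed)
  have p0: "partial_deriv b u y = 0" if "y \<notin> S" for b y
    by (rule partial_deriv_outside_support[OF clS S(2) that])
  have pp0: "partial_deriv c (partial_deriv b u) y = 0" if "y \<notin> S" for b c y
    by (rule partial_deriv_outside_support[OF clS p0 that])
  have [measurable]: "laplacian u \<in> borel_measurable borel" "gradient u \<in> borel_measurable borel"
    using continuous_laplacian[OF u] continuous_gradient[OF u] by (auto intro: borel_measurable_continuous_onI)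
  have Wb: "W \<in> sets borel" using W by simp
  define c where "c = approx_delta_mass TYPE('a) / real DIM('a)"
  have c: "c > 0" unfolding c_def using approx_delta_mass_pos[where 'a='a] by simp
  define f where "f = (\<lambda>x. ennreal \<bar>laplacian u x\<bar>)"
  define h where "h = (\<lambda>x. ennreal (norm (gradient u x)))"
  have hm: "h \<in> borel_measurable (lebesgue_on W)" unfolding h_def by (rule measurable_lebesgue_onI) measurable
  have le: "ennreal c * h x \<le> riesz_pot f x" for x
  proof -
    have "approx_delta_mass TYPE('a) * norm (gradient u x) \<le> (\<Sum>b\<in>Basis. approx_delta_mass TYPE('a) * \<bar>partial_deriv b u x\<bar>)"
      unfolding sum_distrib_left[symmetric] using less_imp_le[OF approx_delta_mass_pos[where 'a='a]] by (intro mult_left_mono norm_gradient_le)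
    hence "ennreal (approx_delta_mass TYPE('a) * norm (gradient u x)) \<le> ennreal (\<Sum>b\<in>Basis. approx_delta_mass TYPE('a) * \<bar>partial_deriv b u x\<bar>)"
      by (rule ennreal_leI)
    also have "\<dots> = (\<Sum>b\<in>(Basis::'a set). ennreal (approx_delta_mass TYPE('a) * \<bar>partial_deriv b u x\<bar>))"
      using less_imp_le[OF approx_delta_mass_pos[where 'a='a]] by (intro sum_ennreal[symmetric]) auto
    also have "\<dots> \<le> (\<Sum>b\<in>(Basis::'a set). riesz_pot f x)"
      unfolding f_def by (intro sum_mono partial_deriv_le_riesz_pot_laplacian[OF u S])
    also have "\<dots> = ennreal (real DIM('a)) * riesz_pot f x" by (simp add: ennreal_of_nat_eq_real_of_nat)
    finally have *: "ennreal (approx_delta_mass TYPE('a) * norm (gradient u x)) \<le> ennreal (real DIM('a)) * riesz_pot f x" .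
    have "ennreal c * h x = ennreal (1 / real DIM('a)) * ennreal (approx_delta_mass TYPE('a) * norm (gradient u x))"
      unfolding c_def h_def using less_imp_le[OF approx_delta_mass_pos[where 'a='a]] by (simp add: ennreal_mult''[symmetric])
    also have "\<dots> \<le> ennreal (1 / real DIM('a)) * (ennreal (real DIM('a)) * riesz_pot f x)"
      using * by (rule mult_left_mono) simp
    also have "\<dots> = riesz_pot f x"
      unfolding mult.assoc[symmetric] by (subst ennreal_mult'[symmetric]) auto
    finally show ?thesis .
  qed
  have "ennreal c * lorentz_int (real DIM('a)) T W h = lorentz_int (real DIM('a)) T W (\<lambda>x. ennreal c * h x)"
    by (rule lorentz_int_scale[symmetric]) (use hm Wb c in auto)
  also have "\<dots> \<le> ennreal (2 * riesz_const TYPE('a)) * lorentz_int (real DIM('a) / 2) T W f"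
  proof (rule lorentz_int_riesz_pot[OF n _ _ Wb W(3,4)])
    show "f x = 0" if "x \<notin> W" for x
    proof -
      have "x \<notin> S" using that W(2) by auto
      thus ?thesis unfolding f_def laplacian_def by (simp add: pp0)
    qed
  qed (auto simp: f_def h_def le[unfolded f_def h_def])
  finally show "ennreal (approx_delta_mass TYPE('a) / real DIM('a)) * lorentz_int (real DIM('a)) T W (\<lambda>x. ennreal (norm (gradient u x)))
      \<le> ennreal (2 * riesz_const TYPE('a)) * lorentz_int (real DIM('a) / 2) T W (\<lambda>x. ennreal \<bar>laplacian u x\<bar>)"
    unfolding c_def f_def h_def .
  have "riesz_pot h x \<le> ennreal (riesz_const TYPE('a)) * lorentz_int (real DIM('a)) T W h"
  proof (rule riesz_pot_le_lorentz_int[OF n _ Wb W(3,4)])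
    show "h x = 0" if "x \<notin> W" for x
    proof -
      have "x \<notin> S" using that W(2) by auto
      thus ?thesis unfolding h_def gradient_def by (simp add: p0)
    qed
  qed (auto simp: h_def)
  thus "ennreal (approx_delta_mass TYPE('a) * \<bar>u x\<bar>) \<le> ennreal (riesz_const TYPE('a)) * lorentz_int (real DIM('a)) T W (\<lambda>x. ennreal (norm (gradient u x)))"
    using order_trans[OF le_riesz_pot_gradient[OF u S]] unfolding h_def by blast
qed

text \<open>The localisation argument. All bounds are taken on a neighbourhood \<open>W'\<close> of the closure of \<open>W\<close> and of the
  support of the cutoff, where \<open>V\<close> is still in \<open>L^(n/2,1)\<close>.\<close>

lemma local_convergence:
  fixes \<psi> :: "nat \<Rightarrow> 'a::euclidean_space \<Rightarrow> real" and V :: "'a \<Rightarrow> ennreal" and \<epsilon> :: "nat \<Rightarrow> real"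
  assumes n: "DIM('a) \<ge> 2"
    and C2: "\<And>j. Ck_on 2 (\<psi> j) UNIV" and p01: "\<And>j x. 0 \<le> \<psi> j x \<and> \<psi> j x \<le> 1"
    and U: "open U" "U \<subseteq> \<Omega>" and Om: "open \<Omega>"
    and e: "\<And>j. \<epsilon> j > 0" "\<epsilon> \<longlonglongrightarrow> 0"
    and gradle: "\<And>j. AE x in lebesgue_on \<Omega>. ennreal (norm (gradient (\<psi> j) x)) \<le> ennreal (\<epsilon> j) * enn_powr (V x) (1/2)"
    and laple: "\<And>j. AE x in lebesgue_on \<Omega>. ennreal \<bar>laplacian (\<psi> j) x\<bar> \<le> ennreal (\<epsilon> j) * V x"
    and L1: "\<And>j. L1_norm \<Omega> (\<psi> j) \<le> ennreal (\<epsilon> j)"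
    and V: "V \<in> lorentz_loc (real DIM('a) / 2) 1 U"
    and W: "open W" "compactly_inside W U"
  shows "(\<lambda>j. SUP x\<in>closure W. ennreal \<bar>\<psi> j x\<bar>) \<longlonglongrightarrow> 0"
    and "(\<lambda>j. lorentz_norm (real DIM('a)) 1 W (\<lambda>x. ennreal (norm (gradient (\<psi> j) x)))) \<longlonglongrightarrow> 0"
proof -
  let ?D = "\<lambda>f x. ennreal (norm (gradient f x))" and ?L = "\<lambda>f x. ennreal \<bar>laplacian f x\<bar>"
  define n where "n = real DIM('a)"
  have n2: "n \<ge> 2" using n unfolding n_def by simp
  have main: "(\<lambda>j. SUP x\<in>closure W. ennreal \<bar>\<psi> j x\<bar>) \<longlonglongrightarrow> 0 \<and>
    (\<lambda>j. lorentz_norm n 1 W (?D (\<psi> j))) \<longlonglongrightarrow> 0"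
  proof (cases "W = {}")
    case True
    have "lorentz_norm n 1 {} f = 0" for f :: "'a \<Rightarrow> ennreal"
      unfolding lorentz_norm_def by simp
    thus ?thesis using True by (simp add: bot_ennreal)
  next
    case ne: False
    have K0: "compact (closure W)" "closure W \<subseteq> U" using W(2) unfolding compactly_inside_def by auto
    obtain B S where B: "Ck_on 2 B UNIV" "compact S" "S \<subseteq> U" "\<And>x. 0 \<le> B x" "\<And>x. x \<in> closure W \<Longrightarrow> 0 < B x" "\<And>x. x \<notin> S \<Longrightarrow> B x = 0"
      using C2_cutoff[OF K0(1) U(1) K0(2)] by metis
    obtain W' where W': "open W'" "S \<union> closure W \<subseteq> W'" "compactly_inside W' U"
      using compact_open_neighbourhood[of "S \<union> closure W" U] B(2,3) K0 U(1) by (metis compact_Un Un_least)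
    have WW': "W \<subseteq> W'" using W'(2) closure_subset by blast
    have W'Om: "W' \<subseteq> \<Omega>" using W'(3) U(2) closure_subset unfolding compactly_inside_def by blast
    have bW': "bounded W'" using W'(3) bounded_subset[OF compact_imp_bounded closure_subset] unfolding compactly_inside_def by blast
    define T where "T = measure lborel W'"
    let ?N = "\<lambda>p. lorentz_int p T W'"
    have T: "emeasure lborel W' = ennreal T" "T \<ge> 0"
      using emeasure_bounded_finite[OF bW'] by (simp_all add: T_def emeasure_eq_ennreal_measure)
    have WL: "W' \<in> sets lebesgue" "W \<in> sets lebesgue" using W'(1) W(1) by auto
    have pos: "measure lborel A > 0" "emeasure lborel A = ennreal (measure lborel A)" if A: "open A" "A \<noteq> {}" "A \<subseteq> W'" for A
    proof -
      have "emeasure lborel A \<noteq> 0" using A(1,2) open_not_negligible[of A]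
        by (auto simp: negligible_iff_null_sets null_sets_def)
      moreover have f: "emeasure lborel A < \<infinity>" using emeasure_bounded_finite[OF bounded_subset[OF bW' A(3)]] .
      ultimately show "measure lborel A > 0" by (simp add: measure_def enn2real_positive_iff zero_less_iff_neq_zero)
      show "emeasure lborel A = ennreal (measure lborel A)" using f by (simp add: emeasure_eq_ennreal_measure)
    qed
    have Tpos: "T > 0" unfolding T_def using pos(1)[OF W'(1)] ne WW' by blast
    have eW': "emeasure lebesgue W' = ennreal T" "measure lebesgue W' = T"
      using T W'(1) by (simp_all add: T_def)
    have VW: "V \<in> lorentz (n / 2) 1 W'" using V W'(1,3) unfolding lorentz_loc_def n_def by blast
    hence Vm: "V \<in> borel_measurable (lebesgue_on W')" and Vn: "lorentz_norm (n/2) 1 W' V < \<infinity>"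
      unfolding lorentz_def by auto
    have "ennreal T * (1 / ennreal T * ?N (n/2) V) < \<infinity>"
      using Vn unfolding lorentz_norm_1_eq[OF Vm WL(1)] lorentz_int_def[symmetric] eW' by (simp add: ennreal_mult_less_top)
    moreover have "ennreal T * (1 / ennreal T) = 1"
      using Tpos by (simp add: divide_ennreal ennreal_mult'[symmetric] flip: ennreal_1)
    ultimately have "?N (n/2) V < \<infinity>" by (simp add: mult.assoc[symmetric])
    then obtain NV where NV: "?N (n/2) V = ennreal NV" "NV \<ge> 0"
      by (cases "?N (n/2) V") auto
    obtain w1 where w1: "w1 \<ge> 0" "lorentz_weight (n/2) T (ennreal T) = ennreal w1"
      using lorentz_weight_finite[of "n/2" T T] n2 T(2) by auto
    obtain w2 where w2: "w2 \<ge> 0" "lorentz_weight n T (ennreal T) = ennreal w2"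
      using lorentz_weight_finite[of n T T] n2 T(2) by auto
    obtain M where M: "M > 0" "\<And>x. \<bar>B x\<bar> \<le> M" "\<And>x. 2 * (\<Sum>b\<in>Basis. \<bar>partial_deriv b B x\<bar>) \<le> M" "\<And>x. \<bar>laplacian B x\<bar> \<le> M"
      using cutoff_derivative_bounds[OF B(1,2,6)] by blast
    \<comment> \<open>Dividing by \<open>B\<close> on the closure of \<open>W\<close> costs the factor \<open>1/m\<close>.\<close>
    obtain m where m: "m > 0" "\<And>x. x \<in> closure W \<Longrightarrow> m \<le> B x"
    proof -
      have "continuous_on (closure W) B" using Ck_on_2_D(4)[OF B(1)] by (rule continuous_on_subset) simp
      then obtain x0 where "x0 \<in> closure W" "\<forall>x\<in>closure W. B x0 \<le> B x"
        using continuous_attains_inf[OF K0(1)] ne by auto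
      thus ?thesis using that[of "B x0"] B(5) by auto
    qed
    define C1 where "C1 = T powr (1/(n/2) - 1/n) / (1/(n/2) - 1/n) / (1 - 1/n)"
    have C1: "C1 \<ge> 0" unfolding C1_def using n2 T(2) by (auto intro!: divide_nonneg_nonneg simp: field_simps)
    define u where "u = (\<lambda>j x. B x * \<psi> j x)"
    have uC2: "Ck_on 2 (u j) UNIV" for j unfolding u_def by (rule Ck_on_mult[OF B(1) C2])
    have u0: "u j x = 0" if "x \<notin> S" for j x unfolding u_def using B(6)[OF that] by simp
    \<comment> \<open>The bound of \<open>lorentz_int_laplacian_cutoff\<close>, as a real null sequence.\<close>
    define a where "a = (\<lambda>j. 4 * M * \<epsilon> j * NV + 4 * (M * \<epsilon> j * w1) + 4 * (M * C1 * \<epsilon> j powr (1/n)))"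
    have a0: "a j \<ge> 0" for j unfolding a_def using M(1) e(1)[of j] NV w1 C1 by simp
    have alim: "a \<longlonglongrightarrow> 0"
    proof -
      have "(\<lambda>j. \<epsilon> j powr (1/n)) \<longlonglongrightarrow> 0"
        using n2 by (intro tendsto_zero_powrI[OF e(2) tendsto_const] always_eventually allI less_imp_le[OF e(1)]) simp
      hence "a \<longlonglongrightarrow> 4 * M * 0 * NV + 4 * (M * 0 * w1) + 4 * (M * C1 * 0)"
        unfolding a_def by (intro tendsto_intros e(2))
      thus ?thesis by simp
    qed
    have lapN: "?N (n/2) (?L (u j)) \<le> ennreal (a j)" for j
    proof -
      have L1': "L1_norm W' (\<psi> j) \<le> ennreal (\<epsilon> j)"
      proof -
        have "L1_norm W' (\<psi> j) = (\<integral>\<^sup>+ x. ennreal \<bar>\<psi> j x\<bar> * indicator W' x \<partial>lebesgue)"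
          unfolding L1_norm_def using WL(1) by (intro nn_integral_restrict_space) auto
        also have "\<dots> \<le> (\<integral>\<^sup>+ x. ennreal \<bar>\<psi> j x\<bar> * indicator \<Omega> x \<partial>lebesgue)"
          using W'Om by (intro nn_integral_mono mult_left_mono) (auto simp: indicator_def)
        also have "\<dots> = L1_norm \<Omega> (\<psi> j)"
          unfolding L1_norm_def using Om by (intro nn_integral_restrict_space[symmetric]) auto
        finally show ?thesis using L1[of j] by simp
      qed
      have aeW: "AE x in lebesgue_on W'. P x" if "AE x in lebesgue_on \<Omega>. P x" for P
      proof -
        have "AE x in lebesgue. x \<in> \<Omega> \<longrightarrow> P x" using that Om by (subst (asm) AE_restrict_space_iff) auto
        hence "AE x in lebesgue. x \<in> W' \<longrightarrow> P x" by eventually_elim (use W'Om in auto)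
        thus ?thesis using WL(1) by (subst AE_restrict_space_iff) auto
      qed
      have "?N (n/2) (?L (u j)) \<le> 2 * (ennreal (2 * M * \<epsilon> j) * ennreal NV)
        + 2 * (2 * (ennreal (M * \<epsilon> j) * ennreal w1) + 2 * (ennreal M * (ennreal C1 * ennreal (\<epsilon> j powr (1/n)))))"
        using lorentz_int_laplacian_cutoff[OF n2 B(1) C2 p01 M e(1) aeW[OF gradle] aeW[OF laple] L1' Vm WL(1) T(2)]
        unfolding u_def C1_def eW' NV(1) w1(2) .
      also have "\<dots> = ennreal (a j)"
      proof -
        have two: "2 * ennreal y = ennreal (2 * y)" if "y \<ge> 0" for y using that by (simp add: ennreal_mult)
        have "ennreal M * (ennreal C1 * ennreal (\<epsilon> j powr (1/n))) = ennreal (M * C1 * \<epsilon> j powr (1/n))"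
          using M(1) C1 by (simp add: ennreal_mult mult.assoc)
        moreover have "ennreal (2 * M * \<epsilon> j) * ennreal NV = ennreal (2 * M * \<epsilon> j * NV)" "ennreal (M * \<epsilon> j) * ennreal w1 = ennreal (M * \<epsilon> j * w1)"
          using M(1) e(1)[of j] NV w1 by (simp_all add: ennreal_mult')
        moreover have nn: "2 * M * \<epsilon> j * NV \<ge> 0" "M * \<epsilon> j * w1 \<ge> 0" "M * C1 * \<epsilon> j powr (1/n) \<ge> 0"
          using M(1) e(1)[of j] NV w1 C1 by auto
        ultimately show ?thesis unfolding a_def
          by (simp only: two ennreal_plus[symmetric] mult_nonneg_nonneg add_nonneg_nonneg zero_le_numeral) (simp add: algebra_simps)
      qed
      finally show ?thesis .
    qed
    define c0 where "c0 = approx_delta_mass TYPE('a)"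
    have c0: "c0 > 0" unfolding c0_def by (rule approx_delta_mass_pos)
    define C where "C = riesz_const TYPE('a)"
    have C: "C > 0" unfolding C_def riesz_const_def by (simp add: add_nonneg_pos)
    have SW': "S \<subseteq> W'" using W'(2) by blast
    define g where "g = (\<lambda>j. n / c0 * (2 * C * a j))"
    have g0: "g j \<ge> 0" for j unfolding g_def using n2 c0 C a0 by simp
    have gradN: "?N n (?D (u j)) \<le> ennreal (g j)" for j
    proof -
      define X where "X = ?N n (?D (u j))"
      have "ennreal (c0 / n) * X \<le> ennreal (2 * C) * ?N (n/2) (?L (u j))"
        using lorentz_gradient_bound(1)[OF n uC2 B(2) u0 W'(1) SW' T] unfolding X_def c0_def n_def C_def .
      also have "\<dots> \<le> ennreal (2 * C) * ennreal (a j)" by (intro mult_left_mono lapN) simp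
      finally have "ennreal (n / c0) * (ennreal (c0 / n) * X) \<le> ennreal (n / c0) * (ennreal (2 * C) * ennreal (a j))"
        by (rule mult_left_mono) simp
      also have "ennreal (n / c0) * (ennreal (c0 / n) * X) = X"
        unfolding mult.assoc[symmetric] using c0 n2 by (subst ennreal_mult'[symmetric]) auto
      also have "ennreal (n / c0) * (ennreal (2 * C) * ennreal (a j)) = ennreal (g j)"
      proof -
        have 1: "0 \<le> n / c0" "0 \<le> 2 * C" "0 \<le> 2 * C * a j" using c0 n2 C a0[of j] by auto
        show ?thesis unfolding g_def ennreal_mult[OF 1(1,3)] ennreal_mult[OF 1(2) a0] ..
      qed
      finally show ?thesis unfolding X_def .
    qed
    define D where "D = (\<lambda>j. C * g j / c0)"
    have D0: "D j \<ge> 0" for j unfolding D_def using g0 c0 C by simp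
    have uD: "\<bar>u j x\<bar> \<le> D j" for j x
    proof -
      have "ennreal (c0 * \<bar>u j x\<bar>) \<le> ennreal C * ?N n (?D (u j))"
        using lorentz_gradient_bound(2)[OF n uC2 B(2) u0 W'(1) SW' T] unfolding c0_def n_def C_def .
      also have "\<dots> \<le> ennreal C * ennreal (g j)" by (intro mult_left_mono gradN) simp
      also have "\<dots> = ennreal (C * g j)" using C g0[of j] by (simp add: ennreal_mult)
      finally have "c0 * \<bar>u j x\<bar> \<le> C * g j" using C g0[of j] by simp
      thus ?thesis unfolding D_def using c0 by (simp add: field_simps)
    qed
    have pD: "\<bar>\<psi> j x\<bar> \<le> D j / m" if "x \<in> closure W" for j x
    proof -
      have "m * \<bar>\<psi> j x\<bar> \<le> \<bar>u j x\<bar>"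
        unfolding u_def abs_mult using m(2)[OF that] m(1) by (intro mult_right_mono) auto
      thus ?thesis using uD[of j x] m(1) by (simp add: field_simps)
    qed
    have glim: "g \<longlonglongrightarrow> 0" unfolding g_def using tendsto_mult_left[OF tendsto_mult_left[OF alim, of "2*C"], of "n/c0"] by simp
    have Dlim: "D \<longlonglongrightarrow> 0" unfolding D_def using tendsto_divide[OF tendsto_mult_left[OF glim, of C] tendsto_const[of c0]] c0 by simp
    have sup: "(\<lambda>j. SUP x\<in>closure W. ennreal \<bar>\<psi> j x\<bar>) \<longlonglongrightarrow> 0"
    proof (rule tendsto_0_ennreal_le)
      show "(SUP x\<in>closure W. ennreal \<bar>\<psi> j x\<bar>) \<le> ennreal (D j / m)" for j
        by (intro SUP_least ennreal_leI pD)
      show "(\<lambda>j. D j / m) \<longlonglongrightarrow> 0" using tendsto_divide[OF Dlim tendsto_const[of m]] m(1) by simp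
    qed
    define \<kappa> where "\<kappa> = (\<lambda>j. M * (D j / m) / m)"
    have k0: "\<kappa> j \<ge> 0" for j unfolding \<kappa>_def using M(1) D0 m(1) by simp
    have klim: "\<kappa> \<longlonglongrightarrow> 0"
      unfolding \<kappa>_def using tendsto_divide[OF tendsto_mult_left[OF tendsto_divide[OF Dlim tendsto_const[of m]], of M] tendsto_const[of m]] m(1) by simp
    define t where "t = measure lborel W"
    have t: "t > 0" "emeasure lborel W = ennreal t" unfolding t_def using pos[OF W(1) ne WW'] by auto
    have tT: "t \<le> T"
    proof -
      have "emeasure lborel W \<le> emeasure lborel W'" using W'(1) WW' by (intro emeasure_mono) auto
      thus ?thesis using t T by simp
    qed
    define b where "b = (\<lambda>j. 1 / t * (2 * (1 / m * g j) + 2 * (\<kappa> j * w2)))"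
    have blim: "b \<longlonglongrightarrow> 0"
    proof -
      have "b \<longlonglongrightarrow> 1 / t * (2 * (1 / m * 0) + 2 * (0 * w2))"
        unfolding b_def by (intro tendsto_intros glim klim)
      thus ?thesis by simp
    qed
    have "lorentz_norm n 1 W (?D (\<psi> j)) \<le> ennreal (b j)" for j
    proof -
      have [measurable]: "gradient (\<psi> j) \<in> borel_measurable borel" "gradient (u j) \<in> borel_measurable borel"
        using continuous_gradient[OF uC2] continuous_gradient[OF C2] by (auto intro: borel_measurable_continuous_onI)
      have gm: "(?D (\<psi> j)) \<in> borel_measurable (lebesgue_on W)"
        and um: "(?D (u j)) \<in> borel_measurable (lebesgue_on W')"
        by (rule measurable_lebesgue_onI; measurable)+
      have cm: "(\<lambda>x. ennreal (1 / m) * ?D (u j) x) \<in> borel_measurable (lebesgue_on W')"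
        using um by simp
      have pw: "?D (\<psi> j) x \<le> ennreal (1 / m) * ?D (u j) x + ennreal (\<kappa> j)" if "x \<in> W" for x
      proof -
        have xc: "x \<in> closure W" using that closure_subset by blast
        have "gradient (u j) x = B x *\<^sub>R gradient (\<psi> j) x + \<psi> j x *\<^sub>R gradient B x"
          unfolding u_def by (rule gradient_mult[OF B(1) C2])
        \<comment> \<open>Solve the product rule for \<open>\<nabla>\<psi>\<^sub>j\<close>; the remaining term contains only \<open>\<psi>\<^sub>j\<close>, which is uniformly small on \<open>W\<close>.\<close>
        hence "B x *\<^sub>R gradient (\<psi> j) x = gradient (u j) x - \<psi> j x *\<^sub>R gradient B x" by simp
        hence "norm (B x *\<^sub>R gradient (\<psi> j) x) \<le> norm (gradient (u j) x) + norm (\<psi> j x *\<^sub>R gradient B x)"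
          by (metis norm_triangle_ineq4)
        hence "B x * norm (gradient (\<psi> j) x) \<le> norm (gradient (u j) x) + \<bar>\<psi> j x\<bar> * norm (gradient B x)"
          using B(4)[of x] by simp
        moreover have "m * norm (gradient (\<psi> j) x) \<le> B x * norm (gradient (\<psi> j) x)"
          using m(2)[OF xc] by (intro mult_right_mono) auto
        moreover have "\<bar>\<psi> j x\<bar> * norm (gradient B x) \<le> (D j / m) * M"
        proof (intro mult_mono pD[OF xc])
          have "0 \<le> (\<Sum>b\<in>Basis. \<bar>partial_deriv b B x\<bar>)" by (intro sum_nonneg) auto
          thus "norm (gradient B x) \<le> M" using norm_gradient_le[of B x] M(3)[of x] by linarith
        qed (use D0 m(1) in auto)
        ultimately have "m * norm (gradient (\<psi> j) x) \<le> norm (gradient (u j) x) + M * (D j / m)"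
          by (simp add: mult.commute)
        hence "norm (gradient (\<psi> j) x) \<le> 1 / m * norm (gradient (u j) x) + \<kappa> j"
          unfolding \<kappa>_def using m(1) by (simp add: field_simps)
        hence "?D (\<psi> j) x \<le> ennreal (1 / m * norm (gradient (u j) x) + \<kappa> j)"
          by (rule ennreal_leI)
        thus ?thesis using m(1) k0[of j] by (simp add: ennreal_mult'[symmetric])
      qed
      have "lorentz_norm n 1 W (?D (\<psi> j))
          = 1 / ennreal t * lorentz_int n t W (?D (\<psi> j))"
        unfolding lorentz_norm_1_eq[OF gm WL(2)] lorentz_int_def using W(1) t by (simp add: t_def)
      also have "lorentz_int n t W (?D (\<psi> j))
          \<le> ?N n (\<lambda>x. ennreal (1 / m) * ?D (u j) x + ennreal (\<kappa> j))"
        by (intro lorentz_int_mono_distr distr_fun_mono gm WL WW' tT borel_measurable_add cm borel_measurable_const AE_I2) (use pw in auto)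
      also have "\<dots> \<le> 2 * ?N n (\<lambda>x. ennreal (1 / m) * ?D (u j) x) + 2 * ?N n (\<lambda>x. ennreal (\<kappa> j))"
        by (rule lorentz_int_add[OF cm _ WL(1)]) simp
      also have "?N n (\<lambda>x. ennreal (1 / m) * ?D (u j) x) = ennreal (1 / m) * ?N n (?D (u j))"
        by (rule lorentz_int_scale[OF um WL(1)]) (use m(1) in simp)
      also have "?N n (\<lambda>x. ennreal (\<kappa> j)) = ennreal (\<kappa> j) * ennreal w2"
        using lorentz_int_const[OF WL(1) k0, of n T j] eW' w2 by simp
      also have "?N n (?D (u j)) \<le> ennreal (g j)" by (rule gradN)
      finally have "lorentz_norm n 1 W (?D (\<psi> j))
         \<le> 1 / ennreal t * (2 * (ennreal (1 / m) * ennreal (g j)) + 2 * (ennreal (\<kappa> j) * ennreal w2))"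
        by (simp add: mult_left_mono add_right_mono)
      also have "\<dots> = ennreal (b j)"
      proof -
        have two: "2 * ennreal y = ennreal (2 * y)" if "y \<ge> 0" for y using that by (simp add: ennreal_mult)
        have 1: "1 / ennreal t = ennreal (1 / t)" using t(1) by (simp add: divide_ennreal flip: ennreal_1)
        have 2: "ennreal (1 / m) * ennreal (g j) = ennreal (1 / m * g j)" "ennreal (\<kappa> j) * ennreal w2 = ennreal (\<kappa> j * w2)"
          by (rule ennreal_mult[symmetric]; use m(1) g0[of j] k0[of j] w2 in simp)+
        have 3: "1 / m * g j \<ge> 0" "\<kappa> j * w2 \<ge> 0" using m(1) g0[of j] k0[of j] w2 by auto
        have 4: "2 * ennreal (1 / m * g j) + 2 * ennreal (\<kappa> j * w2) = ennreal (2 * (1 / m * g j) + 2 * (\<kappa> j * w2))"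
          unfolding two[OF 3(1)] two[OF 3(2)] by (rule ennreal_plus[symmetric]) (use 3 in auto)
        show ?thesis unfolding 1 2 4 b_def
          by (rule ennreal_mult[symmetric]) (use 3 t(1) in auto)
      qed
      finally show ?thesis .
    qed
    hence "(\<lambda>j. lorentz_norm n 1 W (?D (\<psi> j))) \<longlonglongrightarrow> 0"
      using blim by (rule tendsto_0_ennreal_le)
    thus ?thesis using sup by blast
  qed
  show "(\<lambda>j. SUP x\<in>closure W. ennreal \<bar>\<psi> j x\<bar>) \<longlonglongrightarrow> 0"
    and "(\<lambda>j. lorentz_norm (real DIM('a)) 1 W (?D (\<psi> j))) \<longlonglongrightarrow> 0"
    using main unfolding n_def by auto
qed

section \<open>Powers of the distance to a point\<close>

text \<open>The superlevel set at \<open>l\<close> is the ball of radius \<open>l^(-1/m)\<close>, cut off by \<open>\<Omega>\<close>. Its weight behaves like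
  \<open>l^(-2/m)\<close> for large \<open>l\<close> (up to a logarithm if \<open>n = 2\<close>), which is integrable at infinity exactly when
  \<open>m < 2\<close>.\<close>

lemma inverse_power_in_lorentz_iff:
  fixes \<Omega> :: "'a::euclidean_space set"
  assumes n: "DIM('a) \<ge> 2" and Om: "open \<Omega>" "bounded \<Omega>" and a: "a \<in> \<Omega>" and m: "m > 0"
  shows "(\<lambda>x. inverse (ennreal (norm (x - a) powr m))) \<in> lorentz (real DIM('a) / 2) 1 \<Omega> \<longleftrightarrow> m < 2"
proof -
  define n where "n = real DIM('a)"
  have n2: "n \<ge> 2" using n unfolding n_def by simp
  define w where "w = unit_ball_vol n"
  have w: "w > 0" unfolding w_def using n2 by simp
  define P where "P = (\<lambda>x. inverse (ennreal (norm (x - a) powr m)))"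
  have Pm: "P \<in> borel_measurable (lebesgue_on \<Omega>)"
    unfolding P_def by (rule measurable_lebesgue_onI) measurable
  have OL: "\<Omega> \<in> sets lebesgue" using Om by auto
  define T where "T = measure lborel \<Omega>"
  have T: "emeasure lborel \<Omega> = ennreal T" "T \<ge> 0"
    using emeasure_bounded_finite[OF Om(2)] by (simp_all add: T_def emeasure_eq_ennreal_measure)
  have Tpos: "T > 0"
  proof -
    have "emeasure lborel \<Omega> \<noteq> 0" using Om(1) a open_not_negligible[of \<Omega>]
      by (auto simp: negligible_iff_null_sets null_sets_def)
    thus ?thesis using T by (cases "T = 0") auto
  qed
  have eT: "emeasure lebesgue \<Omega> = ennreal T" "measure lebesgue \<Omega> = T" using T Om(1) by (simp_all add: T_def)
  have iff: "P \<in> lorentz (n/2) 1 \<Omega> \<longleftrightarrow> lorentz_int (n/2) T \<Omega> P < \<infinity>"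
  proof -
    have "P \<in> lorentz (n/2) 1 \<Omega> \<longleftrightarrow> ennreal (1 / T) * lorentz_int (n/2) T \<Omega> P < \<infinity>"
      unfolding lorentz_def using Pm Tpos
      by (simp add: lorentz_norm_1_eq[OF Pm OL] lorentz_int_def eT divide_ennreal flip: ennreal_1)
    also have "\<dots> \<longleftrightarrow> lorentz_int (n/2) T \<Omega> P < \<infinity>"
      using Tpos by (auto simp: ennreal_mult_less_top)
    finally show ?thesis .
  qed
  have Plev: "ennreal l < P x \<longleftrightarrow> x \<in> ball a (l powr (-1/m))" if l: "l > 0" for l x
  proof (cases "x = a")
    case True
    thus ?thesis using l by (simp add: P_def)
  next
    case False
    define d where "d = norm (x - a)"
    have d: "d > 0" unfolding d_def using False by simp
    have "P x = ennreal (d powr (-m))"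
      unfolding P_def d_def[symmetric] using d by (simp add: inverse_ennreal powr_minus)
    hence "ennreal l < P x \<longleftrightarrow> l < d powr (-m)" using l by (simp add: ennreal_less_iff)
    also have "\<dots> \<longleftrightarrow> d < l powr (-1/m)"
    proof
      assume "l < d powr (-m)"
      hence "(d powr (-m)) powr (-1/m) < l powr (-1/m)"
        using l m by (intro powr_less_mono2_neg) auto
      thus "d < l powr (-1/m)" using d m by (simp add: powr_powr)
    next
      assume "d < l powr (-1/m)"
      hence "(l powr (-1/m)) powr (-m) < d powr (-m)"
        using d m by (intro powr_less_mono2_neg) auto
      thus "l < d powr (-m)" using l m by (simp add: powr_powr)
    qed
    finally show ?thesis by (simp add: d_def dist_norm norm_minus_commute)
  qed
  have dist_eq: "distr_fun \<Omega> P l = emeasure lborel (\<Omega> \<inter> ball a (l powr (-1/m)))" if l: "l > 0" for l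
  proof -
    have "{x\<in>\<Omega>. ennreal l < P x} = \<Omega> \<inter> ball a (l powr (-1/m))" using Plev[OF l] by blast
    thus ?thesis unfolding distr_fun_def using Om(1) by (simp add: open_Int)
  qed
  have ballv: "emeasure lborel (ball a (l powr (-1/m))) = ennreal (w * l powr (-n/m))" if l: "l > 0" for l
  proof -
    have "(l powr (-1/m)) ^ DIM('a) = (l powr (-1/m)) powr n"
      using l unfolding n_def by (simp add: powr_realpow)
    also have "\<dots> = l powr (-n/m)" unfolding powr_powr by simp
    finally show ?thesis by (simp add: emeasure_ball w_def n_def)
  qed
  have dist_le: "distr_fun \<Omega> P l \<le> ennreal (w * l powr (-n/m))" if l: "l > 0" for l
    unfolding dist_eq[OF l] ballv[OF l, symmetric] using Om(1) by (intro emeasure_mono) auto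
  show ?thesis
  proof (cases "m < 2")
    case True
    \<comment> \<open>The midpoint of \<open>m/n\<close> and \<open>2/n\<close>: below \<open>2/n\<close> for the weight bound, above \<open>m/n\<close> for integrability at infinity.\<close>
    define b where "b = (m + 2) / (2 * n)"
    have b: "0 < b" "b \<le> 1" "b < 1 / (n/2)" "n * b / m > 1"
      using n2 m True unfolding b_def by (auto simp: field_simps)
    define c where "c = T powr (1/(n/2) - b) / (1/(n/2) - b)"
    have c: "c \<ge> 0" unfolding c_def using b by simp
    obtain w1 where w1: "w1 \<ge> 0" "lorentz_weight (n/2) T (ennreal T) = ennreal w1"
      using lorentz_weight_finite[of "n/2" T T] n2 T(2) by auto
    have "lorentz_int (n/2) T \<Omega> P \<le> (\<integral>\<^sup>+ l. ennreal w1 * indicator {0..1} l + ennreal (c * w powr b) * (ennreal (l powr (-(n * b / m))) * indicator {1..} l) \<partial>lborel)"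
      unfolding lorentz_int_def
    proof (rule nn_integral_mono)
      fix l :: real
      consider "l \<le> 0" | "0 < l" "l \<le> 1" | "l > 1" by linarith
      thus "lorentz_weight (n/2) T (distr_fun \<Omega> P l) * indicator {0<..} l
         \<le> ennreal w1 * indicator {0..1} l + ennreal (c * w powr b) * (ennreal (l powr (-(n * b / m))) * indicator {1..} l)"
      proof cases
        case 1
        hence "indicator {0<..} l = (0::ennreal)" by simp
        thus ?thesis by simp
      next
        case 2
        have "distr_fun \<Omega> P l \<le> ennreal T"
          unfolding dist_eq[OF 2(1)] T(1)[symmetric] using Om(1) by (intro emeasure_mono) auto
        hence "lorentz_weight (n/2) T (distr_fun \<Omega> P l) \<le> ennreal w1"
          unfolding w1(2)[symmetric] by (rule lorentz_weight_mono)
        thus ?thesis using 2 by (simp add: add_increasing2)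
      next
        case 3
        have "lorentz_weight (n/2) T (distr_fun \<Omega> P l) \<le> lorentz_weight (n/2) T (ennreal (w * l powr (-n/m)))"
          by (rule lorentz_weight_mono[OF dist_le]) (use 3 in simp)
        also have "\<dots> \<le> ennreal c * ennreal ((w * l powr (-n/m)) powr b)"
          unfolding c_def by (rule lorentz_weight_le_powr) (use b n2 T w in auto)
        also have "(w * l powr (-n/m)) powr b = w powr b * l powr (-(n * b / m))"
          using w by (simp add: powr_mult powr_powr)
        also have "ennreal c * ennreal (w powr b * l powr (-(n * b / m))) = ennreal (c * w powr b) * ennreal (l powr (-(n * b / m)))"
          using c by (simp add: ennreal_mult mult.assoc)
        finally show ?thesis using 3 by simp
      qed
    qed
    also have "\<dots> = ennreal w1 * emeasure lborel {0..1::real} + ennreal (c * w powr b) * ennreal (1 powr (1 - n * b / m) / (n * b / m - 1))"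
      by (subst nn_integral_add) (simp_all add: nn_integral_cmult nn_integral_powr_to_infinity[OF b(4)])
    also have "\<dots> < \<infinity>" by (simp add: ennreal_mult_less_top)
    finally show ?thesis using iff True unfolding P_def n_def by simp
  next
    case False
    obtain r where r: "r > 0" "ball a r \<subseteq> \<Omega>" using Om(1) a openE by blast
    \<comment> \<open>From this level on the superlevel set is a full ball inside \<open>\<Omega>\<close>, and \<open>1/l \<le> l^(-2/m)\<close> because \<open>m \<ge> 2\<close>.\<close>
    define l0 where "l0 = max 1 (r powr (-m))"
    have l0: "l0 > 0" unfolding l0_def by simp
    define k where "k = n / 2 * w powr (2 / n)"
    have k: "k > 0" unfolding k_def using n2 w by simp
    have low: "ennreal k * ennreal (1 / l) \<le> lorentz_weight (n/2) T (distr_fun \<Omega> P l)" if l: "l \<ge> l0" for l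
    proof -
      have l1: "l \<ge> 1" "l \<ge> r powr (-m)" "l > 0" using l l0 unfolding l0_def by auto
      have "l powr (-1/m) \<le> (r powr (-m)) powr (-1/m)"
        using l1 r m by (intro powr_mono2') auto
      hence "l powr (-1/m) \<le> r" using r m by (simp add: powr_powr)
      hence "ball a (l powr (-1/m)) \<subseteq> \<Omega>" using r(2) subset_ball by blast
      hence d: "distr_fun \<Omega> P l = ennreal (w * l powr (-n/m))"
        unfolding dist_eq[OF l1(3)] ballv[OF l1(3), symmetric] by (simp add: Int_absorb1)
      have "ennreal (w * l powr (-n/m)) \<le> ennreal T"
        unfolding d[symmetric] dist_eq[OF l1(3)] T(1)[symmetric] using Om(1) by (intro emeasure_mono) auto
      hence sT: "w * l powr (-n/m) \<le> T" using T(2) by simp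
      have "k * (1 / l) \<le> n / 2 * (w * l powr (-n/m)) powr (1 / (n/2))"
      proof -
        have "(w * l powr (-n/m)) powr (1 / (n/2)) = w powr (2/n) * l powr (-2/m)"
          using w n2 m by (simp add: powr_mult powr_powr)
        moreover have "1 / l \<le> l powr (-2/m)"
        proof -
          have "l powr (-1) \<le> l powr (-2/m)"
            using l1 False m by (intro powr_mono) (auto simp: field_simps)
          thus ?thesis using l1 by (simp add: powr_minus inverse_eq_divide)
        qed
        moreover from this have "k * (1 / l) \<le> k * l powr (-2/m)"
          using k by (intro mult_left_mono) auto
        ultimately show ?thesis unfolding k_def by (simp only: mult.assoc)
      qed
      hence "ennreal k * ennreal (1 / l) \<le> ennreal (n / 2 * (w * l powr (-n/m)) powr (1 / (n/2)))"
        using k by (subst ennreal_mult'[symmetric]) (auto intro: ennreal_leI simp: l1)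
      also have "\<dots> \<le> lorentz_weight (n/2) T (ennreal (w * l powr (-n/m)))"
        by (rule lorentz_weight_ge_powr) (use n2 w sT in auto)
      finally show ?thesis unfolding d .
    qed
    have "ennreal k * (\<integral>\<^sup>+ l\<in>{l0..}. ennreal (1 / l) \<partial>lborel) = (\<integral>\<^sup>+ l. ennreal k * (ennreal (1 / l) * indicator {l0..} l) \<partial>lborel)"
      by (rule nn_integral_cmult[symmetric]) measurable
    also have "\<dots> \<le> lorentz_int (n/2) T \<Omega> P"
      unfolding lorentz_int_def
    proof (rule nn_integral_mono)
      fix l :: real
      show "ennreal k * (ennreal (1 / l) * indicator {l0..} l) \<le> lorentz_weight (n/2) T (distr_fun \<Omega> P l) * indicator {0<..} l"
        using low[of l] l0 by (cases "l \<ge> l0") simp_all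
    qed
    finally have "lorentz_int (n/2) T \<Omega> P = \<infinity>"
      unfolding nn_integral_inverse_to_infinity[OF l0] using k by (simp add: ennreal_mult_top top_unique)
    thus ?thesis using iff False unfolding P_def n_def by simp
  qed
qed

section \<open>Vanishing capacity\<close>

text \<open>If \<open>v = \<infinity>\<close>, the hypothesis holds for every \<open>a\<close>, and the conclusion rests on \<open>e > 0\<close>.\<close>

lemma quotient_le_imp_le_mult:
  fixes v :: ennreal
  assumes "ennreal a / v \<le> ennreal e" "e > 0"
  shows "ennreal a \<le> ennreal e * v"
proof -
  consider "v = 0" | "v = \<infinity>" | r where "v = ennreal r" "r > 0"
    by (cases v) (auto simp: le_less)
  thus ?thesis
  proof cases
    case 1
    have "ennreal a = 0"
    proof (rule ccontr)
      assume "ennreal a \<noteq> 0"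
      hence "ennreal a / v = \<infinity>" unfolding 1 by (simp add: divide_ennreal_def ennreal_mult_eq_top_iff)
      thus False using assms(1) by (simp add: top_unique)
    qed
    thus ?thesis by simp
  next
    case 2
    thus ?thesis using assms(2) by (simp add: ennreal_mult_top)
  next
    case 3
    have "ennreal a = ennreal a / v * v"
      using 3 by (simp add: divide_ennreal_def mult.assoc ennreal_mult[symmetric] inverse_ennreal)
    also have "\<dots> \<le> ennreal e * v" by (rule mult_right_mono[OF assms(1)]) simp
    finally show ?thesis .
  qed
qed

lemma away_from_compact: "compact K \<Longrightarrow> away_from \<Omega> K = \<Omega> - K"
  unfolding away_from_def using in_closed_iff_infdist_zero[of K] infdist_nonneg[of _ K]
  by (auto simp: compact_imp_closed less_le)

text \<open>The sum of the \<open>\<psi>\<^sub>j\<close> has finite integral, so it converges almost everywhere.\<close>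

lemma AE_tendsto_0_of_summable_L1:
  fixes \<psi> :: "nat \<Rightarrow> 'a \<Rightarrow> real"
  assumes [measurable]: "\<And>j. \<psi> j \<in> borel_measurable M" and nn: "\<And>j x. 0 \<le> \<psi> j x"
    and le: "\<And>j. (\<integral>\<^sup>+ x. ennreal (\<psi> j x) \<partial>M) \<le> ennreal (a j)" and a: "summable a" "\<And>j. 0 \<le> a j"
  shows "AE x in M. (\<lambda>j. \<psi> j x) \<longlonglongrightarrow> 0"
proof -
  have "(\<integral>\<^sup>+ x. (\<Sum>j. ennreal (\<psi> j x)) \<partial>M) = (\<Sum>j. \<integral>\<^sup>+ x. ennreal (\<psi> j x) \<partial>M)"
    by (rule nn_integral_suminf) measurable
  also have "\<dots> \<le> (\<Sum>j. ennreal (a j))" by (intro suminf_le le) auto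
  also have "\<dots> = ennreal (\<Sum>j. a j)" by (rule suminf_ennreal2[OF a(2,1)])
  also have "\<dots> < \<infinity>" by simp
  finally have "AE x in M. (\<Sum>j. ennreal (\<psi> j x)) \<noteq> \<infinity>"
    by (intro nn_integral_noteq_infinite) auto
  thus ?thesis
  proof eventually_elim
    case (elim x)
    have "summable (\<lambda>j. \<psi> j x)"
      by (rule summable_suminf_not_top) (use nn elim in auto)
    thus ?case by (rule summable_LIMSEQ_zero)
  qed
qed

theorem theorem1:
  fixes \<Omega> :: "(real ^ 'n) set"
  assumes "CARD('n) \<ge> 2"
    and "smooth_bounded_domain \<Omega>"
  shows
    "(\<forall>(V :: real ^ 'n \<Rightarrow> ennreal) K.
        potential \<Omega> V \<and> compact K \<and> K \<subseteq> \<Omega> \<and> Cap_inf \<Omega> V K = 0 \<longrightarrow>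
        (\<exists>\<psi> :: nat \<Rightarrow> real ^ 'n \<Rightarrow> real.
           (\<forall>j. \<psi> j \<in> C2c \<Omega>) \<and>
           (AE x in lebesgue_on \<Omega>. (\<lambda>j. \<psi> j x) \<longlonglongrightarrow> 0) \<and>
           (\<lambda>j. L1_norm \<Omega> (\<psi> j)) \<longlonglongrightarrow> 0 \<and>
           (\<forall>j. \<forall>x\<in>K. \<psi> j x = 1) \<and>
           Linf_tendsto_0 \<Omega> (\<lambda>j. grad_quot V (\<psi> j)) \<and>
           Linf_tendsto_0 \<Omega> (\<lambda>j. lap_quot V (\<psi> j)) \<and>
           (V \<in> lorentz_loc (real CARD('n) / 2) 1 (away_from \<Omega> K) \<longrightarrow>
              (\<forall>x\<in>\<Omega> - K. (\<lambda>j. \<psi> j x) \<longlonglongrightarrow> 0) \<and>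
              (\<forall>W. open W \<and> compactly_inside W (away_from \<Omega> K) \<longrightarrow>
                 (\<lambda>j. SUP x\<in>closure W. ennreal \<bar>\<psi> j x\<bar>) \<longlonglongrightarrow> 0 \<and>
                 (\<lambda>j. lorentz_norm (real CARD('n)) 1 W (\<lambda>x. ennreal (norm (gradient (\<psi> j) x))))
                    \<longlonglongrightarrow> 0)))) \<and>
     (\<forall>a\<in>\<Omega>. \<forall>m>0.
        (\<lambda>x. inverse (ennreal (norm (x - a) powr m))) \<in> lorentz (real CARD('n) / 2) 1 \<Omega> \<longleftrightarrow> m < 2)"
proof -
  have dim: "DIM(real^'n) = CARD('n)" by simp
  have n: "DIM(real^'n) \<ge> 2" using assms(1) by simp
  have Om: "open \<Omega>" "bounded \<Omega>" using assms(2) unfolding smooth_bounded_domain_def by auto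
  have part3: "\<forall>a\<in>\<Omega>. \<forall>m>0. (\<lambda>x. inverse (ennreal (norm (x - a) powr m))) \<in> lorentz (real CARD('n) / 2) 1 \<Omega> \<longleftrightarrow> m < 2"
    using inverse_power_in_lorentz_iff[OF n Om] unfolding dim by blast
  show ?thesis
  proof (intro conjI[OF _ part3] allI impI, goal_cases)
    case (1 V K)
    hence K: "compact K" "K \<subseteq> \<Omega>" and cap: "Cap_inf \<Omega> V K = 0" by auto
    define \<epsilon> :: "nat \<Rightarrow> real" where "\<epsilon> = (\<lambda>j. (1/2) ^ j)"
    have e: "\<epsilon> j > 0" for j unfolding \<epsilon>_def by simp
    have esum: "summable \<epsilon>" unfolding \<epsilon>_def by (rule summable_geometric) simp
    have elim: "\<epsilon> \<longlonglongrightarrow> 0" by (rule summable_LIMSEQ_zero[OF esum])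
    have "\<exists>\<phi>\<in>B2 \<Omega> K. V_inf_norm \<Omega> V \<phi> < ennreal (\<epsilon> j)" for j
    proof -
      have "Cap_inf \<Omega> V K < ennreal (\<epsilon> j)" using cap e by simp
      thus ?thesis unfolding Cap_inf_def INF_less_iff .
    qed
    then obtain \<psi> where \<psi>: "\<And>j. \<psi> j \<in> B2 \<Omega> K" "\<And>j. V_inf_norm \<Omega> V (\<psi> j) < ennreal (\<epsilon> j)" by metis
    have C2c: "\<psi> j \<in> C2c \<Omega>" and p01: "0 \<le> \<psi> j x \<and> \<psi> j x \<le> 1" for j x
      using \<psi>(1)[of j] unfolding B2_def by auto
    have p1: "\<psi> j x = 1" if "x \<in> K" for j x
      using \<psi>(1)[of j] that unfolding B2_def by blast
    have C2: "Ck_on 2 (\<psi> j) UNIV" for j using C2c[of j] unfolding C2c_def by simp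
    have L1: "L1_norm \<Omega> (\<psi> j) \<le> ennreal (\<epsilon> j)"
      and Lg: "Linf_norm \<Omega> (grad_quot V (\<psi> j)) \<le> ennreal (\<epsilon> j)"
      and Ll: "Linf_norm \<Omega> (lap_quot V (\<psi> j)) \<le> ennreal (\<epsilon> j)" for j
    proof -
      have le: "x \<le> x + y + z" "y \<le> x + y + z" "z \<le> x + y + z" for x y z :: ennreal
        by (simp_all add: add_increasing2 add_increasing)
      show "L1_norm \<Omega> (\<psi> j) \<le> ennreal (\<epsilon> j)" "Linf_norm \<Omega> (grad_quot V (\<psi> j)) \<le> ennreal (\<epsilon> j)"
        "Linf_norm \<Omega> (lap_quot V (\<psi> j)) \<le> ennreal (\<epsilon> j)"
        using order_trans[OF le(1) less_imp_le[OF \<psi>(2)[of j, unfolded V_inf_norm_def]]]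
          order_trans[OF le(2) less_imp_le[OF \<psi>(2)[of j, unfolded V_inf_norm_def]]]
          order_trans[OF le(3) less_imp_le[OF \<psi>(2)[of j, unfolded V_inf_norm_def]]] by blast+
    qed
    have ae: "AE x in lebesgue_on \<Omega>. (\<lambda>j. \<psi> j x) \<longlonglongrightarrow> 0"
    proof (rule AE_tendsto_0_of_summable_L1[OF _ _ _ esum])
      show "\<psi> j \<in> borel_measurable (lebesgue_on \<Omega>)" for j
        using Ck_on_2_D(4)[OF C2] by (intro measurable_lebesgue_onI borel_measurable_continuous_onI)
      show "(\<integral>\<^sup>+ x. ennreal (\<psi> j x) \<partial>lebesgue_on \<Omega>) \<le> ennreal (\<epsilon> j)" for j
        using L1[of j] p01 unfolding L1_norm_def by (simp add: abs_of_nonneg)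
    qed (use p01 e in \<open>auto intro: less_imp_le\<close>)
    have Linf: "Linf_tendsto_0 \<Omega> (\<lambda>j. grad_quot V (\<psi> j))" "Linf_tendsto_0 \<Omega> (\<lambda>j. lap_quot V (\<psi> j))"
      unfolding Linf_tendsto_0_def
      using tendsto_0_ennreal_le[OF Lg elim] tendsto_0_ennreal_le[OF Ll elim]
        le_less_trans[OF Lg ennreal_less_top] le_less_trans[OF Ll ennreal_less_top] by auto
    have gradle: "AE x in lebesgue_on \<Omega>. ennreal (norm (gradient (\<psi> j) x)) \<le> ennreal (\<epsilon> j) * enn_powr (V x) (1/2)" for j
      using esssup_AE[of "grad_quot V (\<psi> j)" "lebesgue_on \<Omega>"]
    proof eventually_elim
      case (elim x)
      hence "grad_quot V (\<psi> j) x \<le> ennreal (\<epsilon> j)" using Lg[of j] unfolding Linf_norm_def by (rule order_trans)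
      thus ?case unfolding grad_quot_def by (rule quotient_le_imp_le_mult) (rule e)
    qed
    have laple: "AE x in lebesgue_on \<Omega>. ennreal \<bar>laplacian (\<psi> j) x\<bar> \<le> ennreal (\<epsilon> j) * V x" for j
      using esssup_AE[of "lap_quot V (\<psi> j)" "lebesgue_on \<Omega>"]
    proof eventually_elim
      case (elim x)
      hence "lap_quot V (\<psi> j) x \<le> ennreal (\<epsilon> j)" using Ll[of j] unfolding Linf_norm_def by (rule order_trans)
      thus ?case unfolding lap_quot_def by (rule quotient_le_imp_le_mult) (rule e)
    qed
    have U: "away_from \<Omega> K = \<Omega> - K" by (rule away_from_compact[OF K(1)])
    have U1: "open (\<Omega> - K)" "\<Omega> - K \<subseteq> \<Omega>" using Om(1) K(1) by (auto intro: open_Diff compact_imp_closed)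
    have loc: "(\<lambda>j. SUP x\<in>closure W. ennreal \<bar>\<psi> j x\<bar>) \<longlonglongrightarrow> 0"
      "(\<lambda>j. lorentz_norm (real CARD('n)) 1 W (\<lambda>x. ennreal (norm (gradient (\<psi> j) x)))) \<longlonglongrightarrow> 0"
      if "V \<in> lorentz_loc (real CARD('n) / 2) 1 (\<Omega> - K)" "open W" "compactly_inside W (\<Omega> - K)" for W
      using local_convergence[OF n C2 p01 U1 Om(1) e elim gradle laple L1 _ that(2,3)] that(1) unfolding dim by blast+
    have pw: "(\<lambda>j. \<psi> j x) \<longlonglongrightarrow> 0"
      if V: "V \<in> lorentz_loc (real CARD('n) / 2) 1 (\<Omega> - K)" and x: "x \<in> \<Omega> - K" for x
    proof -
      obtain W where W: "open W" "{x} \<subseteq> W" "compactly_inside W (\<Omega> - K)"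
        using compact_open_neighbourhood[of "{x}" "\<Omega> - K"] U1 x by auto
      have xc: "x \<in> closure W" using W(2) closure_subset by blast
      have "(\<lambda>j. ennreal (\<psi> j x)) \<longlonglongrightarrow> 0"
      proof (rule tendsto_sandwich[of "\<lambda>_. 0" _ sequentially "\<lambda>j. SUP x\<in>closure W. ennreal \<bar>\<psi> j x\<bar>"])
        have "ennreal (\<psi> j x) \<le> (SUP x\<in>closure W. ennreal \<bar>\<psi> j x\<bar>)" for j
          using SUP_upper[OF xc, of "\<lambda>x. ennreal \<bar>\<psi> j x\<bar>"] p01[of j x] by simp
        thus "\<forall>\<^sub>F j in sequentially. ennreal (\<psi> j x) \<le> (SUP x\<in>closure W. ennreal \<bar>\<psi> j x\<bar>)" by simp
      qed (use loc(1)[OF V W(1,3)] in auto)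
      thus ?thesis using tendsto_ennreal_iff[of "\<lambda>j. \<psi> j x" sequentially 0] p01 by simp
    qed
    show ?case
      using C2c ae tendsto_0_ennreal_le[OF L1 elim] p1 Linf loc pw unfolding U by (intro exI[of _ \<psi>]) blast
  qed
qed

end
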